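(* Let $(\Omega,\Sigma,\mu)$ be a measure space with the direct sum property and let $(S,\Xi,\nu)$ be a measure space. Let $k(t,s,\omega)$ be a complex-valued measurable function on $S^2\times\Omega$ such that $$\int_S\int_S|k(t,s,\omega)|^2\,d\nu(t)\,d\nu(s)\in L^\infty(\Omega)\qquad\text{and}\qquad k(t,s,\omega)=\overline{k(s,t,\omega)},$$ and let $T:L^{2,\infty}(S\times\Omega)\to L^{2,\infty}(S\times\Omega)$ be the operator $$T(f)(t,\omega)=\int_Sk(t,s,\omega)f(s,\omega)\,d\nu(s).$$ Then there exist a measurable partition $\{\Omega_0,\Omega_1,\ldots,\Omega_k,\ldots,\Omega_\infty\}$ of $\Omega$ and, for every $k\in\{1,2,\ldots\}\cup\{\infty\}$, an orthonormal family $\{g_{k,n}\}_{n=1}^{k}$ in $\chi_{\Omega_k}L^{2,\infty}(S\times\Omega)$ and a family $\{\lambda_{k,n}\}_{n=1}^{k}$ in $\chi_{\Omega_k}L^\infty(\Omega)$ (for $k=\infty$ the index $n$ runs over all of $\{1,2,\ldots\}$) such that: (1) $\chi_{\Omega_0}T=0$; (2) $\chi_{\Omega_\infty}|\lambda_{\infty,n}|\downarrow0$ as $n\to\infty$; (3) for every $f\in L^{2,\infty}(S\times\Omega)$, $$T(f)=\chi_{\Omega_\infty}\sum_{n=1}^\infty\lambda_{\infty,n}\langle f,g_{\infty,n}\rangle g_{\infty,n}+\sum_{k=1}^\infty\chi_{\Omega_k}\sum_{n=1}^k\lambda_{k,n}\langle f,g_{k,n}\rangle g_{k,n}.$$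
   Context: Direct sum property of $\mu$: there is a family $\{\Omega_i'\}_{i\in J}\subset\Sigma$ with $0<\mu(\Omega_i')<+\infty$ such that for every $A\in\Sigma$ with $\mu(A)<+\infty$ there are a countable $J_0\subset J$ and a null set $B$ with $A=\bigcup_{i\in J_0}(A\cap\Omega_i')\cup B$. $L^\infty(\Omega)$ is the algebra of (classes of) bounded complex measurable functions on $\Omega$. $L^{2,\infty}(S\times\Omega)$ is the space of (a.e.-equivalence classes of) complex measurable functions $f$ on $S\times\Omega$ with $\int_S|f(s,\omega)|^2\,d\nu(s)\in L^\infty(\Omega)$. It is an $L^\infty(\Omega)$-module (with $(af)(s,\omega)=a(\omega)f(s,\omega)$) with the $L^\infty(\Omega)$-valued inner product $\langle f,g\rangle(\omega)=\int_Sf(s,\omega)\overline{g(s,\omega)}\,d\nu(s)$. $\chi_A$ denotes the indicator function of $A\subset\Omega$; members of the partition may be null sets. A family in $\chi_{\Omega_k}L^{2,\infty}(S\times\Omega)$ is orthonormal if $\langle g_{k,n},g_{k,m}\rangle=0$ for $n\ne m$ and $\langle g_{k,n},g_{k,n}\rangle=\chi_{\Omega_k}$. The notation $h_n\downarrow0$ means that $(h_n)$ is a decreasing sequence in $L^\infty(\Omega)$ with infimum $0$. Infinite sums are understood as follows: the partial sums converge in the $L^\infty(\Omega)$-valued norm $\|f\|=\sqrt{\langle f,f\rangle}$ almost everywhere on $\Omega$; the outer sum over $k$ is over the disjoint sets $\Omega_k$. (The letter $k$ denotes both the kernel $k(t,s,\omega)$ and an index.) *)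

theory Defs
  imports "HOL-Analysis.Analysis" "HOL-Library.Extended_Nat"
begin

text \<open>
  Throughout, \<open>M\<close> is the measure space \<open>\<Omega>\<close> (with measure \<open>\<mu>\<close>) and \<open>S\<close> is the second measure space
  (with measure \<open>\<nu>\<close>). Elements of function spaces are represented by measurable functions,
  and equality of classes is stated explicitly as equality almost everywhere.
\<close>

text \<open>The family is given by its set of members; no disjointness is required.\<close>

definition direct_sum_property :: "'w measure \<Rightarrow> bool" where
  "direct_sum_property M \<longleftrightarrow>
     (\<exists>F. F \<subseteq> sets M \<and> (\<forall>D\<in>F. 0 < emeasure M D \<and> emeasure M D < \<infinity>) \<and>
       (\<forall>A\<in>sets M. emeasure M A < \<infinity> \<longrightarrow>
          (\<exists>F0 B. F0 \<subseteq> F \<and> countable F0 \<and> B \<in> null_sets M \<and> A = (\<Union>D\<in>F0. A \<inter> D) \<union> B)))"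

definition Linf :: "'w measure \<Rightarrow> ('w \<Rightarrow> 'b::real_normed_vector) set" where
  "Linf M = {a \<in> borel_measurable M. \<exists>C. AE w in M. norm (a w) \<le> C}"

text \<open>
  Membership in \<open>L\<^sup>\<infinity>\<close> for functions given by integrals of nonnegative functions, which may be
  infinite on a null set.
\<close>

definition nn_Linf :: "'w measure \<Rightarrow> ('w \<Rightarrow> ennreal) \<Rightarrow> bool" where
  "nn_Linf M h \<longleftrightarrow> h \<in> borel_measurable M \<and> (\<exists>C::real. AE w in M. h w \<le> ennreal C)"

definition L2inf :: "'s measure \<Rightarrow> 'w measure \<Rightarrow> ('s \<times> 'w \<Rightarrow> complex) set" where
  "L2inf S M = {f \<in> borel_measurable (S \<Otimes>\<^sub>M M).
     nn_Linf M (\<lambda>w. \<integral>\<^sup>+s. ennreal ((cmod (f (s, w)))\<^sup>2) \<partial>S)}"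

text \<open>
  Almost everywhere equality on \<open>S \<times> \<Omega>\<close>, phrased through sections: neither measure has to be
  \<open>\<sigma>\<close>-finite, so the null sets of the library's product measure are not the intended ones. This is
  exactly the relation \<open>\<langle>f - g, f - g\<rangle> = 0\<close> in \<open>L\<^sup>\<infinity>(\<Omega>)\<close>.
\<close>

definition L2inf_eq :: "'s measure \<Rightarrow> 'w measure \<Rightarrow> ('s \<times> 'w \<Rightarrow> complex) \<Rightarrow> ('s \<times> 'w \<Rightarrow> complex) \<Rightarrow> bool" where
  "L2inf_eq S M f g \<longleftrightarrow> (AE w in M. AE s in S. f (s, w) = g (s, w))"

definition L2inf_scale :: "('w \<Rightarrow> complex) \<Rightarrow> ('s \<times> 'w \<Rightarrow> complex) \<Rightarrow> ('s \<times> 'w \<Rightarrow> complex)" where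
  "L2inf_scale a f = (\<lambda>(s, w). a w * f (s, w))"

definition L2inf_inner :: "'s measure \<Rightarrow> ('s \<times> 'w \<Rightarrow> complex) \<Rightarrow> ('s \<times> 'w \<Rightarrow> complex) \<Rightarrow> ('w \<Rightarrow> complex)" where
  "L2inf_inner S f g = (\<lambda>w. \<integral>s. f (s, w) * cnj (g (s, w)) \<partial>S)"

definition L2inf_norm :: "'s measure \<Rightarrow> ('s \<times> 'w \<Rightarrow> complex) \<Rightarrow> ('w \<Rightarrow> real)" where
  "L2inf_norm S f = (\<lambda>w. sqrt (Re (L2inf_inner S f f w)))"

definition L2inf_orthonormal ::
  "'s measure \<Rightarrow> 'w measure \<Rightarrow> 'w set \<Rightarrow> nat set \<Rightarrow> (nat \<Rightarrow> 's \<times> 'w \<Rightarrow> complex) \<Rightarrow> bool" where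
  "L2inf_orthonormal S M A I g \<longleftrightarrow>
     (\<forall>n\<in>I. g n \<in> L2inf_scale (indicator A) ` L2inf S M) \<and>
     (\<forall>n\<in>I. \<forall>m\<in>I. n \<noteq> m \<longrightarrow> (AE w in M. L2inf_inner S (g n) (g m) w = 0)) \<and>
     (\<forall>n\<in>I. AE w in M. L2inf_inner S (g n) (g n) w = indicator A w)"

text \<open>The series \<open>u 1 + u 2 + \<dots>\<close> has sum \<open>F\<close>.\<close>

definition L2inf_sums ::
  "'s measure \<Rightarrow> 'w measure \<Rightarrow> (nat \<Rightarrow> 's \<times> 'w \<Rightarrow> complex) \<Rightarrow> ('s \<times> 'w \<Rightarrow> complex) \<Rightarrow> bool" where
  "L2inf_sums S M u F \<longleftrightarrow>
     (\<forall>n\<ge>1. u n \<in> L2inf S M) \<and> F \<in> L2inf S M \<and>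
     (AE w in M. (\<lambda>N. L2inf_norm S (\<lambda>z. F z - (\<Sum>n=1..N. u n z)) w) \<longlonglongrightarrow> 0)"

text \<open>
  \<open>h n \<down> 0\<close> for the sequence \<open>h 1, h 2, \<dots>\<close>: order and infimum are those of (the real part of)
  \<open>L\<^sup>\<infinity>(\<Omega>)\<close>, i.e. inequalities hold almost everywhere.
\<close>

definition Linf_decreases_to_0 :: "'w measure \<Rightarrow> (nat \<Rightarrow> 'w \<Rightarrow> real) \<Rightarrow> bool" where
  "Linf_decreases_to_0 M h \<longleftrightarrow>
     (\<forall>n\<ge>1. h n \<in> Linf M) \<and>
     (\<forall>n\<ge>1. AE w in M. h (Suc n) w \<le> h n w) \<and>
     (\<forall>n\<ge>1. AE w in M. 0 \<le> h n w) \<and>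
     (\<forall>u\<in>Linf M. (\<forall>n\<ge>1. AE w in M. u w \<le> h n w) \<longrightarrow> (AE w in M. u w \<le> 0))"

definition kernel_op ::
  "'s measure \<Rightarrow> ('s \<times> 's \<times> 'w \<Rightarrow> complex) \<Rightarrow> ('s \<times> 'w \<Rightarrow> complex) \<Rightarrow> ('s \<times> 'w \<Rightarrow> complex)" where
  "kernel_op S k f = (\<lambda>(t, w). \<integral>s. k (t, s, w) * f (s, w) \<partial>S)"

text \<open>
  The second measure space is arbitrary. If it is not \<open>\<sigma>\<close>-finite, measurability of integrals
  depending on a parameter can fail, and then the objects of the theorem need not exist. That they
  do exist consists of three facts: the iterated integral of \<open>|k|\<^sup>2\<close> has a measurable
  inner integral, the inner product takes values in \<open>L\<^sup>\<infinity>(\<Omega>)\<close>, and the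
  kernel operator maps \<open>L\<^sup>2\<^sup>,\<^sup>\<infinity>\<close> to itself. For \<open>\<sigma>\<close>-finite \<open>S\<close> all three are automatic:
\<close>

lemma sigma_finite_inner_integral_measurable:
  assumes "sigma_finite_measure S" and k: "k \<in> borel_measurable (S \<Otimes>\<^sub>M (S \<Otimes>\<^sub>M M))"
  shows "(\<lambda>(s, w). \<integral>\<^sup>+t. ennreal ((cmod (k (t, s, w)))\<^sup>2) \<partial>S) \<in> borel_measurable (S \<Otimes>\<^sub>M M)"
proof -
  interpret sigma_finite_measure S by fact
  note k[measurable]
  show ?thesis by measurable
qed

lemma Cauchy_Schwarz_lintegral_complex:
  fixes f g :: "'s \<Rightarrow> complex"
  assumes [measurable]: "f \<in> borel_measurable S" "g \<in> borel_measurable S"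
  shows "ennreal ((cmod (\<integral>s. f s * g s \<partial>S))\<^sup>2) \<le>
    (\<integral>\<^sup>+s. ennreal ((cmod (f s))\<^sup>2) \<partial>S) * (\<integral>\<^sup>+s. ennreal ((cmod (g s))\<^sup>2) \<partial>S)"
proof (cases "integrable S (\<lambda>s. f s * g s)")
  case True
  have "ennreal (cmod (\<integral>s. f s * g s \<partial>S)) \<le> (\<integral>\<^sup>+s. ennreal (cmod (f s * g s)) \<partial>S)"
    using integral_norm_bound_ennreal[OF True] by simp
  then have "ennreal ((cmod (\<integral>s. f s * g s \<partial>S))\<^sup>2) \<le> (\<integral>\<^sup>+s. ennreal (cmod (f s)) * ennreal (cmod (g s)) \<partial>S)\<^sup>2"
    by (simp add: norm_mult ennreal_mult flip: ennreal_power) (rule power_mono; simp)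
  also have "\<dots> \<le> (\<integral>\<^sup>+s. (ennreal (cmod (f s)))\<^sup>2 \<partial>S) * (\<integral>\<^sup>+s. (ennreal (cmod (g s)))\<^sup>2 \<partial>S)"
    by (rule Cauchy_Schwarz_nn_integral) auto
  finally show ?thesis by (simp add: ennreal_power)
qed (simp add: not_integrable_integral_eq)

lemma measurable_cnj[measurable]: "cnj \<in> borel_measurable borel"
  by (intro borel_measurable_continuous_onI continuous_intros)

lemma sigma_finite_inner_Linf:
  assumes "sigma_finite_measure S" and f: "f \<in> L2inf S M" and g: "g \<in> L2inf S M"
  shows "L2inf_inner S f g \<in> Linf M"
proof -
  interpret sigma_finite_measure S by fact
  have [measurable]: "f \<in> borel_measurable (S \<Otimes>\<^sub>M M)" "g \<in> borel_measurable (S \<Otimes>\<^sub>M M)"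
    using f g by (auto simp: L2inf_def)
  obtain C D :: real where
    C: "AE w in M. (\<integral>\<^sup>+s. ennreal ((cmod (f (s, w)))\<^sup>2) \<partial>S) \<le> ennreal C" and
    D: "AE w in M. (\<integral>\<^sup>+s. ennreal ((cmod (g (s, w)))\<^sup>2) \<partial>S) \<le> ennreal D"
    using f g by (auto simp: L2inf_def nn_Linf_def)
  have "AE w in M. norm (L2inf_inner S f g w) \<le> sqrt (max 0 C * max 0 D)"
    using C D AE_space
  proof eventually_elim
    case (elim w)
    note \<open>w \<in> space M\<close>[measurable]
    have "ennreal ((cmod (L2inf_inner S f g w))\<^sup>2) \<le>
        (\<integral>\<^sup>+s. ennreal ((cmod (f (s, w)))\<^sup>2) \<partial>S) * (\<integral>\<^sup>+s. ennreal ((cmod (cnj (g (s, w))))\<^sup>2) \<partial>S)"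
      unfolding L2inf_inner_def by (rule Cauchy_Schwarz_lintegral_complex) measurable
    also have "\<dots> \<le> ennreal (max 0 C) * ennreal (max 0 D)"
      using elim by (intro mult_mono) (auto simp: ennreal_max_0)
    finally show ?case
      by (intro real_le_rsqrt) (simp flip: ennreal_mult)
  qed
  moreover have "L2inf_inner S f g \<in> borel_measurable M"
    unfolding L2inf_inner_def by measurable
  ultimately show ?thesis unfolding Linf_def by blast
qed

lemma sigma_finite_kernel_op_L2inf:
  assumes "sigma_finite_measure S" and k: "k \<in> borel_measurable (S \<Otimes>\<^sub>M (S \<Otimes>\<^sub>M M))"
    and k2: "nn_Linf M (\<lambda>w. \<integral>\<^sup>+s. \<integral>\<^sup>+t. ennreal ((cmod (k (t, s, w)))\<^sup>2) \<partial>S \<partial>S)"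
    and herm: "\<forall>t\<in>space S. \<forall>s\<in>space S. \<forall>w\<in>space M. k (t, s, w) = cnj (k (s, t, w))"
    and f: "f \<in> L2inf S M"
  shows "kernel_op S k f \<in> L2inf S M"
proof -
  interpret sigma_finite_measure S by fact
  note k[measurable]
  have [measurable]: "f \<in> borel_measurable (S \<Otimes>\<^sub>M M)"
    using f by (auto simp: L2inf_def)
  have T[measurable]: "kernel_op S k f \<in> borel_measurable (S \<Otimes>\<^sub>M M)"
    unfolding kernel_op_def by measurable
  obtain C D :: real where
    C: "AE w in M. (\<integral>\<^sup>+s. ennreal ((cmod (f (s, w)))\<^sup>2) \<partial>S) \<le> ennreal C" and
    D: "AE w in M. (\<integral>\<^sup>+s. \<integral>\<^sup>+t. ennreal ((cmod (k (t, s, w)))\<^sup>2) \<partial>S \<partial>S) \<le> ennreal D"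
    using f k2 by (auto simp: L2inf_def nn_Linf_def)
  have "AE w in M. (\<integral>\<^sup>+t. ennreal ((cmod (kernel_op S k f (t, w)))\<^sup>2) \<partial>S) \<le> ennreal (max 0 D * max 0 C)"
    using C D AE_space
  proof eventually_elim
    case (elim w)
    note \<open>w \<in> space M\<close>[measurable]
    let ?F = "\<integral>\<^sup>+s. ennreal ((cmod (f (s, w)))\<^sup>2) \<partial>S"
    have "(\<integral>\<^sup>+t. ennreal ((cmod (kernel_op S k f (t, w)))\<^sup>2) \<partial>S) \<le>
        (\<integral>\<^sup>+t. (\<integral>\<^sup>+s. ennreal ((cmod (k (s, t, w)))\<^sup>2) \<partial>S) * ?F \<partial>S)"
    proof (rule nn_integral_mono)
      fix t assume t[measurable]: "t \<in> space S"
      have "ennreal ((cmod (kernel_op S k f (t, w)))\<^sup>2) \<le>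
          (\<integral>\<^sup>+s. ennreal ((cmod (k (t, s, w)))\<^sup>2) \<partial>S) * ?F"
        unfolding kernel_op_def prod.case by (rule Cauchy_Schwarz_lintegral_complex) measurable
      also have "(\<integral>\<^sup>+s. ennreal ((cmod (k (t, s, w)))\<^sup>2) \<partial>S) = (\<integral>\<^sup>+s. ennreal ((cmod (k (s, t, w)))\<^sup>2) \<partial>S)"
        using herm t elim(3) by (intro nn_integral_cong) (metis complex_mod_cnj)
      finally show "ennreal ((cmod (kernel_op S k f (t, w)))\<^sup>2) \<le>
          (\<integral>\<^sup>+s. ennreal ((cmod (k (s, t, w)))\<^sup>2) \<partial>S) * ?F" .
    qed
    also have "\<dots> = (\<integral>\<^sup>+t. (\<integral>\<^sup>+s. ennreal ((cmod (k (s, t, w)))\<^sup>2) \<partial>S) \<partial>S) * ?F"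
      by (rule nn_integral_multc) measurable
    also have "\<dots> \<le> ennreal (max 0 D) * ennreal (max 0 C)"
      using elim by (intro mult_mono) (auto simp: ennreal_max_0)
    finally show ?case by (simp add: ennreal_mult)
  qed
  moreover have "(\<lambda>w. \<integral>\<^sup>+t. ennreal ((cmod (kernel_op S k f (t, w)))\<^sup>2) \<partial>S) \<in> borel_measurable M"
    by measurable
  ultimately show ?thesis
    using T unfolding L2inf_def nn_Linf_def by blast
qed

end

theory Submission
  imports Defs "HOL-Probability.Probability"
begin

text \<open>
  Let \<open>q(s,\<omega>)\<^sup>2 = \<integral>|k(t,s,\<omega>)|\<^sup>2 d\<nu>(t)\<close>. The finite measures \<open>q(\<cdot>,\<omega>)\<^sup>2 \<nu>\<close>, suitably normalised, depend
  measurably on \<open>\<omega>\<close> even if \<open>\<nu>\<close> is not \<open>\<sigma>\<close>-finite, and \<open>T\<close> lives on them with the Hermitian kernel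
  \<open>k(t,s,\<omega>) / (q(t,\<omega>) q(s,\<omega>))\<close>. For such an operator \<open>T\<close> put \<open>c\<^sub>n = \<parallel>T\<^bsup>n+1\<^esup>\<parallel>\<^sup>2\<close> in the Hilbert-Schmidt norm.
  The sequence is log-convex and \<open>c\<^bsub>n+m+1\<^esub> \<le> c\<^sub>n c\<^sub>m\<close>, so \<open>c\<^bsub>n+1\<^esub> / c\<^sub>n\<close> increases to a limit \<open>\<rho>\<close>, the square of
  the operator norm, and \<open>\<rho>\<^bsup>-n\<^esup> T\<^bsup>2n+1\<^esup>\<close> converges in the Hilbert-Schmidt norm to an operator \<open>P \<noteq> 0\<close> with
  \<open>T\<^sup>2 P = \<rho> P\<close>. Everything is a limit of integrals, hence measurable in \<open>\<omega>\<close>. Applying \<open>P\<close> to one of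
  countably many indicator functions gives a measurable eigenvector for an eigenvalue of largest
  modulus. Subtracting it and iterating yields all nonzero eigenvalues in decreasing order of modulus;
  \<open>\<Omega>\<^sub>k\<close> is the set where exactly \<open>k\<close> of them occur.
\<close>

section \<open>Square-integrable functions\<close>

text \<open>The obstacle is that \<open>S\<close> is arbitrary. Without \<sigma>-finiteness neither
  Fubini's theorem nor measurability of parameter integrals is available over \<open>S\<close>, and
  no countable dense set exists from which vectors could be selected. Measurability of the finite
  measures in w is extracted from the assumption on inner products, by pairing sign multiples of q
  with q; the normalisation is a constant \<open>B\<close> \<ge> 1 that bounds the squared
  Hilbert-Schmidt norm for almost every w. A supremum of quadratic forms over uncountably many
  vectors need not be measurable, whereas norms of powers are integrals. Only odd powers occur
  because \<open>sqrt rho\<close> and \<open>- sqrt rho\<close> may both be eigenvalues: steps by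
  the square of T do not oscillate. The sequence is Cauchy because inner products of powers depend
  only on the sum of the exponents, and submultiplicativity keeps the limit away from 0. Countably
  many indicators suffice because a set of a product \<sigma>-algebra is built from countably many
  rectangles, so all its sections lie in one countably generated \<sigma>-algebra.\<close>

definition L2 :: "'a measure \<Rightarrow> ('a \<Rightarrow> complex) set" where
  "L2 N = {f \<in> borel_measurable N. integrable N (\<lambda>x. (cmod (f x))\<^sup>2)}"

definition sq :: "'a measure \<Rightarrow> ('a \<Rightarrow> complex) \<Rightarrow> real" where
  "sq N f = (\<integral>x. (cmod (f x))\<^sup>2 \<partial>N)"

definition ip :: "'a measure \<Rightarrow> ('a \<Rightarrow> complex) \<Rightarrow> ('a \<Rightarrow> complex) \<Rightarrow> complex" where
  "ip N f g = (\<integral>x. f x * cnj (g x) \<partial>N)"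

lemma L2_measurable: "f \<in> L2 N \<Longrightarrow> f \<in> borel_measurable N"
  and L2_integrable_sq: "f \<in> L2 N \<Longrightarrow> integrable N (\<lambda>x. (cmod (f x))\<^sup>2)"
  by (auto simp: L2_def)

lemma sq_nonneg: "0 \<le> sq N f"
  by (simp add: sq_def)

lemma L2_iff_nn:
  "f \<in> L2 N \<longleftrightarrow> f \<in> borel_measurable N \<and> (\<integral>\<^sup>+x. ennreal ((cmod (f x))\<^sup>2) \<partial>N) < \<infinity>"
  by (auto simp: L2_def integrable_iff_bounded)

lemma nn_sq: "f \<in> L2 N \<Longrightarrow> (\<integral>\<^sup>+x. ennreal ((cmod (f x))\<^sup>2) \<partial>N) = ennreal (sq N f)"
  unfolding sq_def by (rule nn_integral_eq_integral) (auto simp: L2_def)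

lemma L2I_nn:
  assumes "f \<in> borel_measurable N" "(\<integral>\<^sup>+x. ennreal ((cmod (f x))\<^sup>2) \<partial>N) \<le> ennreal c" "0 \<le> c"
  shows "f \<in> L2 N" "sq N f \<le> c"
proof -
  show *: "f \<in> L2 N"
    using assms by (auto simp: L2_iff_nn intro: le_less_trans)
  show "sq N f \<le> c"
    using assms nn_sq[OF *] by (simp add: ennreal_le_iff)
qed

lemma L2_mult_integrable:
  assumes f: "f \<in> L2 N" and g: "g \<in> L2 N"
  shows "integrable N (\<lambda>x. f x * g x)"
proof (rule Bochner_Integration.integrable_bound)
  show "integrable N (\<lambda>x. (cmod (f x))\<^sup>2 + (cmod (g x))\<^sup>2)"
    using f g by (auto intro: L2_integrable_sq)
  show "(\<lambda>x. f x * g x) \<in> borel_measurable N"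
    using f g by (auto dest!: L2_measurable)
  have "norm (f x * g x) \<le> norm ((cmod (f x))\<^sup>2 + (cmod (g x))\<^sup>2)" for x
    using sum_squares_bound[of "cmod (f x)" "cmod (g x)"]
      mult_nonneg_nonneg[OF norm_ge_zero norm_ge_zero, of "f x" "g x"]
    unfolding norm_mult real_norm_def by linarith
  then show "AE x in N. norm (f x * g x) \<le> norm ((cmod (f x))\<^sup>2 + (cmod (g x))\<^sup>2)"
    by simp
qed

lemma L2_cong_cmod:
  assumes "f \<in> L2 N" "g \<in> borel_measurable N" "AE x in N. cmod (g x) \<le> cmod (f x)"
  shows "g \<in> L2 N"
proof -
  have "(\<integral>\<^sup>+x. ennreal ((cmod (g x))\<^sup>2) \<partial>N) \<le> (\<integral>\<^sup>+x. ennreal ((cmod (f x))\<^sup>2) \<partial>N)"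
    using assms(3) by (intro nn_integral_mono_AE) (auto simp: power_mono)
  then show ?thesis
    using assms(1,2) by (auto simp: L2_iff_nn)
qed

lemma L2_cnj: "f \<in> L2 N \<Longrightarrow> (\<lambda>x. cnj (f x)) \<in> L2 N"
  by (auto simp: L2_def)

lemma L2_ip_integrable: "f \<in> L2 N \<Longrightarrow> g \<in> L2 N \<Longrightarrow> integrable N (\<lambda>x. f x * cnj (g x))"
  by (intro L2_mult_integrable L2_cnj)

lemma L2_zero: "(\<lambda>_. 0) \<in> L2 N"
  by (simp add: L2_def)

lemma L2_scale: "f \<in> L2 N \<Longrightarrow> (\<lambda>x. c * f x) \<in> L2 N"
  by (auto simp: L2_def norm_mult power_mult_distrib)

lemma L2_add:
  assumes f: "f \<in> L2 N" and g: "g \<in> L2 N"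
  shows "(\<lambda>x. f x + g x) \<in> L2 N"
proof -
  have "integrable N (\<lambda>x. (cmod (f x + g x))\<^sup>2)"
  proof (rule Bochner_Integration.integrable_bound)
    show "integrable N (\<lambda>x. 2 * ((cmod (f x))\<^sup>2 + (cmod (g x))\<^sup>2))"
      using f g by (simp add: L2_integrable_sq)
    show "(\<lambda>x. (cmod (f x + g x))\<^sup>2) \<in> borel_measurable N"
      using f g by (auto dest!: L2_measurable)
    have "(cmod (f x + g x))\<^sup>2 \<le> 2 * ((cmod (f x))\<^sup>2 + (cmod (g x))\<^sup>2)" for x
      using power_mono[OF norm_triangle_ineq[of "f x" "g x"] norm_ge_zero, of 2]
        sum_squares_bound[of "cmod (f x)" "cmod (g x)"] by (simp add: power2_sum)
    then show "AE x in N. norm ((cmod (f x + g x))\<^sup>2) \<le> norm (2 * ((cmod (f x))\<^sup>2 + (cmod (g x))\<^sup>2))"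
      by simp
  qed
  then show ?thesis
    using f g by (auto simp: L2_def)
qed

lemma L2_diff: "f \<in> L2 N \<Longrightarrow> g \<in> L2 N \<Longrightarrow> (\<lambda>x. f x - g x) \<in> L2 N"
  using L2_add[of f N "\<lambda>x. - 1 * g x"] L2_scale[of g N "-1"] by simp

lemma L2_sum: "(\<And>i. i \<in> I \<Longrightarrow> f i \<in> L2 N) \<Longrightarrow> (\<lambda>x. \<Sum>i\<in>I. f i x) \<in> L2 N"
  by (induction I rule: infinite_finite_induct) (auto intro: L2_zero L2_add)

lemma Cauchy_Schwarz_ip:
  assumes f: "f \<in> L2 N" and g: "g \<in> L2 N"
  shows "(cmod (ip N f g))\<^sup>2 \<le> sq N f * sq N g"
proof -
  have "ennreal ((cmod (\<integral>x. f x * cnj (g x) \<partial>N))\<^sup>2) \<le>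
      (\<integral>\<^sup>+x. ennreal ((cmod (f x))\<^sup>2) \<partial>N) * (\<integral>\<^sup>+x. ennreal ((cmod (cnj (g x)))\<^sup>2) \<partial>N)"
    using f g by (intro Cauchy_Schwarz_lintegral_complex) (auto dest!: L2_measurable)
  also have "\<dots> = ennreal (sq N f * sq N g)"
    by (simp add: nn_sq[OF f] nn_sq[OF g] ennreal_mult sq_nonneg)
  finally show ?thesis
    by (simp add: ip_def ennreal_le_iff sq_nonneg)
qed

lemma ip_self: "f \<in> L2 N \<Longrightarrow> ip N f f = of_real (sq N f)"
  unfolding ip_def sq_def by (simp add: complex_norm_square[symmetric] flip: integral_complex_of_real of_real_power)

lemma ip_cnj: "cnj (ip N f g) = ip N g f"
  unfolding ip_def Bochner_Integration.integral_cnj[symmetric] by (simp add: mult.commute del: Bochner_Integration.integral_cnj)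

lemma ip_diff_left: "f \<in> L2 N \<Longrightarrow> g \<in> L2 N \<Longrightarrow> h \<in> L2 N \<Longrightarrow> ip N (\<lambda>x. f x - g x) h = ip N f h - ip N g h"
  unfolding ip_def by (simp add: left_diff_distrib L2_ip_integrable)

lemma ip_scale_left: "ip N (\<lambda>x. c * f x) h = c * ip N f h"
  unfolding ip_def by (simp add: mult.assoc)

lemma ip_diff_right: "f \<in> L2 N \<Longrightarrow> g \<in> L2 N \<Longrightarrow> h \<in> L2 N \<Longrightarrow> ip N h (\<lambda>x. f x - g x) = ip N h f - ip N h g"
  unfolding ip_def by (simp add: right_diff_distrib L2_ip_integrable)

lemma ip_scale_right: "ip N h (\<lambda>x. c * f x) = cnj c * ip N h f"
  unfolding ip_def by (simp add: mult.left_commute)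

lemma sq_cong_AE:
  assumes "AE x in N. f x = g x" "f \<in> borel_measurable N" "g \<in> borel_measurable N"
  shows "sq N f = sq N g"
  unfolding sq_def using assms by (intro integral_cong_AE) auto

lemma ip_cong_AE:
  assumes "AE x in N. f x = f' x" "AE x in N. g x = g' x"
    "f \<in> borel_measurable N" "f' \<in> borel_measurable N" "g \<in> borel_measurable N" "g' \<in> borel_measurable N"
  shows "ip N f g = ip N f' g'"
  unfolding ip_def using assms by (intro integral_cong_AE) auto

lemma sq_scale: "sq N (\<lambda>x. c * f x) = (cmod c)\<^sup>2 * sq N f"
  unfolding sq_def by (simp add: norm_mult power_mult_distrib)

lemma sq_cnj: "sq N (\<lambda>x. cnj (f x)) = sq N f"
  unfolding sq_def by simp

lemma sq_eq_0_iff: "f \<in> L2 N \<Longrightarrow> sq N f = 0 \<longleftrightarrow> (AE x in N. f x = 0)"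
  unfolding sq_def by (subst integral_nonneg_eq_0_iff_AE) (auto simp: L2_def)

lemma sq_zero: "sq N (\<lambda>_. 0) = 0"
  by (simp add: sq_def)

lemma sq_diff:
  assumes f: "f \<in> L2 N" and g: "g \<in> L2 N"
  shows "sq N (\<lambda>x. f x - g x) = sq N f - 2 * Re (ip N f g) + sq N g"
proof -
  have "of_real (sq N (\<lambda>x. f x - g x)) = ip N (\<lambda>x. f x - g x) (\<lambda>x. f x - g x)"
    by (simp add: ip_self L2_diff f g)
  also have "\<dots> = of_real (sq N f) - (ip N f g + cnj (ip N f g)) + of_real (sq N g)"
    by (simp add: ip_diff_left ip_diff_right ip_self ip_cnj L2_diff f g)
  finally show ?thesis
    by (simp add: complex_add_cnj complex_eq_iff)
qed

lemma sq_add: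
  assumes f: "f \<in> L2 N" and g: "g \<in> L2 N"
  shows "sq N (\<lambda>x. f x + g x) = sq N f + 2 * Re (ip N f g) + sq N g"
  using sq_diff[OF f L2_scale[OF g, of "-1"]] unfolding sq_scale ip_scale_right by simp

lemma sq_add_le:
  assumes f: "f \<in> L2 N" and g: "g \<in> L2 N"
  shows "sq N (\<lambda>x. f x + g x) \<le> 2 * sq N f + 2 * sq N g"
proof -
  have "sq N (\<lambda>x. f x + g x) \<le> (\<integral>x. 2 * (cmod (f x))\<^sup>2 + 2 * (cmod (g x))\<^sup>2 \<partial>N)"
    unfolding sq_def
  proof (intro integral_mono)
    show "(cmod (f x + g x))\<^sup>2 \<le> 2 * (cmod (f x))\<^sup>2 + 2 * (cmod (g x))\<^sup>2" for x
      using power_mono[OF norm_triangle_ineq[of "f x" "g x"] norm_ge_zero, of 2]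
        sum_squares_bound[of "cmod (f x)" "cmod (g x)"] by (simp add: power2_sum)
  qed (use f g L2_add[OF f g] in \<open>auto simp: L2_def\<close>)
  also have "\<dots> = 2 * sq N f + 2 * sq N g"
    using f g by (simp add: sq_def L2_def)
  finally show ?thesis .
qed

lemma sq_diff_le: "f \<in> L2 N \<Longrightarrow> g \<in> L2 N \<Longrightarrow> sq N (\<lambda>x. f x - g x) \<le> 2 * sq N f + 2 * sq N g"
  using sq_add_le[of f N "\<lambda>x. - 1 * g x"] L2_scale[of g N "-1"] sq_scale[of N "-1" g] by simp

lemma L2_bounded:
  assumes "finite_measure N" "f \<in> borel_measurable N" "\<And>x. cmod (f x) \<le> B"
  shows "f \<in> L2 N"
proof -
  interpret finite_measure N by fact
  have "integrable N (\<lambda>x. (cmod (f x))\<^sup>2)"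
    using assms(2,3) by (intro integrable_const_bound[where B="B\<^sup>2"]) (auto simp: power_mono)
  then show ?thesis
    using assms(2) by (auto simp: L2_def)
qed

section \<open>Hilbert-Schmidt kernels\<close>

definition kop :: "'a measure \<Rightarrow> ('a \<times> 'a \<Rightarrow> complex) \<Rightarrow> ('a \<Rightarrow> complex) \<Rightarrow> 'a \<Rightarrow> complex" where
  "kop N X f t = (\<integral>s. X (t, s) * f s \<partial>N)"

definition kcomp :: "'a measure \<Rightarrow> ('a \<times> 'a \<Rightarrow> complex) \<Rightarrow> ('a \<times> 'a \<Rightarrow> complex) \<Rightarrow> 'a \<times> 'a \<Rightarrow> complex" where
  "kcomp N X Y = (\<lambda>(t, s). kop N X (\<lambda>r. Y (r, s)) t)"

definition hermitian_kernel :: "'a measure \<Rightarrow> ('a \<times> 'a \<Rightarrow> complex) \<Rightarrow> bool" where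
  "hermitian_kernel N K \<longleftrightarrow> (\<forall>t\<in>space N. \<forall>s\<in>space N. K (t, s) = cnj (K (s, t)))"

lemma kop_cong_AE:
  assumes "AE x in N. f x = g x" "f \<in> borel_measurable N" "g \<in> borel_measurable N"
    "X \<in> borel_measurable (N \<Otimes>\<^sub>M N)" "t \<in> space N"
  shows "kop N X f t = kop N X g t"
proof -
  note assms(2-5)[measurable]
  show ?thesis
    unfolding kop_def using assms(1) by (intro integral_cong_AE) auto
qed

text \<open>An own copy of \<open>finite_measure\<close>, so that the product interpretation
  \<open>NN\<close> can be attached without changing the library locale.\<close>

locale finite_measure_L2 = finite_measure N for N :: "'a measure"

sublocale finite_measure_L2 \<subseteq> NN: pair_sigma_finite N N ..

context finite_measure_L2
begin

lemma kop_measurable[measurable]: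
  assumes [measurable]: "X \<in> borel_measurable (N \<Otimes>\<^sub>M N)" "f \<in> borel_measurable N"
  shows "kop N X f \<in> borel_measurable N"
  unfolding kop_def[abs_def] by measurable

lemma kcomp_measurable[measurable]:
  assumes [measurable]: "X \<in> borel_measurable (N \<Otimes>\<^sub>M N)" "Y \<in> borel_measurable (N \<Otimes>\<^sub>M N)"
  shows "kcomp N X Y \<in> borel_measurable (N \<Otimes>\<^sub>M N)"
  unfolding kcomp_def kop_def[abs_def] by measurable

lemma L2_swap:
  assumes X: "X \<in> L2 (N \<Otimes>\<^sub>M N)"
  shows "(\<lambda>(t, s). X (s, t)) \<in> L2 (N \<Otimes>\<^sub>M N)"
proof -
  note L2_measurable[OF X, measurable]
  have "integrable (N \<Otimes>\<^sub>M N) (\<lambda>(t, s). (cmod (X (s, t)))\<^sup>2)"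
    using NN.integrable_product_swap[OF L2_integrable_sq[OF X]] .
  then show ?thesis
    by (simp add: L2_def split_beta')
qed

lemma AE_row_L2:
  assumes X: "X \<in> L2 (N \<Otimes>\<^sub>M N)"
  shows "AE t in N. (\<lambda>s. X (t, s)) \<in> L2 N"
proof -
  note L2_measurable[OF X, measurable]
  show ?thesis
    using NN.AE_integrable_fst'[OF L2_integrable_sq[OF X]] AE_space
    by eventually_elim (simp add: L2_def)
qed

lemma AE_col_L2:
  assumes X: "X \<in> L2 (N \<Otimes>\<^sub>M N)"
  shows "AE s in N. (\<lambda>t. X (t, s)) \<in> L2 N"
  using AE_row_L2[OF L2_swap[OF X]] by simp

lemma kop_L2:
  assumes X: "X \<in> L2 (N \<Otimes>\<^sub>M N)" and f: "f \<in> L2 N"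
  shows "kop N X f \<in> L2 N" "sq N (kop N X f) \<le> sq (N \<Otimes>\<^sub>M N) X * sq N f"
proof -
  note L2_measurable[OF X, measurable] L2_measurable[OF f, measurable]
  have "(\<integral>\<^sup>+t. ennreal ((cmod (kop N X f t))\<^sup>2) \<partial>N) \<le>
      (\<integral>\<^sup>+t. (\<integral>\<^sup>+s. ennreal ((cmod (X (t, s)))\<^sup>2) \<partial>N) * (\<integral>\<^sup>+s. ennreal ((cmod (f s))\<^sup>2) \<partial>N) \<partial>N)"
    unfolding kop_def by (intro nn_integral_mono Cauchy_Schwarz_lintegral_complex) auto
  also have "\<dots> = (\<integral>\<^sup>+t. (\<integral>\<^sup>+s. ennreal ((cmod (X (t, s)))\<^sup>2) \<partial>N) \<partial>N) * (\<integral>\<^sup>+s. ennreal ((cmod (f s))\<^sup>2) \<partial>N)"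
    by (intro nn_integral_multc) auto
  also have "(\<integral>\<^sup>+t. (\<integral>\<^sup>+s. ennreal ((cmod (X (t, s)))\<^sup>2) \<partial>N) \<partial>N) = ennreal (sq (N \<Otimes>\<^sub>M N) X)"
    by (subst nn_integral_fst) (auto simp: nn_sq[OF X])
  finally have *: "(\<integral>\<^sup>+t. ennreal ((cmod (kop N X f t))\<^sup>2) \<partial>N) \<le> ennreal (sq (N \<Otimes>\<^sub>M N) X * sq N f)"
    by (simp add: nn_sq[OF f] ennreal_mult sq_nonneg)
  show "kop N X f \<in> L2 N" "sq N (kop N X f) \<le> sq (N \<Otimes>\<^sub>M N) X * sq N f"
    using L2I_nn[OF _ *] by (auto simp: sq_nonneg)
qed

lemma tensor_L2:
  assumes f: "f \<in> L2 N" and g: "g \<in> L2 N"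
  shows "(\<lambda>(t, s). f t * g s) \<in> L2 (N \<Otimes>\<^sub>M N)" "sq (N \<Otimes>\<^sub>M N) (\<lambda>(t, s). f t * g s) = sq N f * sq N g"
proof -
  note L2_measurable[OF f, measurable] L2_measurable[OF g, measurable]
  have "(\<integral>\<^sup>+x. ennreal ((cmod ((\<lambda>(t, s). f t * g s) x))\<^sup>2) \<partial>(N \<Otimes>\<^sub>M N)) =
      (\<integral>\<^sup>+t. (\<integral>\<^sup>+s. ennreal ((cmod (f t))\<^sup>2) * ennreal ((cmod (g s))\<^sup>2) \<partial>N) \<partial>N)"
    by (subst nn_integral_fst[symmetric]) (auto simp: norm_mult power_mult_distrib ennreal_mult)
  also have "\<dots> = ennreal (sq N f * sq N g)"
    by (simp add: nn_integral_cmult nn_integral_multc nn_sq f g ennreal_mult sq_nonneg)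
  finally have *: "(\<integral>\<^sup>+x. ennreal ((cmod ((\<lambda>(t, s). f t * g s) x))\<^sup>2) \<partial>(N \<Otimes>\<^sub>M N)) = ennreal (sq N f * sq N g)" .
  show **: "(\<lambda>(t, s). f t * g s) \<in> L2 (N \<Otimes>\<^sub>M N)"
    using * by (auto simp: L2_iff_nn)
  show "sq (N \<Otimes>\<^sub>M N) (\<lambda>(t, s). f t * g s) = sq N f * sq N g"
    using *[unfolded nn_sq[OF **]] by (simp add: sq_nonneg)
qed

text \<open>\<open>kcomp N K\<close> acts on every column separately. Reading inner products
  columnwise therefore lifts facts about the operator, such as symmetry, to kernels.\<close>

lemma ip_cols:
  assumes X: "X \<in> L2 (N \<Otimes>\<^sub>M N)" and Y: "Y \<in> L2 (N \<Otimes>\<^sub>M N)"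
  shows "ip (N \<Otimes>\<^sub>M N) X Y = (\<integral>s. ip N (\<lambda>t. X (t, s)) (\<lambda>t. Y (t, s)) \<partial>N)"
  unfolding ip_def
  using NN.integral_snd[of "\<lambda>t s. X (t, s) * cnj (Y (t, s))"] L2_ip_integrable[OF X Y]
  by (simp add: split_beta')

text \<open>Both factors on the right are square integrable on the product, so Fubini applies to
  their product. Symmetry of the operator then reduces to swapping the two variables of the
  kernel.\<close>

lemma ip_kop:
  assumes X: "X \<in> L2 (N \<Otimes>\<^sub>M N)" and f: "f \<in> L2 N" and g: "g \<in> L2 N"
  shows "ip N (kop N X f) g = ip (N \<Otimes>\<^sub>M N) X (\<lambda>(t, s). g t * cnj (f s))"
proof -
  have "ip (N \<Otimes>\<^sub>M N) X (\<lambda>(t, s). g t * cnj (f s)) = (\<integral>t. (\<integral>s. X (t, s) * cnj (g t * cnj (f s)) \<partial>N) \<partial>N)"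
    unfolding ip_def
    using NN.integral_fst'[OF L2_ip_integrable[OF X tensor_L2(1)[OF g L2_cnj[OF f]]]]
    by (simp add: split_beta')
  also have "\<dots> = ip N (kop N X f) g"
  proof -
    have *: "X (t, s) * cnj (g t * cnj (f s)) = (X (t, s) * f s) * cnj (g t)" for t s
      by simp
    show ?thesis
      unfolding ip_def kop_def * by simp
  qed
  finally show ?thesis ..
qed

lemma kop_sym:
  assumes K: "K \<in> L2 (N \<Otimes>\<^sub>M N)" and herm: "hermitian_kernel N K" and f: "f \<in> L2 N" and g: "g \<in> L2 N"
  shows "ip N (kop N K f) g = ip N f (kop N K g)"
proof -
  note L2_measurable[OF K, measurable] L2_measurable[OF f, measurable] L2_measurable[OF g, measurable]
  have "ip N f (kop N K g) = cnj (ip N (kop N K g) f)"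
    by (simp add: ip_cnj)
  also have "\<dots> = (\<integral>x. cnj (K x * cnj ((\<lambda>(t, s). f t * cnj (g s)) x)) \<partial>(N \<Otimes>\<^sub>M N))"
    unfolding ip_kop[OF K g f] unfolding ip_def by (rule Bochner_Integration.integral_cnj[symmetric])
  also have "\<dots> = (\<integral>x. (\<lambda>(s, t). K (t, s) * cnj (g t * cnj (f s))) x \<partial>(N \<Otimes>\<^sub>M N))"
    using herm by (intro Bochner_Integration.integral_cong)
      (auto simp: hermitian_kernel_def space_pair_measure mult.commute)
  also have "\<dots> = (\<integral>x. (\<lambda>(t, s). K (t, s) * cnj (g t * cnj (f s))) x \<partial>(N \<Otimes>\<^sub>M N))"
    using NN.integral_product_swap[of "\<lambda>(t, s). K (t, s) * cnj (g t * cnj (f s))"]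
    by (simp add: split_beta')
  also have "\<dots> = ip N (kop N K f) g"
    unfolding ip_kop[OF K f g] unfolding ip_def by (simp add: split_beta')
  finally show ?thesis ..
qed

text \<open>Cauchy-Schwarz in the middle variable bounds the integrand by a function of t times a
  function of s, and the double integral splits.\<close>

lemma kcomp_L2:
  assumes X: "X \<in> L2 (N \<Otimes>\<^sub>M N)" and Y: "Y \<in> L2 (N \<Otimes>\<^sub>M N)"
  shows "kcomp N X Y \<in> L2 (N \<Otimes>\<^sub>M N)" "sq (N \<Otimes>\<^sub>M N) (kcomp N X Y) \<le> sq (N \<Otimes>\<^sub>M N) X * sq (N \<Otimes>\<^sub>M N) Y"
proof -
  note L2_measurable[OF X, measurable] L2_measurable[OF Y, measurable]
  have "(\<integral>\<^sup>+x. ennreal ((cmod (kcomp N X Y x))\<^sup>2) \<partial>(N \<Otimes>\<^sub>M N)) =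
      (\<integral>\<^sup>+t. (\<integral>\<^sup>+s. ennreal ((cmod (\<integral>r. X (t, r) * Y (r, s) \<partial>N))\<^sup>2) \<partial>N) \<partial>N)"
    by (subst nn_integral_fst[symmetric]) (auto simp: kcomp_def kop_def)
  also have "\<dots> \<le> (\<integral>\<^sup>+t. (\<integral>\<^sup>+s. (\<integral>\<^sup>+r. ennreal ((cmod (X (t, r)))\<^sup>2) \<partial>N) * (\<integral>\<^sup>+r. ennreal ((cmod (Y (r, s)))\<^sup>2) \<partial>N) \<partial>N) \<partial>N)"
    by (intro nn_integral_mono Cauchy_Schwarz_lintegral_complex) auto
  also have "\<dots> = (\<integral>\<^sup>+t. (\<integral>\<^sup>+r. ennreal ((cmod (X (t, r)))\<^sup>2) \<partial>N) \<partial>N) * (\<integral>\<^sup>+s. (\<integral>\<^sup>+r. ennreal ((cmod (Y (r, s)))\<^sup>2) \<partial>N) \<partial>N)"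
    by (simp add: nn_integral_cmult nn_integral_multc)
  also have "(\<integral>\<^sup>+t. (\<integral>\<^sup>+r. ennreal ((cmod (X (t, r)))\<^sup>2) \<partial>N) \<partial>N) = ennreal (sq (N \<Otimes>\<^sub>M N) X)"
    by (subst nn_integral_fst) (auto simp: nn_sq[OF X])
  also have "(\<integral>\<^sup>+s. (\<integral>\<^sup>+r. ennreal ((cmod (Y (r, s)))\<^sup>2) \<partial>N) \<partial>N) = ennreal (sq (N \<Otimes>\<^sub>M N) Y)"
    by (subst NN.nn_integral_snd) (auto simp: nn_sq[OF Y])
  finally have *: "(\<integral>\<^sup>+x. ennreal ((cmod (kcomp N X Y x))\<^sup>2) \<partial>(N \<Otimes>\<^sub>M N)) \<le> ennreal (sq (N \<Otimes>\<^sub>M N) X * sq (N \<Otimes>\<^sub>M N) Y)"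
    by (simp add: ennreal_mult sq_nonneg)
  show "kcomp N X Y \<in> L2 (N \<Otimes>\<^sub>M N)" "sq (N \<Otimes>\<^sub>M N) (kcomp N X Y) \<le> sq (N \<Otimes>\<^sub>M N) X * sq (N \<Otimes>\<^sub>M N) Y"
    using L2I_nn[OF _ *] by (auto simp: sq_nonneg)
qed

text \<open>Fubini for fixed t needs the row X(t, .) to be square integrable, which holds only for
  almost every t. This is why the identities for compositions are stated almost everywhere.\<close>

lemma kop_comp:
  assumes X: "X \<in> L2 (N \<Otimes>\<^sub>M N)" and Y: "Y \<in> L2 (N \<Otimes>\<^sub>M N)" and f: "f \<in> L2 N"
  shows "AE t in N. kop N (kcomp N X Y) f t = kop N X (kop N Y f) t"
  using AE_row_L2[OF X]
proof eventually_elim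
  case (elim t)
  have i: "integrable (N \<Otimes>\<^sub>M N) (\<lambda>(r, s). X (t, r) * Y (r, s) * f s)"
    using L2_mult_integrable[OF Y tensor_L2(1)[OF elim f]] by (simp add: split_beta' mult_ac)
  have "kop N (kcomp N X Y) f t = (\<integral>s. (\<integral>r. X (t, r) * Y (r, s) * f s \<partial>N) \<partial>N)"
    unfolding kop_def kcomp_def by simp
  also have "\<dots> = (\<integral>r. (\<integral>s. X (t, r) * Y (r, s) * f s \<partial>N) \<partial>N)"
    by (rule NN.Fubini_integral[OF i])
  also have "\<dots> = kop N X (kop N Y f) t"
    unfolding kop_def by (simp add: mult.assoc)
  finally show ?case .
qed

lemma AE_pair_cols:
  assumes [measurable]: "X \<in> borel_measurable (N \<Otimes>\<^sub>M N)" "Y \<in> borel_measurable (N \<Otimes>\<^sub>M N)"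
  shows "(AE x in N \<Otimes>\<^sub>M N. X x = (Y x :: complex)) \<longleftrightarrow> (AE s in N. AE t in N. X (t, s) = Y (t, s))"
proof -
  have "(AE x in N \<Otimes>\<^sub>M N. X x = Y x) \<longleftrightarrow> (AE t in N. AE s in N. X (t, s) = Y (t, s))"
    using NN.AE_pair_iff[of "\<lambda>t s. X (t, s) = Y (t, s)"] by simp
  also have "\<dots> \<longleftrightarrow> (AE s in N. AE t in N. X (t, s) = Y (t, s))"
    by (intro NN.AE_commute) measurable
  finally show ?thesis .
qed

lemma kcomp_cong_AE:
  assumes [measurable]: "K \<in> borel_measurable (N \<Otimes>\<^sub>M N)" "X \<in> borel_measurable (N \<Otimes>\<^sub>M N)" "Y \<in> borel_measurable (N \<Otimes>\<^sub>M N)"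
  assumes eq: "AE x in N \<Otimes>\<^sub>M N. X x = Y x"
  shows "AE x in N \<Otimes>\<^sub>M N. kcomp N K X x = kcomp N K Y x"
proof -
  have "AE s in N. AE t in N. X (t, s) = Y (t, s)"
    using eq by (subst (asm) AE_pair_cols) auto
  then have "AE s in N. AE t in N. kcomp N K X (t, s) = kcomp N K Y (t, s)"
    using AE_space
  proof eventually_elim
    case (elim s)
    note elim(2)[measurable]
    show ?case
      unfolding kcomp_def prod.case by (intro AE_I2 kop_cong_AE[OF elim(1)]) auto
  qed
  then show ?thesis
    by (subst AE_pair_cols) auto
qed

lemma kcomp_assoc:
  assumes K: "K \<in> L2 (N \<Otimes>\<^sub>M N)" and X: "X \<in> L2 (N \<Otimes>\<^sub>M N)" and Y: "Y \<in> L2 (N \<Otimes>\<^sub>M N)"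
  shows "AE x in N \<Otimes>\<^sub>M N. kcomp N (kcomp N K X) Y x = kcomp N K (kcomp N X Y) x"
proof -
  note L2_measurable[OF K, measurable] L2_measurable[OF X, measurable] L2_measurable[OF Y, measurable]
  have "AE s in N. AE t in N. kcomp N (kcomp N K X) Y (t, s) = kcomp N K (kcomp N X Y) (t, s)"
    using AE_col_L2[OF Y]
  proof eventually_elim
    case (elim s)
    show ?case
      using kop_comp[OF K X elim] unfolding kcomp_def[of _ "kcomp N K X"] kcomp_def[of _ _ "kcomp N X Y"]
      by (simp add: kcomp_def[of _ X Y])
  qed
  then show ?thesis
    by (subst AE_pair_cols) auto
qed

lemma kcomp_sym:
  assumes K: "K \<in> L2 (N \<Otimes>\<^sub>M N)" and herm: "hermitian_kernel N K"
    and X: "X \<in> L2 (N \<Otimes>\<^sub>M N)" and Y: "Y \<in> L2 (N \<Otimes>\<^sub>M N)"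
  shows "ip (N \<Otimes>\<^sub>M N) (kcomp N K X) Y = ip (N \<Otimes>\<^sub>M N) X (kcomp N K Y)"
proof -
  note L2_measurable[OF K, measurable] L2_measurable[OF X, measurable] L2_measurable[OF Y, measurable]
  have "AE s in N. ip N (\<lambda>t. kcomp N K X (t, s)) (\<lambda>t. Y (t, s)) = ip N (\<lambda>t. X (t, s)) (\<lambda>t. kcomp N K Y (t, s))"
    using AE_col_L2[OF X] AE_col_L2[OF Y]
  proof eventually_elim
    case (elim s)
    then show ?case
      using kop_sym[OF K herm elim] by (simp add: kcomp_def)
  qed
  then show ?thesis
    unfolding ip_cols[OF kcomp_L2(1)[OF K X] Y] ip_cols[OF X kcomp_L2(1)[OF K Y]]
    by (intro integral_cong_AE) (auto simp: ip_def)
qed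

end

text \<open>The index is shifted: \<open>kpow N K n\<close> is the kernel of the operator power \<open>T\<^bsup>n+1\<^esup>\<close>.\<close>

primrec kpow :: "'a measure \<Rightarrow> ('a \<times> 'a \<Rightarrow> complex) \<Rightarrow> nat \<Rightarrow> 'a \<times> 'a \<Rightarrow> complex" where
  "kpow N K 0 = K"
| "kpow N K (Suc n) = kcomp N K (kpow N K n)"

section \<open>Hilbert-Schmidt norms of the powers of a Hermitian operator\<close>

locale hermitian_HS = finite_measure_L2 +
  fixes K :: "'a \<times> 'a \<Rightarrow> complex"
  assumes K_L2: "K \<in> L2 (N \<Otimes>\<^sub>M N)" and K_herm: "hermitian_kernel N K"
begin

abbreviation "T \<equiv> kop N K"

definition c :: "nat \<Rightarrow> real" where
  "c n = sq (N \<Otimes>\<^sub>M N) (kpow N K n)"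

lemma kpow_L2: "kpow N K n \<in> L2 (N \<Otimes>\<^sub>M N)"
  by (induction n) (auto simp: K_L2 kcomp_L2)

lemmas [measurable] = L2_measurable[OF K_L2] L2_measurable[OF kpow_L2]

lemma T_L2: "f \<in> L2 N \<Longrightarrow> T f \<in> L2 N"
  by (rule kop_L2(1)[OF K_L2])

lemma T_sym: "f \<in> L2 N \<Longrightarrow> g \<in> L2 N \<Longrightarrow> ip N (T f) g = ip N f (T g)"
  by (rule kop_sym[OF K_L2 K_herm])

lemma ip_kpow: "ip (N \<Otimes>\<^sub>M N) (kpow N K n) (kpow N K m) = ip (N \<Otimes>\<^sub>M N) K (kpow N K (n + m))"
proof (induction n arbitrary: m)
  case (Suc n)
  show ?case
    using kcomp_sym[OF K_L2 K_herm kpow_L2 kpow_L2, of n m] Suc[of "Suc m"] by simp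
qed simp

text \<open>By symmetry factors of \<open>K\<close> move from one side to the other, so the inner
  product depends only on n + m: it is the trace of the power n + m + 2 of T. An even sum can be
  split evenly, which gives a squared norm.\<close>

lemma ip_kpow_eq:
  assumes "n + m = 2 * j"
  shows "ip (N \<Otimes>\<^sub>M N) (kpow N K n) (kpow N K m) = of_real (c j)"
  using ip_kpow[of n m] ip_kpow[of j j] assms by (simp add: ip_self[OF kpow_L2] c_def mult_2)

lemma c_nonneg: "0 \<le> c n"
  by (simp add: c_def sq_nonneg)

text \<open>Cauchy-Schwarz for the powers n + 1 and n + 3 of T, whose inner product is the squared
  norm of the power n + 2.\<close>

lemma c_log_convex: "(c (Suc n))\<^sup>2 \<le> c n * c (Suc (Suc n))"
  using Cauchy_Schwarz_ip[OF kpow_L2 kpow_L2, of n "Suc (Suc n)"] ip_kpow_eq[of n "Suc (Suc n)" "Suc n"]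
  by (simp add: c_def[symmetric] del: kpow.simps)

lemma kcomp_kpow: "AE x in N \<Otimes>\<^sub>M N. kcomp N (kpow N K n) (kpow N K m) x = kpow N K (Suc (n + m)) x"
proof (induction n)
  case (Suc n)
  have "AE x in N \<Otimes>\<^sub>M N. kcomp N K (kcomp N (kpow N K n) (kpow N K m)) x = kcomp N K (kpow N K (Suc (n + m))) x"
    by (intro kcomp_cong_AE Suc.IH) auto
  with kcomp_assoc[OF K_L2 kpow_L2 kpow_L2, of n m] show ?case
    by eventually_elim simp
qed simp

lemma c_submult: "c (Suc (n + m)) \<le> c n * c m"
proof -
  have "c (Suc (n + m)) = sq (N \<Otimes>\<^sub>M N) (kcomp N (kpow N K n) (kpow N K m))"
    unfolding c_def by (rule sq_cong_AE[symmetric]) (use kcomp_kpow in auto)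
  also have "\<dots> \<le> c n * c m"
    unfolding c_def by (rule kcomp_L2(2)[OF kpow_L2 kpow_L2])
  finally show ?thesis .
qed

end

section \<open>Powers of a Hermitian kernel\<close>

context finite_measure_L2
begin

lemma kop_scale: "kop N X (\<lambda>s. a * f s) t = a * kop N X f t"
  unfolding kop_def by (simp add: mult.left_commute)

lemma kop_scale_kernel: "kop N (\<lambda>z. a * X z) f t = a * kop N X f t"
  unfolding kop_def by (simp add: mult.assoc)

text \<open>Additivity is guaranteed only where the row X(t, .) is square integrable; elsewhere an
  integral may take the default value 0.\<close>

lemma kop_diff:
  assumes X: "X \<in> L2 (N \<Otimes>\<^sub>M N)" and f: "f \<in> L2 N" and g: "g \<in> L2 N"
  shows "AE t in N. kop N X (\<lambda>s. f s - g s) t = kop N X f t - kop N X g t"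
  using AE_row_L2[OF X]
  by eventually_elim (simp add: kop_def right_diff_distrib L2_mult_integrable f g)

lemma kop_add:
  assumes X: "X \<in> L2 (N \<Otimes>\<^sub>M N)" and f: "f \<in> L2 N" and g: "g \<in> L2 N"
  shows "AE t in N. kop N X (\<lambda>s. f s + g s) t = kop N X f t + kop N X g t"
  using AE_row_L2[OF X]
  by eventually_elim (simp add: kop_def distrib_left L2_mult_integrable f g)

lemma kop_diff_kernel:
  assumes X: "X \<in> L2 (N \<Otimes>\<^sub>M N)" and Y: "Y \<in> L2 (N \<Otimes>\<^sub>M N)" and f: "f \<in> L2 N"
  shows "AE t in N. kop N (\<lambda>z. X z - Y z) f t = kop N X f t - kop N Y f t"
  using AE_row_L2[OF X] AE_row_L2[OF Y]
  by eventually_elim (simp add: kop_def left_diff_distrib L2_mult_integrable f)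

end

context hermitian_HS
begin

lemma Tpow_L2: "f \<in> L2 N \<Longrightarrow> (T ^^ n) f \<in> L2 N"
  by (induction n) (auto intro: T_L2)

lemma kop_cong:
  "X \<in> borel_measurable (N \<Otimes>\<^sub>M N) \<Longrightarrow> f \<in> borel_measurable N \<Longrightarrow> g \<in> borel_measurable N \<Longrightarrow>
    AE x in N. f x = g x \<Longrightarrow> AE t in N. kop N X f t = kop N X g t"
  using kop_cong_AE[where f=f and g=g and X=X] by (intro AE_I2) auto

lemma Tpow_kpow:
  assumes f: "f \<in> L2 N"
  shows "AE t in N. (T ^^ Suc n) f t = kop N (kpow N K n) f t"
proof (induction n)
  case (Suc n)
  have "AE t in N. T ((T ^^ Suc n) f) t = T (kop N (kpow N K n) f) t"
    using Suc Tpow_L2[OF f, of "Suc n"] f by (intro kop_cong) (auto dest: L2_measurable)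
  with kop_comp[OF K_L2 kpow_L2 f, of n] show ?case
    by eventually_elim simp
qed simp

lemma sq_Tpow_le:
  assumes f: "f \<in> L2 N"
  shows "sq N ((T ^^ Suc n) f) \<le> c n * sq N f"
proof -
  have "sq N ((T ^^ Suc n) f) = sq N (kop N (kpow N K n) f)"
    by (intro sq_cong_AE Tpow_kpow f L2_measurable[OF Tpow_L2] L2_measurable[OF kop_L2(1)] kpow_L2)
  also have "\<dots> \<le> c n * sq N f"
    unfolding c_def by (rule kop_L2(2)[OF kpow_L2 f])
  finally show ?thesis .
qed

text \<open>If the square of T vanishes, then so does \<langle>f, T T f\<rangle>, which by symmetry
  is the squared norm of T f.\<close>

lemma T_eq_0:
  assumes "c 1 = 0" and f: "f \<in> L2 N"
  shows "sq N (T f) = 0"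
proof -
  have "sq N (T (T f)) \<le> 0"
    using sq_Tpow_le[OF f, of 1] assms(1) by simp
  moreover have "(cmod (ip N f (T (T f))))\<^sup>2 \<le> sq N f * sq N (T (T f))"
    by (intro Cauchy_Schwarz_ip f T_L2)
  moreover have "ip N f (T (T f)) = of_real (sq N (T f))"
    using T_sym[OF f T_L2[OF f]] ip_self[OF T_L2[OF f]] by simp
  ultimately show ?thesis
    using sq_nonneg[of N "T (T f)"] by simp
qed

end

section \<open>Growth rate of the norms and the limit of the normalised odd powers\<close>

locale hermitian_HS_nontrivial = hermitian_HS +
  assumes c1: "c 1 \<noteq> 0"
begin

text \<open>Log-convexity propagates positivity from index 1 in both directions:
  \<open>(c 1)\<^sup>2 \<le> c 0 * c 2\<close> reaches index 0 as well as index 2. Starting from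
  \<open>c 0\<close> it would give nothing.\<close>

lemma c_pos: "0 < c n"
proof -
  have step: "0 < c (Suc (Suc n))" if "0 < c (Suc n)" for n
    using c_log_convex[of n] that c_nonneg[of n] c_nonneg[of "Suc (Suc n)"]
    by (cases "c (Suc (Suc n)) = 0") auto
  have "0 < c (Suc n)" for n
    using c1 c_nonneg[of 1] by (induction n) (auto intro: step)
  moreover have "0 < c 0"
    using c_log_convex[of 0] c1 c_nonneg[of 0] by (cases "c 0 = 0") auto
  ultimately show ?thesis
    by (cases n) auto
qed

definition r :: "nat \<Rightarrow> real" where "r n = c (Suc n) / c n"

definition rho :: real where "rho = lim r"

text \<open>In terms of the eigenvalues \<open>b n\<close> is the sum of
  \<open>\<lambda>\<^sup>2 * (\<lambda>\<^sup>2 / rho) ^ n\<close>, which decreases to rho times the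
  total multiplicity of the eigenvalues of modulus \<open>sqrt rho\<close>.\<close>

definition b :: "nat \<Rightarrow> real" where "b n = c n / rho ^ n"

lemma incseq_r: "incseq r"
proof (rule incseq_SucI)
  show "r n \<le> r (Suc n)" for n
    using c_log_convex[of n] c_pos[of n] c_pos[of "Suc n"]
    by (simp add: r_def field_simps power2_eq_square)
qed

lemma r_pos: "0 < r n"
  by (simp add: r_def c_pos)

lemma r_le_c0: "r n \<le> c 0"
  using c_submult[of 0 n] c_pos[of n] by (simp add: r_def field_simps)

lemma r_tendsto: "r \<longlonglongrightarrow> rho"
proof -
  have "convergent r"
    using r_le_c0 r_pos by (intro Bseq_monoseq_convergent incseq_imp_monoseq[OF incseq_r])
      (auto intro!: BseqI'[of _ "c 0"] simp: abs_of_pos)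
  then show ?thesis
    unfolding rho_def by (simp add: convergent_LIMSEQ_iff)
qed

lemma r_le_rho: "r n \<le> rho"
  using incseq_le[OF incseq_r r_tendsto] .

lemma rho_pos: "0 < rho"
  using r_pos[of 0] r_le_rho[of 0] by simp

lemma b_pos: "0 < b n"
  by (simp add: b_def c_pos rho_pos)

lemma b_Suc: "b (Suc n) = b n * (r n / rho)"
  using c_pos[of n] rho_pos by (simp add: b_def r_def field_simps)

lemma decseq_b: "decseq b"
proof (rule decseq_SucI)
  show "b (Suc n) \<le> b n" for n
    unfolding b_Suc using r_le_rho[of n] rho_pos b_pos[of n]
    by (intro mult_left_le) auto
qed

lemma b_add: "b (m + n) = b m * (\<Prod>i<n. r (m + i) / rho)"
  by (induction n) (auto simp: b_Suc)

text \<open>This bound prevents the limit kernel from vanishing. Put p = b (m + n + 1) / b m.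
  Submultiplicativity of \<open>c\<close>, divided by \<open>b m\<close> and the powers of rho, says
  p * rho \<le> b n; and for fixed n the quotient p, a product of n + 1 ratios r / rho, tends to 1
  as m grows.\<close>

lemma rho_le_b: "rho \<le> b n"
proof (rule ccontr)
  assume "\<not> rho \<le> b n"
  then have lt: "b n / rho < 1"
    using rho_pos by simp
  have "(\<lambda>m. \<Prod>i<Suc n. r (m + i) / rho) \<longlonglongrightarrow> (\<Prod>i<Suc n. rho / rho)"
    using rho_pos by (intro tendsto_prod tendsto_divide LIMSEQ_ignore_initial_segment[OF r_tendsto] tendsto_const) auto
  then have "(\<lambda>m. \<Prod>i<Suc n. r (m + i) / rho) \<longlonglongrightarrow> 1"
    using rho_pos by simp
  from order_tendstoD(1)[OF this lt] obtain m where m: "b n / rho < (\<Prod>i<Suc n. r (m + i) / rho)"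
    unfolding eventually_sequentially by blast
  define p where "p = (\<Prod>i<Suc n. r (m + i) / rho)"
  have c_eq: "c j = b j * rho ^ j" for j
    using rho_pos by (simp add: b_def)
  have "c (m + Suc n) \<le> c n * c m"
    using c_submult[of n m] by (simp only: add_Suc_right add.commute)
  then have "b m * p * rho ^ (m + Suc n) \<le> (b n * rho ^ n) * (b m * rho ^ m)"
    unfolding c_eq b_add p_def .
  then have "(p * rho) * (b m * rho ^ (n + m)) \<le> b n * (b m * rho ^ (n + m))"
    by (simp add: power_add mult_ac)
  then have "p * rho \<le> b n"
    using rho_pos b_pos[of m] by (simp only: mult_le_cancel_right_pos mult_pos_pos zero_less_power)
  then show False
    using m rho_pos unfolding p_def[symmetric] by (simp add: field_simps)
qed

text \<open>The squared norms d n of the iterates of f are log-convex, so their ratios never fall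
  below the first one, x = d 1 / d 0. If x exceeded rho, they would outgrow the bound
  \<open>c n * d 0\<close>, whose growth rate is only rho.\<close>

lemma sq_T_le:
  assumes f: "f \<in> L2 N"
  shows "sq N (T f) \<le> rho * sq N f"
proof (rule ccontr)
  define d where "d n = sq N ((T ^^ n) f)" for n
  assume "\<not> sq N (T f) \<le> rho * sq N f"
  then have gt: "rho * d 0 < d 1"
    by (simp add: d_def)
  have "d 0 \<noteq> 0"
    using gt sq_Tpow_le[OF f, of 0] by (auto simp: d_def)
  then have d0: "0 < d 0"
    using sq_nonneg[of N f] by (simp add: d_def)
  define x where "x = d 1 / d 0"
  have x: "rho < x"
    using gt d0 by (simp add: x_def field_simps)
  have x0: "0 < x"
    using x rho_pos by simp
  have conv: "(d (Suc n))\<^sup>2 \<le> d n * d (Suc (Suc n))" for n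
  proof -
    have "ip N ((T ^^ n) f) (T (T ((T ^^ n) f))) = of_real (d (Suc n))"
      using T_sym[OF Tpow_L2[OF f] T_L2[OF Tpow_L2[OF f]], of n n] ip_self[OF Tpow_L2[OF f, of "Suc n"]]
      by (simp add: d_def)
    then show ?thesis
      using Cauchy_Schwarz_ip[OF Tpow_L2[OF f] T_L2[OF T_L2[OF Tpow_L2[OF f]]], of n n] by (simp add: d_def)
  qed
  have step: "0 < d n \<and> x * d n \<le> d (Suc n)" for n
  proof (induction n)
    case 0
    then show ?case using d0 by (simp add: x_def)
  next
    case (Suc n)
    then have pos: "0 < d (Suc n)"
      using x0 by (meson less_le_trans mult_pos_pos)
    have "(x * d n) * d (Suc n) \<le> (d (Suc n))\<^sup>2"
      using Suc pos by (simp add: power2_eq_square)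
    also have "\<dots> \<le> d n * d (Suc (Suc n))"
      by (rule conv)
    finally have "d n * (x * d (Suc n)) \<le> d n * d (Suc (Suc n))"
      by (simp add: mult_ac)
    then show ?case
      using Suc pos by (simp add: mult_le_cancel_left)
  qed
  have ge: "x ^ n * d 0 \<le> d n" for n
  proof (induction n)
    case (Suc n)
    then have "x * (x ^ n * d 0) \<le> x * d n"
      using x0 by simp
    then show ?case
      using step[of n] by simp
  qed simp
  \<comment> \<open>Here \<open>c n = b n * rho ^ n\<close>, and \<open>b\<close> is decreasing, so
    \<open>b 0\<close> serves as a constant independent of n.\<close>
  have bound: "x * (x / rho) ^ n \<le> b 0" for n
  proof -
    have "x ^ Suc n * d 0 \<le> c n * d 0"
      using ge[of "Suc n"] sq_Tpow_le[OF f, of n] unfolding d_def by simp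
    then have "x ^ Suc n \<le> b n * rho ^ n"
      using d0 rho_pos by (simp add: b_def)
    also have "\<dots> \<le> b 0 * rho ^ n"
      using decseqD[OF decseq_b, of 0 n] rho_pos by (intro mult_right_mono) auto
    finally show ?thesis
      using rho_pos by (simp add: field_simps)
  qed
  obtain n where "b 0 / x < (x / rho) ^ n"
    using real_arch_pow[of "x / rho" "b 0 / x"] x rho_pos by auto
  then show False
    using bound[of n] x0 by (simp add: field_simps)
qed

text \<open>\<open>kpow N K (2 * n)\<close> belongs to the power 2n + 1 of T. Starting from T and
  multiplying by T twice at a time keeps the signs of the eigenvalues fixed along the
  sequence.\<close>

definition X :: "nat \<Rightarrow> 'a \<times> 'a \<Rightarrow> complex" where
  "X n = (\<lambda>z. of_real (1 / rho ^ n) * kpow N K (2 * n) z)"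

lemma X_L2: "X n \<in> L2 (N \<Otimes>\<^sub>M N)"
  unfolding X_def by (intro L2_scale kpow_L2)

text \<open>The Gram matrix depends on n + m only, which reduces the Cauchy property of these
  kernels to the convergence of the real sequence \<open>b\<close>.\<close>

lemma ip_X: "ip (N \<Otimes>\<^sub>M N) (X n) (X m) = of_real (b (n + m))"
  unfolding X_def ip_scale_left ip_scale_right
  by (subst ip_kpow_eq[of _ _ "n + m"]) (auto simp: b_def power_add)

lemma sq_X: "sq (N \<Otimes>\<^sub>M N) (X n) = b (2 * n)"
  using ip_X[of n n] ip_self[OF X_L2, of n] by (simp add: mult_2)

lemma Cauchy_X:
  assumes "0 < e"
  shows "\<exists>M. \<forall>n\<ge>M. \<forall>m\<ge>M. sq (N \<Otimes>\<^sub>M N) (\<lambda>z. X n z - X m z) < e"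
proof -
  have "convergent b"
    using decseqD[OF decseq_b, of 0] b_pos by (intro Bseq_monoseq_convergent decseq_imp_monoseq[OF decseq_b])
      (auto intro!: BseqI'[of _ "b 0"] simp: abs_of_pos)
  then obtain l where l: "b \<longlonglongrightarrow> l"
    by (auto simp: convergent_def)
  obtain M where M: "\<And>n. n \<ge> M \<Longrightarrow> \<bar>b n - l\<bar> < e / 4"
    using LIMSEQ_D[OF l, of "e / 4"] assms by auto
  have "sq (N \<Otimes>\<^sub>M N) (\<lambda>z. X n z - X m z) < e" if "n \<ge> M" "m \<ge> M" for n m
  proof -
    have "sq (N \<Otimes>\<^sub>M N) (\<lambda>z. X n z - X m z) = b (2 * n) - 2 * b (n + m) + b (2 * m)"
      by (simp add: sq_diff[OF X_L2 X_L2] sq_X ip_X)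
    moreover have "\<bar>b (2 * n) - l\<bar> < e / 4" "\<bar>b (n + m) - l\<bar> < e / 4" "\<bar>b (2 * m) - l\<bar> < e / 4"
      using that by (intro M; simp)+
    ultimately show ?thesis
      by linarith
  qed
  then show ?thesis
    by blast
qed

lemma limit_kernel:
  assumes P: "P \<in> L2 (N \<Otimes>\<^sub>M N)" and lim: "(\<lambda>n. sq (N \<Otimes>\<^sub>M N) (\<lambda>z. X n z - P z)) \<longlonglongrightarrow> 0"
  shows "0 < sq (N \<Otimes>\<^sub>M N) P"
    and "f \<in> L2 N \<Longrightarrow> AE t in N. T (T (kop N P f)) t = rho * kop N P f t"
proof -
  \<comment> \<open>The squared norm of \<open>X n\<close> is \<open>b (2 * n)\<close>, which is at
    least rho for every n; a zero limit would contradict this.\<close>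
  have "rho \<le> 2 * sq (N \<Otimes>\<^sub>M N) (\<lambda>z. X n z - P z) + 2 * sq (N \<Otimes>\<^sub>M N) P" for n
    using sq_add_le[OF L2_diff[OF X_L2 P] P, of n] rho_le_b[of "2 * n"] by (simp add: sq_X)
  then have "rho \<le> 2 * 0 + 2 * sq (N \<Otimes>\<^sub>M N) P"
    by (intro LIMSEQ_le_const[OF tendsto_add[OF tendsto_mult[OF tendsto_const lim] tendsto_const]]) auto
  then show "0 < sq (N \<Otimes>\<^sub>M N) P"
    using rho_pos by simp
next
  assume f: "f \<in> L2 N"
  define v where "v = kop N P f"
  define w where "w n = kop N (X n) f" for n
  have v: "v \<in> L2 N" and w: "w n \<in> L2 N" for n
    unfolding v_def w_def using kop_L2 P X_L2 f by auto
  note [measurable] = L2_measurable[OF v] L2_measurable[OF w]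
  have wv: "(\<lambda>n. sq N (\<lambda>t. w n t - v t)) \<longlonglongrightarrow> 0"
  proof (rule tendsto_sandwich[OF _ _ tendsto_const])
    show "\<forall>\<^sub>F n in sequentially. 0 \<le> sq N (\<lambda>t. w n t - v t)"
      by (simp add: sq_nonneg)
    have "sq N (\<lambda>t. w n t - v t) \<le> sq (N \<Otimes>\<^sub>M N) (\<lambda>z. X n z - P z) * sq N f" for n
    proof -
      have "sq N (\<lambda>t. w n t - v t) = sq N (kop N (\<lambda>z. X n z - P z) f)"
        using kop_diff_kernel[OF X_L2 P f, of n] kop_L2(1)[OF L2_diff[OF X_L2 P] f, of n]
        by (intro sq_cong_AE) (auto simp flip: v_def w_def dest: L2_measurable)
      also have "\<dots> \<le> sq (N \<Otimes>\<^sub>M N) (\<lambda>z. X n z - P z) * sq N f"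
        by (intro kop_L2 L2_diff X_L2 P f)
      finally show ?thesis .
    qed
    then show "\<forall>\<^sub>F n in sequentially. sq N (\<lambda>t. w n t - v t) \<le> sq (N \<Otimes>\<^sub>M N) (\<lambda>z. X n z - P z) * sq N f"
      by simp
    show "(\<lambda>n. sq (N \<Otimes>\<^sub>M N) (\<lambda>z. X n z - P z) * sq N f) \<longlonglongrightarrow> 0"
      using tendsto_mult_right[OF lim, of "sq N f"] by simp
  qed
  \<comment> \<open>Applying T twice advances the sequence by one step, up to the factor
    rho.\<close>
  have TTw: "AE t in N. T (T (w n)) t = rho * w (Suc n) t" for n
  proof -
    have a1: "T (T (w n)) t = of_real (1 / rho ^ n) * T (T (kop N (kpow N K (2 * n)) f)) t" for t
    proof -
      have w_eq: "w n = (\<lambda>t. of_real (1 / rho ^ n) * kop N (kpow N K (2 * n)) f t)"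
        by (rule ext) (simp only: w_def X_def kop_scale_kernel)
      have T_eq: "T (\<lambda>t. of_real (1 / rho ^ n) * g t) = (\<lambda>t. of_real (1 / rho ^ n) * T g t)" for g
        by (rule ext) (rule kop_scale)
      show ?thesis
        by (simp only: w_eq T_eq)
    qed
    have m: "kop N (kpow N K j) f \<in> borel_measurable N" for j
      by (intro L2_measurable kop_L2 kpow_L2 f)
    have a2: "AE t in N. T (kop N (kpow N K (Suc (2 * n))) f) t = T (T (kop N (kpow N K (2 * n)) f)) t"
      using kop_comp[OF K_L2 kpow_L2 f, of "2 * n"]
      by (intro kop_cong L2_measurable[OF K_L2] L2_measurable[OF T_L2] m kop_L2(1) kpow_L2 f) simp
    have a3: "AE t in N. kop N (kpow N K (2 * Suc n)) f t = T (kop N (kpow N K (Suc (2 * n))) f) t"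
      using kop_comp[OF K_L2 kpow_L2 f, of "Suc (2 * n)"] by simp
    show ?thesis
      using a2 a3
    proof eventually_elim
      case (elim t)
      have "w (Suc n) t = of_real (1 / rho ^ Suc n) * T (T (kop N (kpow N K (2 * n)) f)) t"
        using elim by (simp only: w_def X_def kop_scale_kernel)
      then show ?case
        using rho_pos unfolding a1 by simp
    qed
  qed
  \<comment> \<open>Insert rho w(n+1) = T T w(n): then T T v - rho v equals rho (w(n+1) - v) - T T
    (w(n) - v), and both terms tend to 0 because T is bounded, with \<open>c 0\<close> as a bound
    for its squared norm.\<close>
  have le: "sq N (\<lambda>t. T (T v) t - rho * v t) \<le>
      2 * ((c 0)\<^sup>2 * sq N (\<lambda>t. w n t - v t)) + 2 * (rho\<^sup>2 * sq N (\<lambda>t. w (Suc n) t - v t))" for n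
  proof -
    have "AE t in N. T (T (\<lambda>t. w n t - v t)) t = T (\<lambda>t. T (w n) t - T v t) t"
      using kop_diff[OF K_L2 w v, of n]
      by (intro kop_cong L2_measurable[OF K_L2] L2_measurable[OF T_L2] L2_measurable[OF L2_diff] L2_diff T_L2 v w)
    moreover have "AE t in N. T (\<lambda>t. T (w n) t - T v t) t = T (T (w n)) t - T (T v) t"
      by (intro kop_diff K_L2 T_L2 v w)
    ultimately have "AE t in N. T (T v) t - rho * v t = rho * (w (Suc n) t - v t) - T (T (\<lambda>t. w n t - v t)) t"
      using TTw[of n] by eventually_elim (simp add: algebra_simps)
    then have "sq N (\<lambda>t. T (T v) t - rho * v t) = sq N (\<lambda>t. rho * (w (Suc n) t - v t) - T (T (\<lambda>t. w n t - v t)) t)"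
      by (intro sq_cong_AE L2_measurable[OF L2_diff] L2_diff T_L2 L2_scale v w)
    also have "\<dots> \<le> 2 * sq N (\<lambda>t. rho * (w (Suc n) t - v t)) + 2 * sq N (T (T (\<lambda>t. w n t - v t)))"
      by (intro sq_diff_le L2_scale L2_diff T_L2 v w)
    also have "sq N (\<lambda>t. rho * (w (Suc n) t - v t)) = rho\<^sup>2 * sq N (\<lambda>t. w (Suc n) t - v t)"
      by (simp add: sq_scale)
    also have "sq N (T (T (\<lambda>t. w n t - v t))) \<le> c 0 * sq N (T (\<lambda>t. w n t - v t))"
      using sq_Tpow_le[of "T (\<lambda>t. w n t - v t)" 0] by (simp add: T_L2 L2_diff v w)
    also have "\<dots> \<le> c 0 * (c 0 * sq N (\<lambda>t. w n t - v t))"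
      using sq_Tpow_le[of "\<lambda>t. w n t - v t" 0] by (intro mult_left_mono c_nonneg) (simp add: L2_diff v w)
    finally show ?thesis
      by (simp add: power2_eq_square)
  qed
  have "(\<lambda>n. 2 * ((c 0)\<^sup>2 * sq N (\<lambda>t. w n t - v t)) + 2 * (rho\<^sup>2 * sq N (\<lambda>t. w (Suc n) t - v t))) \<longlonglongrightarrow>
      2 * ((c 0)\<^sup>2 * 0) + 2 * (rho\<^sup>2 * 0)"
    by (intro tendsto_intros wv LIMSEQ_Suc[OF wv])
  then have "sq N (\<lambda>t. T (T v) t - rho * v t) \<le> 0"
    by (intro LIMSEQ_le_const[where X="\<lambda>n. 2 * ((c 0)\<^sup>2 * sq N (\<lambda>t. w n t - v t)) + 2 * (rho\<^sup>2 * sq N (\<lambda>t. w (Suc n) t - v t))"])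
      (use le in auto)
  then have "AE t in N. T (T v) t - rho * v t = 0"
    using sq_nonneg[of N "\<lambda>t. T (T v) t - rho * v t"]
    by (subst sq_eq_0_iff[symmetric]) (auto intro!: L2_diff T_L2 L2_scale v)
  then show "AE t in N. T (T (kop N P f)) t = rho * kop N P f t"
    by (simp add: v_def)
qed

text \<open>On the eigenspace of the square of T the factors T - sqrt rho and T + sqrt rho multiply
  to 0. So (T + sqrt rho) v is an eigenvector for sqrt rho, or it vanishes and v itself is one for -
  sqrt rho.\<close>

lemma eigenvector:
  fixes v u :: "'a \<Rightarrow> complex"
  assumes v: "v \<in> L2 N" and TTv: "AE t in N. T (T v) t = rho * v t"
  defines "u \<equiv> (\<lambda>t. T v t + of_real (sqrt rho) * v t)"
  shows "u \<in> L2 N" "AE t in N. T u t = sqrt rho * u t" "sq N u = 0 \<Longrightarrow> AE t in N. T v t = - sqrt rho * v t"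
proof -
  show u: "u \<in> L2 N"
    unfolding u_def by (intro L2_add L2_scale T_L2 v)
  have "AE t in N. T u t = T (T v) t + T (\<lambda>t. sqrt rho * v t) t"
    unfolding u_def by (intro kop_add K_L2 T_L2 L2_scale v)
  then show "AE t in N. T u t = sqrt rho * u t"
    using TTv
  proof eventually_elim
    case (elim t)
    have "complex_of_real rho = sqrt rho * sqrt rho"
      using rho_pos by (simp flip: of_real_mult)
    moreover have "T u t = of_real rho * v t + of_real (sqrt rho) * T v t"
      using elim by (simp add: kop_scale)
    ultimately show ?case
      by (simp only: u_def distrib_left of_real_mult mult.assoc add.commute)
  qed
  show "AE t in N. T v t = - sqrt rho * v t" if "sq N u = 0"
    using that unfolding sq_eq_0_iff[OF u] unfolding u_def
    by eventually_elim (simp add: eq_neg_iff_add_eq_0)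
qed

end

section \<open>Measurable limits\<close>

text \<open>Both the measure and the integrand depend on x. Pushing \<open>L x\<close> forward along
  y \<mapsto> (x, y) leaves a fixed integrand on the product, with only the measure varying.\<close>

lemma integral_measurable_kernel:
  fixes f :: "'a \<Rightarrow> 'b \<Rightarrow> 'c::{banach, second_countable_topology}"
  assumes f[measurable]: "(\<lambda>(x, y). f x y) \<in> borel_measurable (M \<Otimes>\<^sub>M N)"
  assumes L[measurable]: "L \<in> measurable M (subprob_algebra N)"
  shows "(\<lambda>x. integral\<^sup>L (L x) (f x)) \<in> borel_measurable M"
proof -
  note measurable_distr2[measurable]
  have "(\<lambda>x. integral\<^sup>L (distr (L x) (M \<Otimes>\<^sub>M N) (\<lambda>y. (x, y))) (\<lambda>(x, y). f x y)) \<in> borel_measurable M"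
    by measurable
  then show "(\<lambda>x. integral\<^sup>L (L x) (f x)) \<in> borel_measurable M"
    by (rule measurable_cong[THEN iffD1, rotated]) (simp add: integral_distr)
qed

text \<open>Total mass at most 1 turns the square bounds \<open>(1 / 4) ^ j\<close> into bounds
  \<open>(1 / 2) ^ j\<close> for the integrals of the absolute differences. These are summable, so
  the telescoping series converges absolutely almost everywhere.\<close>

lemma AE_convergent_of_sq_summable:
  assumes Q: "subprob_space Q" and Y: "\<And>j. Y j \<in> L2 Q"
    and small: "\<And>j. sq Q (\<lambda>z. Y (Suc j) z - Y j z) \<le> (1 / 4) ^ j"
  shows "AE z in Q. convergent (\<lambda>j. Y j z)"
proof -
  interpret subprob_space Q by fact
  note L2_measurable[OF Y, measurable]
  have nn: "(\<integral>\<^sup>+z. ennreal (cmod (Y (Suc j) z - Y j z)) \<partial>Q) \<le> ennreal ((1 / 2) ^ j)" for j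
  proof -
    have D: "(\<lambda>z. Y (Suc j) z - Y j z) \<in> L2 Q"
      by (intro L2_diff Y)
    have "(\<integral>\<^sup>+z. ennreal (cmod (Y (Suc j) z - Y j z)) * 1 \<partial>Q)\<^sup>2 \<le>
        (\<integral>\<^sup>+z. (ennreal (cmod (Y (Suc j) z - Y j z)))\<^sup>2 \<partial>Q) * (\<integral>\<^sup>+z. 1\<^sup>2 \<partial>Q)"
      by (rule Cauchy_Schwarz_nn_integral) auto
    also have "(\<integral>\<^sup>+z. (ennreal (cmod (Y (Suc j) z - Y j z)))\<^sup>2 \<partial>Q) = ennreal (sq Q (\<lambda>z. Y (Suc j) z - Y j z))"
      using nn_sq[OF D] by (simp add: ennreal_power)
    also have "\<dots> * (\<integral>\<^sup>+z. 1\<^sup>2 \<partial>Q) \<le> ennreal ((1 / 4) ^ j) * 1"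
      using emeasure_space_le_1 by (intro mult_mono) (auto intro: ennreal_leI small)
    also have "ennreal ((1 / 4) ^ j) * 1 = (ennreal ((1 / 2) ^ j))\<^sup>2"
    proof -
      have "(1 / 4 :: real) ^ j = ((1 / 2) ^ j)\<^sup>2"
        by (simp add: power2_eq_square flip: power_mult_distrib)
      then show ?thesis
        by (simp add: ennreal_power)
    qed
    finally have "(\<integral>\<^sup>+z. ennreal (cmod (Y (Suc j) z - Y j z)) \<partial>Q)\<^sup>2 \<le> (ennreal ((1 / 2) ^ j))\<^sup>2"
      by simp
    then show ?thesis
      by (cases "\<integral>\<^sup>+z. ennreal (cmod (Y (Suc j) z - Y j z)) \<partial>Q" rule: ennreal_cases)
        (auto simp: ennreal_power ennreal_le_iff power2_eq_square top_unique ennreal_mult_eq_top_iff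
          simp flip: ennreal_mult intro: power2_le_imp_le[unfolded power2_eq_square])
  qed
  have "(\<integral>\<^sup>+z. (\<Sum>j. ennreal (cmod (Y (Suc j) z - Y j z))) \<partial>Q) = (\<Sum>j. \<integral>\<^sup>+z. ennreal (cmod (Y (Suc j) z - Y j z)) \<partial>Q)"
    by (intro nn_integral_suminf) auto
  also have "\<dots> \<le> (\<Sum>j. ennreal ((1 / 2) ^ j))"
    by (intro suminf_le nn) auto
  also have "\<dots> = ennreal 2"
    using suminf_geometric[of "1 / 2 :: real"] by (subst suminf_ennreal2) auto
  finally have "(\<integral>\<^sup>+z. (\<Sum>j. ennreal (cmod (Y (Suc j) z - Y j z))) \<partial>Q) \<noteq> \<infinity>"
    by (auto simp: top_unique)
  then have "AE z in Q. (\<Sum>j. ennreal (cmod (Y (Suc j) z - Y j z))) \<noteq> \<infinity>"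
    by (intro nn_integral_PInf_AE) auto
  then show ?thesis
  proof eventually_elim
    case (elim z)
    then have "summable (\<lambda>j. cmod (Y (Suc j) z - Y j z))"
      by (intro summable_suminf_not_top) auto
    then have "summable (\<lambda>j. Y (Suc j) z - Y j z)"
      by (rule summable_norm_cancel)
    then have "convergent (\<lambda>n. \<Sum>j<n. Y (Suc j) z - Y j z)"
      by (simp add: summable_iff_convergent)
    then have "convergent (\<lambda>n. Y n z - Y 0 z)"
      by (simp only: sum_lessThan_telescope[of "\<lambda>j. Y j z"])
    then show ?case
      using convergent_add_const_iff[of "Y 0 z" "\<lambda>n. Y n z - Y 0 z"] by simp
  qed
qed

text \<open>Fatou's lemma for the squared moduli.\<close>

lemma sq_limit_le:
  assumes f: "\<And>j. f j \<in> L2 Q" and P: "P \<in> borel_measurable Q"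
    and lim: "AE z in Q. (\<lambda>j. f j z) \<longlonglongrightarrow> P z"
    and le: "\<And>j. j \<ge> J \<Longrightarrow> sq Q (\<lambda>z. f j z) \<le> e" and "0 \<le> e"
  shows "P \<in> L2 Q" "sq Q P \<le> e"
proof -
  note L2_measurable[OF f, measurable] P[measurable]
  have "(\<integral>\<^sup>+z. ennreal ((cmod (P z))\<^sup>2) \<partial>Q) = (\<integral>\<^sup>+z. liminf (\<lambda>j. ennreal ((cmod (f j z))\<^sup>2)) \<partial>Q)"
    using lim
  proof (intro nn_integral_cong_AE, eventually_elim)
    case (elim z)
    then have "(\<lambda>j. ennreal ((cmod (f j z))\<^sup>2)) \<longlonglongrightarrow> ennreal ((cmod (P z))\<^sup>2)"
      by (intro tendsto_ennrealI tendsto_intros)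
    then show ?case
      by (rule lim_imp_Liminf[OF sequentially_bot, symmetric])
  qed
  also have "\<dots> \<le> liminf (\<lambda>j. \<integral>\<^sup>+z. ennreal ((cmod (f j z))\<^sup>2) \<partial>Q)"
    by (intro nn_integral_liminf) auto
  also have "\<dots> \<le> ennreal e"
  proof (rule Liminf_le)
    show "\<forall>\<^sub>F j in sequentially. (\<integral>\<^sup>+z. ennreal ((cmod (f j z))\<^sup>2) \<partial>Q) \<le> ennreal e"
      using eventually_ge_at_top[of J]
      by eventually_elim (simp add: nn_sq f ennreal_leI le)
  qed simp
  finally show "P \<in> L2 Q" "sq Q P \<le> e"
    using L2I_nn[OF P _ \<open>0 \<le> e\<close>] by auto
qed

text \<open>The Riesz-Fischer theorem with a parameter. The subsequence that converges almost
  everywhere has to depend on w; choosing least admissible indices makes this dependence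
  measurable.\<close>

lemma measurable_L2_limit:
  fixes X :: "nat \<Rightarrow> 'z \<times> 'w \<Rightarrow> complex"
  assumes Q[measurable]: "Q \<in> M \<rightarrow>\<^sub>M subprob_algebra Z"
    and X[measurable]: "\<And>n. X n \<in> borel_measurable (Z \<Otimes>\<^sub>M M)"
    and L2: "\<And>n w. w \<in> space M \<Longrightarrow> (\<lambda>z. X n (z, w)) \<in> L2 (Q w)"
    and Cauchy: "\<And>w e. w \<in> space M \<Longrightarrow> 0 < e \<Longrightarrow>
      \<exists>k. \<forall>n\<ge>k. \<forall>m\<ge>k. sq (Q w) (\<lambda>z. X n (z, w) - X m (z, w)) < e"
  shows "\<exists>P\<in>borel_measurable (Z \<Otimes>\<^sub>M M). \<forall>w\<in>space M.
    (\<lambda>z. P (z, w)) \<in> L2 (Q w) \<and> (\<lambda>n. sq (Q w) (\<lambda>z. X n (z, w) - P (z, w))) \<longlonglongrightarrow> 0"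
proof -
  have Qw: "subprob_space (Q w)" "sets (Q w) = sets Z" "space (Q w) = space Z" if "w \<in> space M" for w
    using measurable_space[OF Q that] by (auto simp: space_subprob_algebra dest: sets_eq_imp_space_eq)
  define C where "C j k w \<longleftrightarrow> (\<forall>n\<ge>k. \<forall>m\<ge>k. sq (Q w) (\<lambda>z. X n (z, w) - X m (z, w)) \<le> (1 / 4) ^ j)" for j k w
  have sqm[measurable]: "(\<lambda>w. sq (Q w) (\<lambda>z. X n (z, w) - X m (z, w))) \<in> borel_measurable M" for n m
    unfolding sq_def by (rule integral_measurable_kernel[OF _ Q]) measurable
  have [measurable]: "Measurable.pred M (C j k)" for j k
    unfolding C_def by measurable
  \<comment> \<open>The least index from which on all squared distances are at most
    \<open>(1 / 4) ^ j\<close>. It is measurable in w because \<open>C j k\<close> is a countable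
    conjunction of measurable conditions.\<close>
  define \<kappa> where "\<kappa> j w = (LEAST k. C j k w)" for j w
  have [measurable]: "\<kappa> j \<in> M \<rightarrow>\<^sub>M count_space UNIV" for j
    unfolding \<kappa>_def by measurable
  have \<kappa>: "C j (\<kappa> j w) w" if w: "w \<in> space M" for j w
  proof -
    obtain k where "\<forall>n\<ge>k. \<forall>m\<ge>k. sq (Q w) (\<lambda>z. X n (z, w) - X m (z, w)) < (1 / 4) ^ j"
      using Cauchy[OF w, of "(1 / 4) ^ j"] by auto
    then have "C j k w"
      unfolding C_def by (auto intro: less_imp_le)
    then show ?thesis
      unfolding \<kappa>_def by (rule LeastI)
  qed
  \<comment> \<open>The condition \<open>C\<close> gets stronger with j. Hence all
    \<open>Y i\<close> with i \<ge> j use indices at or beyond \<open>\<kappa> j w\<close>, where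
    the bound for j holds.\<close>
  have \<kappa>_mono: "\<kappa> j w \<le> \<kappa> i w" if "w \<in> space M" "j \<le> i" for i j w
  proof -
    have "(1 / 4 :: real) ^ i \<le> (1 / 4) ^ j"
      using that(2) by (intro power_decreasing) auto
    then have "C j (\<kappa> i w) w"
      using \<kappa>[OF that(1), of i] unfolding C_def by (meson order_trans)
    then show ?thesis
      unfolding \<kappa>_def[of j] by (rule Least_le)
  qed
  define Y where "Y j = (\<lambda>(z, w). X (\<kappa> j w) (z, w))" for j
  have Y[measurable]: "Y j \<in> borel_measurable (Z \<Otimes>\<^sub>M M)" for j
  proof -
    have "(\<lambda>x. X (\<kappa> j (snd x)) x) \<in> borel_measurable (Z \<Otimes>\<^sub>M M)"
      by (rule measurable_compose_countable[OF X]) measurable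
    then show ?thesis
      by (simp add: Y_def split_beta')
  qed
  \<comment> \<open>Where the sequence diverges \<open>lim\<close> gives an unspecified value, but
    still a measurable function; for each w in \<open>space M\<close> these points form a null set
    of \<open>Q w\<close>.\<close>
  define P where "P x = lim (\<lambda>j. Y j x)" for x
  have P[measurable]: "P \<in> borel_measurable (Z \<Otimes>\<^sub>M M)"
    unfolding P_def[abs_def] by measurable
  have "(\<lambda>z. P (z, w)) \<in> L2 (Q w) \<and> (\<lambda>n. sq (Q w) (\<lambda>z. X n (z, w) - P (z, w))) \<longlonglongrightarrow> 0"
    if w[measurable]: "w \<in> space M" for w
  proof -
    have YL2: "(\<lambda>z. Y j (z, w)) \<in> L2 (Q w)" for j
      unfolding Y_def using L2[OF w] by simp
    have "(\<lambda>z. P (z, w)) \<in> borel_measurable Z"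
      by measurable
    then have [measurable]: "(\<lambda>z. P (z, w)) \<in> borel_measurable (Q w)"
      using measurable_cong_sets[OF Qw(2)[OF w] refl] by blast
    note [measurable] = L2_measurable[OF L2[OF w]]
    have conv: "AE z in Q w. (\<lambda>j. Y j (z, w)) \<longlonglongrightarrow> P (z, w)"
    proof -
      have "sq (Q w) (\<lambda>z. Y (Suc j) (z, w) - Y j (z, w)) \<le> (1 / 4) ^ j" for j
        using \<kappa>[OF w, of j] \<kappa>_mono[OF w, of j "Suc j"] unfolding C_def Y_def by simp
      from AE_convergent_of_sq_summable[OF Qw(1)[OF w] YL2 this]
      show ?thesis
        by eventually_elim (simp add: P_def convergent_LIMSEQ_iff)
    qed
    have *: "(\<lambda>z. X n (z, w) - P (z, w)) \<in> L2 (Q w) \<and> sq (Q w) (\<lambda>z. X n (z, w) - P (z, w)) \<le> (1 / 4) ^ j"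
      if "\<kappa> j w \<le> n" for n j
    proof -
      have "sq (Q w) (\<lambda>z. X n (z, w) - Y i (z, w)) \<le> (1 / 4) ^ j" if "j \<le> i" for i
        using \<kappa>[OF w, of j] \<kappa>_mono[OF w that] \<open>\<kappa> j w \<le> n\<close> unfolding C_def Y_def by simp
      moreover have "AE z in Q w. (\<lambda>i. X n (z, w) - Y i (z, w)) \<longlonglongrightarrow> X n (z, w) - P (z, w)"
        using conv by eventually_elim (intro tendsto_intros)
      moreover have "(\<lambda>z. X n (z, w) - P (z, w)) \<in> borel_measurable (Q w)"
        by measurable
      moreover have "(\<lambda>z. X n (z, w) - Y i (z, w)) \<in> L2 (Q w)" for i
        by (intro L2_diff L2 w YL2)
      moreover have "0 \<le> (1 / 4 :: real) ^ j"
        by simp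
      ultimately show ?thesis
        using sq_limit_le[of "\<lambda>i z. X n (z, w) - Y i (z, w)" "Q w" "\<lambda>z. X n (z, w) - P (z, w)" j "(1 / 4) ^ j"]
        by blast
    qed
    have "(\<lambda>z. X (\<kappa> 0 w) (z, w) - (X (\<kappa> 0 w) (z, w) - P (z, w))) \<in> L2 (Q w)"
      using *[of 0 "\<kappa> 0 w"] L2_diff[OF L2[OF w]] by blast
    moreover have "(\<lambda>n. sq (Q w) (\<lambda>z. X n (z, w) - P (z, w))) \<longlonglongrightarrow> 0"
    proof (rule LIMSEQ_I)
      fix e :: real assume "0 < e"
      then obtain j where "(1 / 4) ^ j < e"
        using real_arch_pow_inv[of e "1 / 4"] by auto
      then have "norm (sq (Q w) (\<lambda>z. X n (z, w) - P (z, w)) - 0) < e" if "\<kappa> j w \<le> n" for n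
        using *[OF that] sq_nonneg[of "Q w" "\<lambda>z. X n (z, w) - P (z, w)"] by simp
      then show "\<exists>no. \<forall>n\<ge>no. norm (sq (Q w) (\<lambda>z. X n (z, w) - P (z, w)) - 0) < e"
        by blast
    qed
    ultimately show ?thesis
      by simp
  qed
  then show ?thesis
    using P by blast
qed

section \<open>Countably many detecting sets\<close>

text \<open>Induction over the generation of the product \<sigma>-algebra: a rectangle needs one
  set, complements need nothing new, and a countable union collects countably many countable
  families. The same family serves all w.\<close>

lemma countable_sections_fst:
  assumes "B \<in> sets (S \<Otimes>\<^sub>M M)"
  shows "\<exists>D\<subseteq>sets S. countable D \<and> (\<forall>w. {s. (s, w) \<in> B} \<in> sigma_sets (space S) D)"
proof -
  have "B \<in> sigma_sets (space S \<times> space M) {a \<times> b |a b. a \<in> sets S \<and> b \<in> sets M}"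
    using assms by (simp add: sets_pair_measure)
  then show ?thesis
  proof (induction rule: sigma_sets.induct)
    case (Basic B)
    then obtain a b where B: "B = a \<times> b" "a \<in> sets S"
      by blast
    have "{s. (s, w) \<in> B} = (if w \<in> b then a else {})" for w
      by (auto simp: B)
    then show ?case
      using B by (intro exI[of _ "{a}"]) (auto intro: sigma_sets.intros)
  next
    case Empty
    show ?case by (intro exI[of _ "{}"]) (auto intro: sigma_sets.intros)
  next
    case (Compl B)
    then obtain D where D: "D \<subseteq> sets S" "countable D" "\<And>w. {s. (s, w) \<in> B} \<in> sigma_sets (space S) D"
      by blast
    have "{s. (s, w) \<in> space S \<times> space M - B} = (if w \<in> space M then space S - {s. (s, w) \<in> B} else {})" for w
      by auto
    then show ?case
      using D by (intro exI[of _ D]) (auto intro: sigma_sets.intros)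
  next
    case (Union B)
    then have "\<forall>i. \<exists>D\<subseteq>sets S. countable D \<and> (\<forall>w. {s. (s, w) \<in> B i} \<in> sigma_sets (space S) D)"
      by blast
    then obtain D where D: "\<And>i. D i \<subseteq> sets S" "\<And>i. countable (D i)"
        "\<And>i w. {s. (s, w) \<in> B i} \<in> sigma_sets (space S) (D i)"
      by metis
    have eq: "{s. (s, w) \<in> (\<Union>i. B i)} = (\<Union>i. {s. (s, w) \<in> B i})" for w
      by auto
    have "{s. (s, w) \<in> B i} \<in> sigma_sets (space S) (\<Union>i. D i)" for w i
      using sigma_sets_mono'[of "D i" "\<Union>i. D i"] D(3) by blast
    then show ?case
      using D unfolding eq by (intro exI[of _ "\<Union>i. D i"]) (auto intro: sigma_sets.Union)
  qed
qed

lemma countable_sections_mid: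
  assumes "E \<in> sets (S' \<Otimes>\<^sub>M (S \<Otimes>\<^sub>M M))"
  shows "\<exists>D\<subseteq>sets S. countable D \<and> (\<forall>t w. {s. (t, s, w) \<in> E} \<in> sigma_sets (space S) D)"
proof -
  have "(\<lambda>(s, t, w). (t, s, w)) -` E \<inter> space (S \<Otimes>\<^sub>M (S' \<Otimes>\<^sub>M M)) \<in> sets (S \<Otimes>\<^sub>M (S' \<Otimes>\<^sub>M M))" (is "?B \<in> _")
    using assms by (intro measurable_sets[OF _ assms]) measurable
  from countable_sections_fst[OF this] obtain D where D: "D \<subseteq> sets S" "countable D"
      "\<And>x. {s. (s, x) \<in> ?B} \<in> sigma_sets (space S) D"
    by blast
  have "{s. (t, s, w) \<in> E} = {s. (s, t, w) \<in> ?B}" for t w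
    using sets.sets_into_space[OF assms] by (auto simp: space_pair_measure)
  then show ?thesis
    using D by (intro exI[of _ D]) auto
qed

text \<open>Closing under finite intersections gives a countable \<pi>-system without enlarging the
  generated \<sigma>-algebra. The empty intersection, cut down to \<Omega>, supplies the whole
  space.\<close>

lemma countable_Int_stable_cover:
  assumes "countable D" "D \<subseteq> Pow \<Omega>"
  shows "\<exists>D'. countable D' \<and> D' \<subseteq> sigma_sets \<Omega> D \<and> D \<subseteq> D' \<and> Int_stable D' \<and> \<Omega> \<in> D'"
proof (intro exI[of _ "(\<lambda>F. \<Omega> \<inter> \<Inter>F) ` {F. finite F \<and> F \<subseteq> D}"] conjI)
  let ?D' = "(\<lambda>F. \<Omega> \<inter> \<Inter>F) ` {F. finite F \<and> F \<subseteq> D}"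
  show "countable ?D'"
    using countable_Collect_finite_subset[OF assms(1)] by (intro countable_image)
  show "D \<subseteq> ?D'"
  proof
    fix A assume "A \<in> D"
    then show "A \<in> ?D'"
      using assms(2) by (intro image_eqI[of _ _ "{A}"]) auto
  qed
  show "\<Omega> \<in> ?D'"
    by (intro image_eqI[of _ _ "{}"]) auto
  show "Int_stable ?D'"
  proof (rule Int_stableI_image)
    fix F G assume "F \<in> {F. finite F \<and> F \<subseteq> D}" "G \<in> {F. finite F \<and> F \<subseteq> D}"
    then show "\<exists>k\<in>{F. finite F \<and> F \<subseteq> D}. \<Omega> \<inter> \<Inter>F \<inter> (\<Omega> \<inter> \<Inter>G) = \<Omega> \<inter> \<Inter>k"
      by (intro bexI[of _ "F \<union> G"]) auto
  qed
  interpret sigma_algebra \<Omega> "sigma_sets \<Omega> D"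
    using assms(2) by (rule sigma_algebra_sigma_sets)
  have "\<Omega> \<inter> \<Inter>F \<in> sigma_sets \<Omega> D" if "finite F" "F \<subseteq> D" for F
    using that
  proof (induction rule: finite_induct)
    case (insert A F)
    have "\<Omega> \<inter> \<Inter>(insert A F) = A \<inter> (\<Omega> \<inter> \<Inter>F)"
      by auto
    then show ?case
      using insert by (auto intro!: Int)
  qed auto
  then show "?D' \<subseteq> sigma_sets \<Omega> D"
    by auto
qed

text \<open>Only the preimages of a countable basis of the complex plane have to be treated, so
  countably many countable families are merged into one that is independent of t and w.\<close>

lemma countable_sections_function:
  fixes P :: "'t \<times> 's \<times> 'w \<Rightarrow> complex"
  assumes P: "P \<in> borel_measurable (S' \<Otimes>\<^sub>M (S \<Otimes>\<^sub>M M))"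
  shows "\<exists>D\<subseteq>sets S. countable D \<and> Int_stable D \<and> space S \<in> D \<and>
    (\<forall>t\<in>space S'. \<forall>w\<in>space M. (\<lambda>s. P (t, s, w)) \<in> borel_measurable (sigma (space S) D))"
proof -
  obtain B :: "complex set set" where B: "countable B" "topological_basis B"
    using ex_countable_basis by blast
  have "\<forall>b\<in>B. \<exists>D\<subseteq>sets S. countable D \<and>
      (\<forall>t w. {s. (t, s, w) \<in> P -` b \<inter> space (S' \<Otimes>\<^sub>M (S \<Otimes>\<^sub>M M))} \<in> sigma_sets (space S) D)"
  proof
    fix b assume "b \<in> B"
    then have "b \<in> sets borel"
      using topological_basis_open[OF B(2)] by auto
    from countable_sections_mid[OF measurable_sets[OF P this]]
    show "\<exists>D\<subseteq>sets S. countable D \<and>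
        (\<forall>t w. {s. (t, s, w) \<in> P -` b \<inter> space (S' \<Otimes>\<^sub>M (S \<Otimes>\<^sub>M M))} \<in> sigma_sets (space S) D)" .
  qed
  then obtain D where D: "\<And>b. b \<in> B \<Longrightarrow> D b \<subseteq> sets S" "\<And>b. b \<in> B \<Longrightarrow> countable (D b)"
      "\<And>b t w. b \<in> B \<Longrightarrow> {s. (t, s, w) \<in> P -` b \<inter> space (S' \<Otimes>\<^sub>M (S \<Otimes>\<^sub>M M))} \<in> sigma_sets (space S) (D b)"
    by metis
  define D1 where "D1 = (\<Union>b\<in>B. D b)"
  have D1: "D1 \<subseteq> sets S" "countable D1"
    using D B(1) by (auto simp: D1_def)
  then have "D1 \<subseteq> Pow (space S)"
    using sets.sets_into_space by blast
  then obtain D' where D': "countable D'" "D' \<subseteq> sigma_sets (space S) D1" "D1 \<subseteq> D'" "Int_stable D'" "space S \<in> D'"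
    using countable_Int_stable_cover[OF D1(2)] by metis
  have D'S: "D' \<subseteq> sets S"
    using D'(2) sets.sigma_sets_subset[OF D1(1)] by blast
  then have D'pow: "D' \<subseteq> Pow (space S)"
    using sets.sets_into_space by blast
  have "(\<lambda>s. P (t, s, w)) \<in> borel_measurable (sigma (space S) D')" if t: "t \<in> space S'" and w: "w \<in> space M" for t w
    unfolding borel_eq_countable_basis[OF B]
  proof (rule measurable_measure_of)
    fix b assume b: "b \<in> B"
    have "(\<lambda>s. P (t, s, w)) -` b \<inter> space (sigma (space S) D') =
        {s. (t, s, w) \<in> P -` b \<inter> space (S' \<Otimes>\<^sub>M (S \<Otimes>\<^sub>M M))}"
      using t w D'pow by (auto simp: space_pair_measure)
    also have "\<dots> \<in> sigma_sets (space S) D'"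
      using D(3)[OF b, of t w] sigma_sets_mono'[of "D b" D' "space S"] D'(3) b unfolding D1_def by blast
    finally show "(\<lambda>s. P (t, s, w)) -` b \<inter> space (sigma (space S) D') \<in> sets (sigma (space S) D')"
      using D'pow by simp
  qed auto
  then show ?thesis
    using D' D'S by (intro exI[of _ D']) auto
qed

section \<open>Functions determined by their integrals over a \<pi>-system\<close>

lemma integrable_times_indicator:
  fixes f :: "'a \<Rightarrow> complex"
  assumes "A \<in> sets N" "integrable N f"
  shows "integrable N (\<lambda>x. f x * indicator A x)"
proof -
  have "(\<lambda>x. f x * indicator A x) = (\<lambda>x. indicator A x *\<^sub>R f x)"
    by (auto simp: indicator_def)
  then show ?thesis
    using integrable_mult_indicator[OF assms] by simp
qed

text \<open>Dynkin's argument: the sets with zero integral are closed under complements because the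
  whole space is among them, and under disjoint unions by dominated convergence with majorant
  |f|.\<close>

lemma integral_zero_on_sigma_sets:
  fixes f :: "'a \<Rightarrow> complex"
  assumes D: "Int_stable D" "D \<subseteq> sets N" "space N \<in> D" and f: "integrable N f"
    and zero: "\<And>A. A \<in> D \<Longrightarrow> (\<integral>x. f x * indicator A x \<partial>N) = 0"
    and A: "A \<in> sigma_sets (space N) D"
  shows "(\<integral>x. f x * indicator A x \<partial>N) = 0"
proof -
  have DP: "D \<subseteq> Pow (space N)"
    using D(2) sets.sets_into_space by blast
  have in_sets: "A \<in> sets N" if "A \<in> sigma_sets (space N) D" for A
    using sets.sigma_sets_subset[OF D(2)] that by blast
  have int: "integrable N (\<lambda>x. f x * indicator A x)" if "A \<in> sigma_sets (space N) D" for A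
    using integrable_times_indicator[OF in_sets[OF that] f] .
  show ?thesis
    using D(1) DP A
  proof (induction rule: sigma_sets_induct_disjoint)
    case (basic A)
    then show ?case by (rule zero)
  next
    case empty
    then show ?case by simp
  next
    case (compl A)
    have "(\<integral>x. f x * indicator (space N - A) x \<partial>N) = (\<integral>x. f x * indicator (space N) x - f x * indicator A x \<partial>N)"
      by (intro Bochner_Integration.integral_cong) (auto simp: indicator_def)
    also have "\<dots> = 0"
      using compl zero[OF D(3)] int[OF compl(1)] int[OF sigma_sets_top]
      by (subst Bochner_Integration.integral_diff) auto
    finally show ?case .
  next
    case (union A)
    have Ai: "A i \<in> sigma_sets (space N) D" for i
      using union(2) by auto
    have "(\<lambda>i. \<integral>x. (\<Sum>j<i. f x * indicator (A j) x) \<partial>N) \<longlonglongrightarrow> (\<integral>x. f x * indicator (\<Union>i. A i) x \<partial>N)"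
    proof (rule integral_dominated_convergence[where w="\<lambda>x. norm (f x)"])
      have s: "(\<Sum>j<i. f x * indicator (A j) x) = f x * indicator (\<Union>j<i. A j) x" for i x
        using union(1) by (subst indicator_UN_disjoint) (auto simp: disjoint_family_on_def sum_distrib_left)
      show "AE x in N. norm (\<Sum>j<i. f x * indicator (A j) x) \<le> norm (f x)" for i
        unfolding s by (auto simp: indicator_def)
      show "AE x in N. (\<lambda>i. \<Sum>j<i. f x * indicator (A j) x) \<longlonglongrightarrow> f x * indicator (\<Union>i. A i) x"
        unfolding s by (intro AE_I2 tendsto_mult tendsto_const LIMSEQ_indicator_UN)
      show "(\<lambda>x. f x * indicator (\<Union>i. A i) x) \<in> borel_measurable N"
        by (rule borel_measurable_integrable[OF int[OF sigma_sets.Union[OF Ai]]])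
      show "(\<lambda>x. \<Sum>j<i. f x * indicator (A j) x) \<in> borel_measurable N" for i
        by (intro borel_measurable_sum borel_measurable_integrable int Ai)
    qed (use f in simp)
    moreover have "(\<integral>x. (\<Sum>j<i. f x * indicator (A j) x) \<partial>N) = 0" for i
      using int[OF Ai] union(3) by (subst Bochner_Integration.integral_sum) auto
    ultimately show ?case
      using LIMSEQ_unique[OF _ tendsto_const] by simp
  qed
qed

lemma AE_nonpos_of_integral_zero:
  fixes h :: "'a \<Rightarrow> real"
  assumes h: "integrable N h" and zero: "(\<integral>x. h x * indicator {x \<in> space N. 0 < h x} x \<partial>N) = 0"
  shows "AE x in N. h x \<le> 0"
proof -
  have [measurable]: "h \<in> borel_measurable N"
    using h by (rule borel_measurable_integrable)
  have "integrable N (\<lambda>x. h x * indicator {x \<in> space N. 0 < h x} x)"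
    using integrable_mult_indicator[OF _ h, of "{x \<in> space N. 0 < h x}"] by (simp add: mult.commute)
  then have "AE x in N. h x * indicator {x \<in> space N. 0 < h x} x = 0"
    using zero by (subst (asm) integral_nonneg_eq_0_iff_AE) (auto simp: indicator_def)
  then show ?thesis
    using AE_space by eventually_elim (auto simp: indicator_def split: if_splits)
qed

text \<open>Since f is measurable for the small \<sigma>-algebra, the sets where one of Re f, - Re
  f, Im f, - Im f is positive belong to it. The integral of f over them is therefore 0, which makes
  each of the four functions nonpositive almost everywhere.\<close>

lemma AE_zero_of_integral_zero_on_sigma_sets:
  fixes f :: "'a \<Rightarrow> complex"
  assumes D: "Int_stable D" "D \<subseteq> sets N" "space N \<in> D" and f: "integrable N f"
    and zero: "\<And>A. A \<in> D \<Longrightarrow> (\<integral>x. f x * indicator A x \<partial>N) = 0"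
    and fm: "f \<in> borel_measurable (sigma (space N) D)"
  shows "AE x in N. f x = 0"
proof -
  have DP: "D \<subseteq> Pow (space N)"
    using D(2) sets.sets_into_space by blast
  have z: "(\<integral>x. f x * indicator A x \<partial>N) = 0" if "A \<in> sets (sigma (space N) D)" for A
    using integral_zero_on_sigma_sets[OF D f zero] that DP by simp
  have sub: "sets (sigma (space N) D) \<subseteq> sets N"
    using sets.sigma_sets_subset[OF D(2)] DP by simp
  have int: "integrable N (\<lambda>x. f x * indicator A x)" if "A \<in> sets (sigma (space N) D)" for A
    using integrable_times_indicator[OF _ f, of A] sub that by auto
  have le: "AE x in N. g (f x) \<le> 0"
    if g: "bounded_linear g" and gm: "g \<in> borel_measurable borel" for g :: "complex \<Rightarrow> real"
  proof (rule AE_nonpos_of_integral_zero)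
    show "integrable N (\<lambda>x. g (f x))"
      by (rule integrable_bounded_linear[OF g f])
    let ?A = "{x \<in> space N. 0 < g (f x)}"
    have "(\<lambda>x. g (f x)) \<in> borel_measurable (sigma (space N) D)"
      using measurable_compose[OF fm gm] .
    then have "{x \<in> space (sigma (space N) D). 0 < g (f x)} \<in> sets (sigma (space N) D)"
      by measurable
    then have A: "?A \<in> sets (sigma (space N) D)"
      using DP by simp
    interpret bounded_linear g by fact
    have "(\<integral>x. g (f x) * indicator ?A x \<partial>N) = (\<integral>x. g (f x * indicator ?A x) \<partial>N)"
      by (intro Bochner_Integration.integral_cong) (auto simp: indicator_def)
    also have "\<dots> = g (\<integral>x. f x * indicator ?A x \<partial>N)"
      by (rule integral_bounded_linear[OF g int[OF A]])
    finally show "(\<integral>x. g (f x) * indicator ?A x \<partial>N) = 0"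
      using z[OF A] by simp
  qed
  have "AE x in N. Re (f x) \<le> 0" "AE x in N. - Re (f x) \<le> 0" "AE x in N. Im (f x) \<le> 0" "AE x in N. - Im (f x) \<le> 0"
    using le[of Re] le[of "\<lambda>z. - Re z"] le[of Im] le[of "\<lambda>z. - Im z"]
    by (auto intro: bounded_linear_minus bounded_linear_Re bounded_linear_Im)
  then show ?thesis
    by eventually_elim (auto simp: complex_eq_iff)
qed

text \<open>If the operator annihilates all indicators of a \<pi>-system for which the rows P(t, .,
  w) are measurable, then almost every row vanishes. The sets are chosen before w and the measure,
  so one sequence serves the whole family.\<close>

lemma countable_detecting_sets:
  fixes P :: "'s \<times> 's \<times> 'w \<Rightarrow> complex"
  assumes P: "P \<in> borel_measurable (S \<Otimes>\<^sub>M (S \<Otimes>\<^sub>M M))"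
  shows "\<exists>A :: nat \<Rightarrow> 's set. (\<forall>i. A i \<in> sets S) \<and>
    (\<forall>w\<in>space M. \<forall>N. finite_measure N \<longrightarrow> sets N = sets S \<longrightarrow> (\<lambda>(t, s). P (t, s, w)) \<in> L2 (N \<Otimes>\<^sub>M N) \<longrightarrow>
      0 < sq (N \<Otimes>\<^sub>M N) (\<lambda>(t, s). P (t, s, w)) \<longrightarrow>
      (\<exists>i. 0 < sq N (kop N (\<lambda>(t, s). P (t, s, w)) (indicator (A i)))))"
proof -
  obtain D where D: "D \<subseteq> sets S" "countable D" "Int_stable D" "space S \<in> D"
      "\<And>t w. t \<in> space S \<Longrightarrow> w \<in> space M \<Longrightarrow> (\<lambda>s. P (t, s, w)) \<in> borel_measurable (sigma (space S) D)"
    using countable_sections_function[OF P] by metis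
  define A where "A = from_nat_into D"
  have rA: "range A = D"
    unfolding A_def using D(2,4) by (intro range_from_nat_into) auto
  have "\<exists>i. 0 < sq N (kop N (\<lambda>(t, s). P (t, s, w)) (indicator (A i)))"
    if w: "w \<in> space M" and "finite_measure N" and sets: "sets N = sets S"
      and L2: "(\<lambda>(t, s). P (t, s, w)) \<in> L2 (N \<Otimes>\<^sub>M N)" (is "?P \<in> _")
      and pos: "0 < sq (N \<Otimes>\<^sub>M N) (\<lambda>(t, s). P (t, s, w))" for w N
  proof (rule ccontr)
    interpret finite_measure N by fact
    interpret finite_measure_L2 N ..
    have sp: "space N = space S"
      using sets by (rule sets_eq_imp_space_eq)
    note L2_measurable[OF L2, measurable]
    assume neg: "\<not> (\<exists>i. 0 < sq N (kop N ?P (indicator (A i))))"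
    have z: "sq N (kop N ?P (indicator (A i))) = 0" for i
    proof -
      have "\<not> 0 < sq N (kop N ?P (indicator (A i)))"
        using neg by blast
      then show ?thesis
        using sq_nonneg[of N "kop N ?P (indicator (A i))"] by linarith
    qed
    have ind: "indicator (A i) \<in> L2 N" for i
    proof (intro L2_bounded[where B=1] finite_measure_axioms borel_measurable_indicator)
      show "A i \<in> sets N"
        using rA D(1) sets by auto
    qed (auto simp: indicator_def)
    have "AE t in N. \<forall>i. kop N ?P (indicator (A i)) t = 0"
      unfolding AE_all_countable
      using sq_eq_0_iff[OF kop_L2(1)[OF L2 ind]] z by auto
    then have "AE t in N. AE s in N. P (t, s, w) = 0"
      using AE_row_L2[OF L2] AE_space
    proof eventually_elim
      case (elim t)
      show ?case
      proof (rule AE_zero_of_integral_zero_on_sigma_sets[where D=D])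
        show "integrable N (\<lambda>s. P (t, s, w))"
          using L2_mult_integrable[OF elim(2) L2_bounded[OF finite_measure_axioms, of "\<lambda>_. 1" 1]] by simp
        show "(\<integral>s. P (t, s, w) * indicator B s \<partial>N) = 0" if "B \<in> D" for B
          using elim(1) that rA by (auto simp: kop_def)
      qed (use D w elim(3) sets sp in auto)
    qed
    then have "AE x in N \<Otimes>\<^sub>M N. ?P x = 0"
      using NN.AE_pair_iff[of "\<lambda>t s. P (t, s, w) = 0"] by (simp add: split_beta')
    then show False
      using pos sq_eq_0_iff[OF L2] by simp
  qed
  moreover have "\<forall>i. A i \<in> sets S"
    using rA D(1) by auto
  ultimately show ?thesis
    by blast
qed

section \<open>Measurable top eigenvectors\<close>

definition kslice :: "('t \<times> 's \<times> 'w \<Rightarrow> complex) \<Rightarrow> 'w \<Rightarrow> 't \<times> 's \<Rightarrow> complex" where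
  "kslice K w = (\<lambda>(t, s). K (t, s, w))"

text \<open>Measurability into \<open>subprob_algebra S\<close> is what makes integrals against
  \<open>N w\<close> measurable in w, for arbitrary \<open>S\<close>.\<close>

locale kernel_family =
  fixes M :: "'w measure" and S :: "'s measure" and N :: "'w \<Rightarrow> 's measure"
  assumes N_measurable[measurable]: "N \<in> M \<rightarrow>\<^sub>M subprob_algebra S"
begin

definition HS_family :: "('s \<times> 's \<times> 'w \<Rightarrow> complex) \<Rightarrow> bool" where
  "HS_family K \<longleftrightarrow> K \<in> borel_measurable (S \<Otimes>\<^sub>M (S \<Otimes>\<^sub>M M)) \<and>
    (\<forall>w\<in>space M. kslice K w \<in> L2 (N w \<Otimes>\<^sub>M N w) \<and> hermitian_kernel (N w) (kslice K w))"

lemma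
  assumes "w \<in> space M"
  shows N_subprob: "subprob_space (N w)"
    and N_sets: "sets (N w) = sets S"
    and N_finite: "finite_measure (N w)"
    and N_L2: "finite_measure_L2 (N w)"
proof -
  show "subprob_space (N w)" "sets (N w) = sets S"
    using measurable_space[OF N_measurable assms] by (auto simp: space_subprob_algebra)
  interpret subprob_space "N w" by fact
  show "finite_measure (N w)"
    by (rule finite_measure_axioms)
  then show "finite_measure_L2 (N w)"
    by (rule finite_measure_L2.intro)
qed

lemma N_pair_measurable: "(\<lambda>w. N w \<Otimes>\<^sub>M N w) \<in> M \<rightarrow>\<^sub>M subprob_algebra (S \<Otimes>\<^sub>M S)"
  by (rule measurable_pair_measure[OF N_measurable N_measurable])

lemma kslice_measurable:
  assumes [measurable]: "X \<in> borel_measurable (S \<Otimes>\<^sub>M (S \<Otimes>\<^sub>M M))" "w \<in> space M"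
  shows "kslice X w \<in> borel_measurable (N w \<Otimes>\<^sub>M N w)"
proof -
  have "kslice X w \<in> borel_measurable (S \<Otimes>\<^sub>M S)"
    unfolding kslice_def by measurable
  moreover have "sets (N w \<Otimes>\<^sub>M N w) = sets (S \<Otimes>\<^sub>M S)"
    by (intro sets_pair_measure_cong N_sets assms)
  ultimately show ?thesis
    using measurable_cong_sets[of "N w \<Otimes>\<^sub>M N w" "S \<Otimes>\<^sub>M S" borel borel] by blast
qed

lemma kop_family_measurable:
  assumes [measurable]: "X \<in> borel_measurable (S \<Otimes>\<^sub>M (S \<Otimes>\<^sub>M M))" "f \<in> borel_measurable (S \<Otimes>\<^sub>M M)"
  shows "(\<lambda>(t, w). kop (N w) (kslice X w) (\<lambda>s. f (s, w)) t) \<in> borel_measurable (S \<Otimes>\<^sub>M M)"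
proof -
  have "(\<lambda>x. integral\<^sup>L (N (snd x)) (\<lambda>s. X (fst x, s, snd x) * f (s, snd x))) \<in> borel_measurable (S \<Otimes>\<^sub>M M)"
    by (rule integral_measurable_kernel[where N=S]) measurable
  then show ?thesis
    by (simp add: kop_def kslice_def split_beta')
qed

lemma kcomp_family_measurable:
  assumes [measurable]: "X \<in> borel_measurable (S \<Otimes>\<^sub>M (S \<Otimes>\<^sub>M M))" "Y \<in> borel_measurable (S \<Otimes>\<^sub>M (S \<Otimes>\<^sub>M M))"
  shows "(\<lambda>(t, s, w). kcomp (N w) (kslice X w) (kslice Y w) (t, s)) \<in> borel_measurable (S \<Otimes>\<^sub>M (S \<Otimes>\<^sub>M M))"
proof -
  have "(\<lambda>x. integral\<^sup>L (N (snd (snd x))) (\<lambda>r. X (fst x, r, snd (snd x)) * Y (r, snd x)))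
      \<in> borel_measurable (S \<Otimes>\<^sub>M (S \<Otimes>\<^sub>M M))"
    by (rule integral_measurable_kernel[where N=S]) measurable
  then show ?thesis
    by (simp add: kcomp_def kop_def kslice_def split_beta')
qed

lemma sq_family_measurable:
  assumes [measurable]: "f \<in> borel_measurable (S \<Otimes>\<^sub>M M)"
  shows "(\<lambda>w. sq (N w) (\<lambda>s. f (s, w))) \<in> borel_measurable M"
  unfolding sq_def by (rule integral_measurable_kernel[where N=S]) measurable

lemma sq_ksec_measurable:
  assumes [measurable]: "X \<in> borel_measurable (S \<Otimes>\<^sub>M (S \<Otimes>\<^sub>M M))"
  shows "(\<lambda>w. sq (N w \<Otimes>\<^sub>M N w) (kslice X w)) \<in> borel_measurable M"
  unfolding sq_def kslice_def
  by (rule integral_measurable_kernel[OF _ N_pair_measurable]) measurable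

lemma kpow_family_measurable:
  assumes K: "K \<in> borel_measurable (S \<Otimes>\<^sub>M (S \<Otimes>\<^sub>M M))"
  shows "(\<lambda>(t, s, w). kpow (N w) (kslice K w) n (t, s)) \<in> borel_measurable (S \<Otimes>\<^sub>M (S \<Otimes>\<^sub>M M))"
proof (induction n)
  case 0
  then show ?case using K by (simp add: kslice_def split_beta')
next
  case (Suc n)
  have "kslice (\<lambda>(t, s, w). kpow (N w) (kslice K w) n (t, s)) w = kpow (N w) (kslice K w) n" for w
    by (simp add: kslice_def)
  then show ?case
    using kcomp_family_measurable[OF K Suc] by simp
qed

lemma HS_familyD:
  assumes "HS_family K" "w \<in> space M"
  shows "hermitian_HS (N w) (kslice K w)"
  using assms N_L2[OF assms(2)] by (auto simp: HS_family_def hermitian_HS_def hermitian_HS_axioms_def)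

lemma limit_projection:
  assumes K: "HS_family K"
  defines "\<And>n w. cw n w \<equiv> sq (N w \<Otimes>\<^sub>M N w) (kpow (N w) (kslice K w) n)"
  defines "\<And>w. rhow w \<equiv> lim (\<lambda>n. cw (Suc n) w / cw n w)"
  shows "cw n \<in> borel_measurable M" "rhow \<in> borel_measurable M"
    and "\<exists>P\<in>borel_measurable (S \<Otimes>\<^sub>M (S \<Otimes>\<^sub>M M)). \<forall>w\<in>space M. cw 1 w \<noteq> 0 \<longrightarrow>
      kslice P w \<in> L2 (N w \<Otimes>\<^sub>M N w) \<and> 0 < sq (N w \<Otimes>\<^sub>M N w) (kslice P w) \<and>
      (\<forall>f\<in>L2 (N w). AE t in N w. kop (N w) (kslice K w) (kop (N w) (kslice K w) (kop (N w) (kslice P w) f)) t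
          = of_real (rhow w) * kop (N w) (kslice P w) f t)"
proof -
  have Km: "K \<in> borel_measurable (S \<Otimes>\<^sub>M (S \<Otimes>\<^sub>M M))"
    using K by (simp add: HS_family_def)
  note kpow_family_measurable[OF Km, measurable]
  have kp: "kslice (\<lambda>(t, s, w). kpow (N w) (kslice K w) n (t, s)) w = kpow (N w) (kslice K w) n" for n w
    by (simp add: kslice_def)
  show cw[measurable]: "cw n \<in> borel_measurable M" for n
    using sq_ksec_measurable[OF kpow_family_measurable[OF Km, of n]] unfolding cw_def kp .
  show rhow[measurable]: "rhow \<in> borel_measurable M"
    unfolding rhow_def by measurable
  \<comment> \<open>Set to 0 where the square of the operator vanishes: there \<open>rhow\<close> is
    meaningless, and the zero sequence satisfies the hypotheses of
    \<open>measurable_L2_limit\<close> trivially. The variables are regrouped so that (t, s) is the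
    point and w the parameter.\<close>
  define Xw where "Xw n = (\<lambda>((t, s), w). if cw 1 w = 0 then 0 else of_real (1 / rhow w ^ n) * kpow (N w) (kslice K w) (2 * n) (t, s))" for n
  have Xw[measurable]: "Xw n \<in> borel_measurable ((S \<Otimes>\<^sub>M S) \<Otimes>\<^sub>M M)" for n
  proof -
    have m: "(\<lambda>((t, s), w). kpow (N w) (kslice K w) (2 * n) (t, s)) \<in> borel_measurable ((S \<Otimes>\<^sub>M S) \<Otimes>\<^sub>M M)"
      using measurable_compose[OF _ kpow_family_measurable[OF Km, of "2 * n"],
          of "\<lambda>((t, s), w). (t, s, w)" "(S \<Otimes>\<^sub>M S) \<Otimes>\<^sub>M M"]
      by (simp add: split_beta')
    note m[unfolded split_beta', measurable]
    show ?thesis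
      unfolding Xw_def split_beta' by measurable
  qed
  have nontriv: "hermitian_HS_nontrivial (N w) (kslice K w)" if "w \<in> space M" "cw 1 w \<noteq> 0" for w
  proof -
    interpret hermitian_HS "N w" "kslice K w"
      using HS_familyD[OF K that(1)] .
    show ?thesis
      using that(2) by unfold_locales (simp add: c_def cw_def)
  qed
  have rho_eq: "rhow w = hermitian_HS_nontrivial.rho (N w) (kslice K w)"
    and Xw_eq: "(\<lambda>z. Xw n (z, w)) = hermitian_HS_nontrivial.X (N w) (kslice K w) n"
    if "w \<in> space M" "cw 1 w \<noteq> 0" for w n
  proof -
    interpret H: hermitian_HS_nontrivial "N w" "kslice K w"
      by (rule nontriv[OF that])
    show "rhow w = H.rho"
      unfolding rhow_def H.rho_def H.r_def[abs_def] H.c_def cw_def ..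
    then show "(\<lambda>z. Xw n (z, w)) = H.X n"
      using that by (auto simp: Xw_def H.X_def)
  qed
  have Xw0: "(\<lambda>z. Xw n (z, w)) = (\<lambda>_. 0)" if "cw 1 w = 0" for n w
    using that by (auto simp: Xw_def)
  have "\<exists>P\<in>borel_measurable ((S \<Otimes>\<^sub>M S) \<Otimes>\<^sub>M M). \<forall>w\<in>space M.
      (\<lambda>z. P (z, w)) \<in> L2 (N w \<Otimes>\<^sub>M N w) \<and>
      (\<lambda>n. sq (N w \<Otimes>\<^sub>M N w) (\<lambda>z. Xw n (z, w) - P (z, w))) \<longlonglongrightarrow> 0"
  proof (rule measurable_L2_limit[OF N_pair_measurable Xw])
    fix n w assume w: "w \<in> space M"
    show "(\<lambda>z. Xw n (z, w)) \<in> L2 (N w \<Otimes>\<^sub>M N w)"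
    proof (cases "cw 1 w = 0")
      case False
      interpret H: hermitian_HS_nontrivial "N w" "kslice K w"
        by (rule nontriv[OF w False])
      show ?thesis
        unfolding Xw_eq[OF w False] by (rule H.X_L2)
    qed (simp add: Xw0 L2_zero)
  next
    fix w and e :: real assume w: "w \<in> space M" and e: "0 < e"
    show "\<exists>k. \<forall>n\<ge>k. \<forall>m\<ge>k. sq (N w \<Otimes>\<^sub>M N w) (\<lambda>z. Xw n (z, w) - Xw m (z, w)) < e"
    proof (cases "cw 1 w = 0")
      case True
      then show ?thesis
        using fun_cong[OF Xw0[OF True]] e by (simp add: sq_zero)
    next
      case False
      interpret H: hermitian_HS_nontrivial "N w" "kslice K w"
        by (rule nontriv[OF w False])
      show ?thesis
        using H.Cauchy_X[OF e] fun_cong[OF Xw_eq[OF w False]] by simp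
    qed
  qed
  then obtain P where P[measurable]: "P \<in> borel_measurable ((S \<Otimes>\<^sub>M S) \<Otimes>\<^sub>M M)"
    and PL2: "\<And>w. w \<in> space M \<Longrightarrow> (\<lambda>z. P (z, w)) \<in> L2 (N w \<Otimes>\<^sub>M N w)"
    and lim: "\<And>w. w \<in> space M \<Longrightarrow> (\<lambda>n. sq (N w \<Otimes>\<^sub>M N w) (\<lambda>z. Xw n (z, w) - P (z, w))) \<longlonglongrightarrow> 0"
    by blast
  let ?P = "\<lambda>(t, s, w). P ((t, s), w)"
  have sP: "kslice ?P w = (\<lambda>z. P (z, w))" for w
    by (auto simp: kslice_def)
  have "?P \<in> borel_measurable (S \<Otimes>\<^sub>M (S \<Otimes>\<^sub>M M))"
    by measurable
  moreover have "kslice ?P w \<in> L2 (N w \<Otimes>\<^sub>M N w) \<and> 0 < sq (N w \<Otimes>\<^sub>M N w) (kslice ?P w) \<and>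
      (\<forall>f\<in>L2 (N w). AE t in N w. kop (N w) (kslice K w) (kop (N w) (kslice K w) (kop (N w) (kslice ?P w) f)) t
          = of_real (rhow w) * kop (N w) (kslice ?P w) f t)" if w: "w \<in> space M" and nz: "cw 1 w \<noteq> 0" for w
  proof -
    interpret H: hermitian_HS_nontrivial "N w" "kslice K w"
      by (rule nontriv[OF w nz])
    have l: "(\<lambda>n. sq (N w \<Otimes>\<^sub>M N w) (\<lambda>z. H.X n z - P (z, w))) \<longlonglongrightarrow> 0"
      using lim[OF w] fun_cong[OF Xw_eq[OF w nz]] by simp
    show ?thesis
      unfolding sP rho_eq[OF w nz] using H.limit_kernel[OF PL2[OF w] l] PL2[OF w] by blast
  qed
  ultimately show "\<exists>P\<in>borel_measurable (S \<Otimes>\<^sub>M (S \<Otimes>\<^sub>M M)). \<forall>w\<in>space M. cw 1 w \<noteq> 0 \<longrightarrow>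
      kslice P w \<in> L2 (N w \<Otimes>\<^sub>M N w) \<and> 0 < sq (N w \<Otimes>\<^sub>M N w) (kslice P w) \<and>
      (\<forall>f\<in>L2 (N w). AE t in N w. kop (N w) (kslice K w) (kop (N w) (kslice K w) (kop (N w) (kslice P w) f)) t
          = of_real (rhow w) * kop (N w) (kslice P w) f t)"
    by blast
qed

text \<open>The last clause says that |l w| dominates the operator norm. In particular
  \<open>l w = 0\<close> encodes the zero operator, for which h is normalised to 0 rather than to a
  unit vector.\<close>

lemma top_eigenvector:
  assumes K: "HS_family K"
  shows "\<exists>l h. l \<in> borel_measurable M \<and> h \<in> borel_measurable (S \<Otimes>\<^sub>M M) \<and>
    (\<forall>w\<in>space M. (\<lambda>s. h (s, w)) \<in> L2 (N w) \<and>
      (if l w = 0 then \<forall>s. h (s, w) = 0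
       else sq (N w) (\<lambda>s. h (s, w)) = 1 \<and>
         (AE t in N w. kop (N w) (kslice K w) (\<lambda>s. h (s, w)) t = of_real (l w) * h (t, w))) \<and>
      (\<forall>f\<in>L2 (N w). sq (N w) (kop (N w) (kslice K w) f) \<le> (l w)\<^sup>2 * sq (N w) f))"
proof -
  define cw where "cw n w = sq (N w \<Otimes>\<^sub>M N w) (kpow (N w) (kslice K w) n)" for n w
  define rhow where "rhow w = lim (\<lambda>n. cw (Suc n) w / cw n w)" for w
  have Km[measurable]: "K \<in> borel_measurable (S \<Otimes>\<^sub>M (S \<Otimes>\<^sub>M M))"
    using K by (simp add: HS_family_def)
  have cw[measurable]: "cw n \<in> borel_measurable M" and rhow[measurable]: "rhow \<in> borel_measurable M" for n
    using limit_projection(1,2)[OF K] unfolding cw_def[abs_def] rhow_def[abs_def] by auto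
  obtain P where P[measurable]: "P \<in> borel_measurable (S \<Otimes>\<^sub>M (S \<Otimes>\<^sub>M M))"
    and PL2: "\<And>w. w \<in> space M \<Longrightarrow> cw 1 w \<noteq> 0 \<Longrightarrow> kslice P w \<in> L2 (N w \<Otimes>\<^sub>M N w)"
    and Ppos: "\<And>w. w \<in> space M \<Longrightarrow> cw 1 w \<noteq> 0 \<Longrightarrow> 0 < sq (N w \<Otimes>\<^sub>M N w) (kslice P w)"
    and Peig: "\<And>w f. w \<in> space M \<Longrightarrow> cw 1 w \<noteq> 0 \<Longrightarrow> f \<in> L2 (N w) \<Longrightarrow>
      AE t in N w. kop (N w) (kslice K w) (kop (N w) (kslice K w) (kop (N w) (kslice P w) f)) t
          = of_real (rhow w) * kop (N w) (kslice P w) f t"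
    using limit_projection(3)[OF K] unfolding cw_def[symmetric] rhow_def[symmetric] by blast
  obtain A :: "nat \<Rightarrow> 's set" where A[measurable]: "\<And>i. A i \<in> sets S"
    and detect: "\<And>w. w \<in> space M \<Longrightarrow> cw 1 w \<noteq> 0 \<Longrightarrow> \<exists>i. 0 < sq (N w) (kop (N w) (kslice P w) (indicator (A i)))"
    using countable_detecting_sets[OF P] PL2 Ppos N_finite N_sets unfolding kslice_def by metis
  \<comment> \<open>Every value of the limit operator lies in the eigenspace of the square of T for
    rho, so each of these countably many functions is a candidate.\<close>
  define vi where "vi i = (\<lambda>(t, w). kop (N w) (kslice P w) (indicator (A i)) t)" for i
  have vi[measurable]: "vi i \<in> borel_measurable (S \<Otimes>\<^sub>M M)" for i
    using kop_family_measurable[OF P, of "\<lambda>(s, w). indicator (A i) s"] unfolding vi_def by simp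
  have [measurable]: "(\<lambda>w. sq (N w) (\<lambda>s. vi i (s, w))) \<in> borel_measurable M" for i
    by (rule sq_family_measurable) measurable
  \<comment> \<open>The first nonzero candidate. Where all vanish the index is arbitrary; this can
    happen only where \<open>cw 1 w = 0\<close>, and there h is 0 anyway.\<close>
  define ind where "ind w = (LEAST i. 0 < sq (N w) (\<lambda>s. vi i (s, w)))" for w
  have ind[measurable]: "ind \<in> M \<rightarrow>\<^sub>M count_space UNIV"
    unfolding ind_def by measurable
  define v where "v x = vi (ind (snd x)) x" for x
  have v[measurable]: "v \<in> borel_measurable (S \<Otimes>\<^sub>M M)"
    unfolding v_def[abs_def] by (rule measurable_compose_countable[OF vi]) measurable
  define u where "u = (\<lambda>(t, w). kop (N w) (kslice K w) (\<lambda>s. v (s, w)) t + of_real (sqrt (rhow w)) * v (t, w))"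
  have u[measurable]: "u \<in> borel_measurable (S \<Otimes>\<^sub>M M)"
    using kop_family_measurable[OF Km v] unfolding u_def split_beta' by measurable
  note sqv[measurable] = sq_family_measurable[OF v] and squ[measurable] = sq_family_measurable[OF u]
  \<comment> \<open>By \<open>eigenvector\<close>, u is an eigenvector for + sqrt rho unless it is
    null; if it is null, v is one for - sqrt rho. The case distinction is measurable in w.\<close>
  define l where "l w = (if cw 1 w = 0 then 0 else if sq (N w) (\<lambda>s. u (s, w)) = 0 then - sqrt (rhow w) else sqrt (rhow w))" for w
  define h where "h = (\<lambda>(s, w). if cw 1 w = 0 then 0 else if sq (N w) (\<lambda>s. u (s, w)) = 0
    then of_real (1 / sqrt (sq (N w) (\<lambda>s. v (s, w)))) * v (s, w)
    else of_real (1 / sqrt (sq (N w) (\<lambda>s. u (s, w)))) * u (s, w))"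
  have "l \<in> borel_measurable M"
    unfolding l_def[abs_def] by measurable
  moreover have "h \<in> borel_measurable (S \<Otimes>\<^sub>M M)"
    unfolding h_def split_beta' by measurable
  moreover have "(\<lambda>s. h (s, w)) \<in> L2 (N w) \<and>
      (if l w = 0 then \<forall>s. h (s, w) = 0
       else sq (N w) (\<lambda>s. h (s, w)) = 1 \<and>
         (AE t in N w. kop (N w) (kslice K w) (\<lambda>s. h (s, w)) t = of_real (l w) * h (t, w))) \<and>
      (\<forall>f\<in>L2 (N w). sq (N w) (kop (N w) (kslice K w) f) \<le> (l w)\<^sup>2 * sq (N w) f)"
    if w: "w \<in> space M" for w
  proof (cases "cw 1 w = 0")
    case True
    interpret hermitian_HS "N w" "kslice K w"
      using HS_familyD[OF K w] .
    have "c 1 = 0"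
      using True by (simp add: c_def cw_def)
    then show ?thesis
      using True T_eq_0 by (simp add: l_def h_def L2_zero)
  next
    case False
    interpret hermitian_HS "N w" "kslice K w"
      using HS_familyD[OF K w] .
    interpret hermitian_HS_nontrivial "N w" "kslice K w"
      using False by unfold_locales (simp add: c_def cw_def)
    have rho: "rhow w = rho"
      unfolding rhow_def rho_def r_def[abs_def] c_def cw_def ..
    define f where "f = (indicator (A (ind w)) :: 's \<Rightarrow> complex)"
    have fL2: "f \<in> L2 (N w)"
      unfolding f_def using A N_sets[OF w]
      by (intro L2_bounded[where B=1] finite_measure_axioms borel_measurable_indicator) (auto simp: indicator_def)
    have v_eq: "(\<lambda>s. v (s, w)) = kop (N w) (kslice P w) f"
      by (auto simp: v_def vi_def f_def)
    have vL2: "(\<lambda>s. v (s, w)) \<in> L2 (N w)"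
      unfolding v_eq by (intro kop_L2 PL2 w False fL2)
    have vpos: "0 < sq (N w) (\<lambda>s. v (s, w))"
    proof -
      obtain i where "0 < sq (N w) (\<lambda>s. vi i (s, w))"
        using detect[OF w False] by (auto simp: vi_def)
      then have "0 < sq (N w) (\<lambda>s. vi (ind w) (s, w))"
        unfolding ind_def by (rule LeastI)
      then show ?thesis
        by (simp add: v_def)
    qed
    have eig: "AE t in N w. T (T (\<lambda>s. v (s, w))) t = rho * v (t, w)"
      using Peig[OF w False fL2] fun_cong[OF v_eq] unfolding v_eq rho by simp
    have u_eq: "(\<lambda>s. u (s, w)) = (\<lambda>t. T (\<lambda>s. v (s, w)) t + of_real (sqrt rho) * v (t, w))"
      by (simp add: u_def rho)
    note ue = eigenvector[OF vL2 eig, folded u_eq]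
    have l2: "(l w)\<^sup>2 = rho" and lnz: "l w \<noteq> 0"
      using False rho_pos by (auto simp: l_def rho)
    have norm1: "sq (N w) (\<lambda>s. of_real (1 / sqrt (sq (N w) g)) * g s) = 1" if "0 < sq (N w) g" for g
      using that by (simp only: sq_scale norm_of_real) (simp add: power_divide)
    have eigscale: "AE t in N w. T (\<lambda>s. of_real a * g s) t = of_real b * (of_real a * g t)"
      if "AE t in N w. T g t = of_real b * g t" for g :: "'s \<Rightarrow> complex" and a b :: real
      using that by eventually_elim (simp add: kop_scale)
    have "(\<lambda>s. h (s, w)) \<in> L2 (N w) \<and> sq (N w) (\<lambda>s. h (s, w)) = 1 \<and>
         (AE t in N w. T (\<lambda>s. h (s, w)) t = of_real (l w) * h (t, w))"
    proof (cases "sq (N w) (\<lambda>s. u (s, w)) = 0")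
      case True
      have h_eq: "h (s, w) = of_real (1 / sqrt (sq (N w) (\<lambda>s. v (s, w)))) * v (s, w)" for s
        using False True by (simp add: h_def)
      have "AE t in N w. T (\<lambda>s. v (s, w)) t = of_real (l w) * v (t, w)"
        using ue(3)[OF True] True False by (simp add: l_def rho)
      from eigscale[OF this] show ?thesis
        unfolding h_eq using norm1[OF vpos] by (intro conjI L2_scale vL2)
    next
      case nz: False
      then have upos: "0 < sq (N w) (\<lambda>s. u (s, w))"
        using sq_nonneg[of "N w" "\<lambda>s. u (s, w)"] by simp
      have h_eq: "h (s, w) = of_real (1 / sqrt (sq (N w) (\<lambda>s. u (s, w)))) * u (s, w)" for s
        using False nz by (simp add: h_def)
      have "AE t in N w. T (\<lambda>s. u (s, w)) t = of_real (l w) * u (t, w)"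
        using ue(2) nz False by (simp add: l_def rho u_eq fun_cong[OF u_eq])
      from eigscale[OF this] show ?thesis
        unfolding h_eq using norm1[OF upos] ue(1) by (intro conjI L2_scale)
    qed
    then show ?thesis
      using lnz sq_T_le l2 by auto
  qed
  ultimately show ?thesis
    by blast
qed

end

section \<open>Deflation\<close>

text \<open>Setting eigenvectors to 0 beyond the rank lets finite and infinite rank share one
  infinite sequence. The remainder estimate is the operator norm bound for the n-fold deflated
  operator, and the comparison with the Hilbert-Schmidt norm later bounds the eigenvalues uniformly
  in w.\<close>

definition eigensystem ::
  "'a measure \<Rightarrow> ('a \<times> 'a \<Rightarrow> complex) \<Rightarrow> (nat \<Rightarrow> real) \<Rightarrow> (nat \<Rightarrow> 'a \<Rightarrow> complex) \<Rightarrow> bool" where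
  "eigensystem N K l h \<longleftrightarrow>
    (\<forall>n. h n \<in> L2 N) \<and>
    (\<forall>n. l n = 0 \<longrightarrow> (\<forall>s. h n s = 0)) \<and>
    (\<forall>n. l n \<noteq> 0 \<longrightarrow> sq N (h n) = 1) \<and>
    (\<forall>i j. i \<noteq> j \<longrightarrow> ip N (h i) (h j) = 0) \<and>
    (\<forall>n. \<bar>l (Suc n)\<bar> \<le> \<bar>l n\<bar>) \<and>
    (\<forall>n. (l n)\<^sup>2 \<le> sq (N \<Otimes>\<^sub>M N) K) \<and>
    l \<longlonglongrightarrow> 0 \<and>
    (\<forall>f\<in>L2 N. \<forall>n. sq N (\<lambda>t. kop N K f t - (\<Sum>i<n. of_real (l i) * ip N f (h i) * h i t)) \<le> (l n)\<^sup>2 * sq N f)"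

context finite_measure_L2
begin

text \<open>At a fixed parameter: \<open>K n\<close> is the kernel left after n subtractions, and (l
  n, h n) is a top eigenpair of it.\<close>

context
  fixes K :: "nat \<Rightarrow> 'a \<times> 'a \<Rightarrow> complex" and l :: "nat \<Rightarrow> real" and h :: "nat \<Rightarrow> 'a \<Rightarrow> complex"
  assumes HS: "\<And>n. hermitian_HS N (K n)"
    and hL2: "\<And>n. h n \<in> L2 N"
    and zero: "\<And>n s. l n = 0 \<Longrightarrow> h n s = 0"
    and one: "\<And>n. l n \<noteq> 0 \<Longrightarrow> sq N (h n) = 1"
    and eig: "\<And>n. l n \<noteq> 0 \<Longrightarrow> AE t in N. kop N (K n) (h n) t = of_real (l n) * h n t"
    and bound: "\<And>n f. f \<in> L2 N \<Longrightarrow> sq N (kop N (K n) f) \<le> (l n)\<^sup>2 * sq N f"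
    and step: "\<And>n. K (Suc n) = (\<lambda>(t, s). K n (t, s) - of_real (l n) * (h n t * cnj (h n s)))"
begin

lemma deflation_kernel_L2: "K n \<in> L2 (N \<Otimes>\<^sub>M N)"
  using hermitian_HS.K_L2[OF HS] .

lemma kop_K_L2: "f \<in> L2 N \<Longrightarrow> kop N (K n) f \<in> L2 N"
  using hermitian_HS.T_L2[OF HS] .

lemma tensor_h_L2: "(\<lambda>(t, s). h n t * cnj (h n s)) \<in> L2 (N \<Otimes>\<^sub>M N)"
  by (intro tensor_L2 L2_cnj hL2)

lemma deflation_step: "K (Suc n) = (\<lambda>z. K n z - of_real (l n) * (\<lambda>(t, s). h n t * cnj (h n s)) z)"
  unfolding step by auto

lemma kop_tensor: "kop N (\<lambda>(t, s). h n t * cnj (h n s)) f t = h n t * ip N f (h n)"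
  unfolding kop_def ip_def by (simp add: mult.assoc mult.commute[of "cnj _"])

lemma kop_step:
  assumes f: "f \<in> L2 N"
  shows "AE t in N. kop N (K (Suc n)) f t = kop N (K n) f t - of_real (l n) * ip N f (h n) * h n t"
  using kop_diff_kernel[OF deflation_kernel_L2[of n] L2_scale[OF tensor_h_L2[of n], of "of_real (l n)"] f]
  unfolding deflation_step[symmetric]
  by eventually_elim (simp add: kop_scale_kernel kop_tensor mult_ac)

lemma deflation_eigenvector: "AE t in N. kop N (K n) (h n) t = of_real (l n) * h n t"
proof (cases "l n = 0")
  case True
  then show ?thesis
    using zero[OF True] by (simp add: kop_def)
qed (rule eig)

text \<open>The factor \<open>l n\<close> makes this hold in the degenerate case
  \<open>h n = 0\<close> as well, so that later steps need no case distinction.\<close>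

lemma ip_h_self: "of_real (l n) * ip N (h n) (h n) = of_real (l n)"
  using one[of n] by (cases "l n = 0") (auto simp: ip_self hL2)

lemma deflation_expand:
  assumes f: "f \<in> L2 N"
  shows "AE t in N. kop N (K 0) f t - (\<Sum>i<n. of_real (l i) * ip N f (h i) * h i t) = kop N (K n) f t"
proof (induction n)
  case (Suc n)
  then show ?case
    using kop_step[OF f, of n] by eventually_elim (simp add: algebra_simps)
qed simp

lemma deflation_bound:
  assumes f: "f \<in> L2 N"
  shows "sq N (\<lambda>t. kop N (K 0) f t - (\<Sum>i<n. of_real (l i) * ip N f (h i) * h i t)) \<le> (l n)\<^sup>2 * sq N f"
proof -
  have "sq N (\<lambda>t. kop N (K 0) f t - (\<Sum>i<n. of_real (l i) * ip N f (h i) * h i t)) = sq N (kop N (K n) f)"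
    by (intro sq_cong_AE deflation_expand f L2_measurable[OF L2_diff] L2_measurable[OF kop_K_L2] kop_K_L2 L2_sum L2_scale hL2)
  also have "\<dots> \<le> (l n)\<^sup>2 * sq N f"
    by (rule bound[OF f])
  finally show ?thesis .
qed

text \<open>Eigenvectors for a nonzero eigenvalue of a symmetric operator are orthogonal to its null
  space.\<close>

lemma orth_of_kernel:
  assumes "AE t in N. kop N (K n) (h i) t = 0"
  shows "ip N (h n) (h i) = 0"
proof (cases "l n = 0")
  case True
  then show ?thesis
    using zero[OF True] by (simp add: ip_def)
next
  case False
  have "of_real (l n) * ip N (h n) (h i) = ip N (kop N (K n) (h n)) (h i)"
    unfolding ip_scale_left[symmetric] using deflation_eigenvector[of n]
    by (intro ip_cong_AE L2_measurable[OF L2_scale] L2_measurable[OF kop_K_L2] L2_measurable[OF hL2] hL2) (auto elim: eventually_mono)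
  also have "\<dots> = ip N (h n) (kop N (K n) (h i))"
    by (rule hermitian_HS.T_sym[OF HS hL2 hL2])
  also have "\<dots> = ip N (h n) (\<lambda>_. 0)"
    using assms by (intro ip_cong_AE L2_measurable[OF kop_K_L2] L2_measurable[OF hL2] hL2) auto
  also have "\<dots> = 0"
    by (simp add: ip_def)
  finally show ?thesis
    using False by simp
qed

text \<open>Subtracting the eigenpair annihilates h n. An earlier h i stays annihilated since, by
  \<open>orth_of_kernel\<close>, it is orthogonal to h n, so the subtracted term does not see
  it.\<close>

lemma kernel_of_deflated: "i < n \<Longrightarrow> AE t in N. kop N (K n) (h i) t = 0"
proof (induction n)
  case (Suc n)
  show ?case
  proof (cases "i = n")
    case True
    then show ?thesis
      using kop_step[of "h n" n, OF hL2] deflation_eigenvector[of n]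
      by (auto elim!: eventually_elim2 simp: ip_h_self)
  next
    case False
    then have *: "AE t in N. kop N (K n) (h i) t = 0"
      using Suc by simp
    have ip0: "ip N (h i) (h n) = 0"
      using orth_of_kernel[OF *] ip_cnj[of N "h n" "h i"] by simp
    show ?thesis
      using kop_step[of "h i" n, OF hL2] * by eventually_elim (simp add: ip0)
  qed
qed simp

lemma deflation_orth: "i \<noteq> j \<Longrightarrow> ip N (h i) (h j) = 0"
proof (induction i j rule: linorder_wlog)
  case (le i j)
  then show ?case
    using orth_of_kernel[OF kernel_of_deflated[of i j]] ip_cnj[of N "h j" "h i"] by simp
next
  case (sym i j)
  then show ?case
    using ip_cnj[of N "h i" "h j"] by simp
qed

text \<open>By orthogonality to h n, the operators of \<open>K (Suc n)\<close> and
  \<open>K n\<close> agree on h (n+1), and the norm of the latter operator is at most |l n|.\<close>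

lemma deflation_decreasing: "\<bar>l (Suc n)\<bar> \<le> \<bar>l n\<bar>"
proof (cases "l (Suc n) = 0")
  case False
  have "(l (Suc n))\<^sup>2 = sq N (\<lambda>t. of_real (l (Suc n)) * h (Suc n) t)"
    using one[OF False] by (simp add: sq_scale)
  also have "\<dots> = sq N (kop N (K (Suc n)) (h (Suc n)))"
    using deflation_eigenvector[of "Suc n"]
    by (intro sq_cong_AE L2_measurable[OF L2_scale] L2_measurable[OF kop_K_L2] hL2) (auto elim: eventually_mono)
  also have "\<dots> = sq N (kop N (K n) (h (Suc n)))"
    using kop_step[of "h (Suc n)" n, OF hL2] deflation_orth[of "Suc n" n]
    by (intro sq_cong_AE L2_measurable[OF kop_K_L2] hL2) (auto elim: eventually_mono)
  also have "\<dots> \<le> (l n)\<^sup>2"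
    using bound[of "h (Suc n)" n, OF hL2] one[OF False] by simp
  finally show ?thesis
    by (rule abs_le_square_iff[THEN iffD2])
qed simp

text \<open>Pythagoras: for \<open>l n \<noteq> 0\<close> the subtracted rank-one kernel has squared
  norm \<open>(l n)\<^sup>2\<close>, which is also its inner product with \<open>K n\<close>.
  Summation bounds the series of \<open>(l n)\<^sup>2\<close> by the norm of the original kernel,
  hence \<open>l\<close> tends to 0.\<close>

lemma sq_deflate: "sq (N \<Otimes>\<^sub>M N) (K (Suc n)) = sq (N \<Otimes>\<^sub>M N) (K n) - (l n)\<^sup>2"
proof (cases "l n = 0")
  case True
  then show ?thesis
    unfolding deflation_step by simp
next
  case False
  have "ip (N \<Otimes>\<^sub>M N) (K n) (\<lambda>z. of_real (l n) * (\<lambda>(t, s). h n t * cnj (h n s)) z) =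
      of_real (l n) * ip N (kop N (K n) (h n)) (h n)"
    unfolding ip_scale_right ip_kop[OF deflation_kernel_L2 hL2 hL2] by simp
  also have "ip N (kop N (K n) (h n)) (h n) = ip N (\<lambda>t. of_real (l n) * h n t) (h n)"
    using deflation_eigenvector[of n]
    by (intro ip_cong_AE L2_measurable[OF L2_scale] L2_measurable[OF kop_K_L2] L2_measurable[OF hL2] hL2) auto
  also have "\<dots> = of_real (l n)"
    unfolding ip_scale_left by (rule ip_h_self)
  finally have "Re (ip (N \<Otimes>\<^sub>M N) (K n) (\<lambda>z. of_real (l n) * (\<lambda>(t, s). h n t * cnj (h n s)) z)) = (l n)\<^sup>2"
    by (simp add: power2_eq_square)
  moreover have "sq (N \<Otimes>\<^sub>M N) (\<lambda>z. of_real (l n) * (\<lambda>(t, s). h n t * cnj (h n s)) z) = (l n)\<^sup>2"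
    unfolding sq_scale tensor_L2(2)[OF hL2 L2_cnj[OF hL2]] sq_cnj one[OF False] by simp
  ultimately show ?thesis
    unfolding deflation_step sq_diff[OF deflation_kernel_L2 L2_scale[OF tensor_h_L2]] by simp
qed

lemma sum_deflation: "(\<Sum>i<n. (l i)\<^sup>2) = sq (N \<Otimes>\<^sub>M N) (K 0) - sq (N \<Otimes>\<^sub>M N) (K n)"
  by (induction n) (auto simp: sq_deflate)

lemma deflation_le: "(l n)\<^sup>2 \<le> sq (N \<Otimes>\<^sub>M N) (K 0)"
proof -
  have "(l n)\<^sup>2 \<le> (\<Sum>i<Suc n. (l i)\<^sup>2)"
    by (simp add: sum_nonneg)
  then show ?thesis
    using sum_deflation[of "Suc n"] sq_nonneg[of "N \<Otimes>\<^sub>M N" "K (Suc n)"] by simp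
qed

lemma deflation_tendsto_0: "l \<longlonglongrightarrow> 0"
proof -
  have "summable (\<lambda>i. (l i)\<^sup>2)"
    using sum_deflation sq_nonneg by (intro bounded_imp_summable[of _ "sq (N \<Otimes>\<^sub>M N) (K 0)"])
      (auto simp: lessThan_Suc_atMost[symmetric] simp del: sum.lessThan_Suc)
  then have "(\<lambda>i. (l i)\<^sup>2) \<longlonglongrightarrow> 0"
    by (rule summable_LIMSEQ_zero)
  then have "(\<lambda>i. sqrt ((l i)\<^sup>2)) \<longlonglongrightarrow> sqrt 0"
    by (rule tendsto_real_sqrt)
  then show ?thesis
    by (simp add: tendsto_rabs_zero_iff)
qed

end

end

context kernel_family
begin

definition deflate where
  "deflate K l h = (\<lambda>(t, s, w). K (t, s, w) - of_real (l w) * (h (t, w) * cnj (h (s, w))) :: complex)"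

lemma kslice_deflate: "kslice (deflate K l h) w = (\<lambda>(t, s). kslice K w (t, s) - of_real (l w) * (h (t, w) * cnj (h (s, w))))"
  by (auto simp: kslice_def deflate_def)

lemma HS_family_deflate:
  assumes K: "HS_family K" and [measurable]: "l \<in> borel_measurable M" "h \<in> borel_measurable (S \<Otimes>\<^sub>M M)"
    and hL2: "\<And>w. w \<in> space M \<Longrightarrow> (\<lambda>s. h (s, w)) \<in> L2 (N w)"
  shows "HS_family (deflate K l h)"
  unfolding HS_family_def
proof (intro conjI ballI)
  have [measurable]: "K \<in> borel_measurable (S \<Otimes>\<^sub>M (S \<Otimes>\<^sub>M M))"
    using K by (simp add: HS_family_def)
  show "deflate K l h \<in> borel_measurable (S \<Otimes>\<^sub>M (S \<Otimes>\<^sub>M M))"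
    unfolding deflate_def by measurable
  fix w assume w: "w \<in> space M"
  interpret finite_measure_L2 "N w"
    by (rule N_L2[OF w])
  have "kslice (deflate K l h) w = (\<lambda>z. kslice K w z - of_real (l w) * (\<lambda>(t, s). h (t, w) * cnj (h (s, w))) z)"
    by (auto simp: kslice_deflate)
  also have "\<dots> \<in> L2 (N w \<Otimes>\<^sub>M N w)"
    using K w by (intro L2_diff L2_scale tensor_L2 L2_cnj hL2) (auto simp: HS_family_def)
  finally show "kslice (deflate K l h) w \<in> L2 (N w \<Otimes>\<^sub>M N w)" .
  have "hermitian_kernel (N w) (kslice K w)"
    using K w by (auto simp: HS_family_def)
  then show "hermitian_kernel (N w) (kslice (deflate K l h) w)"
    unfolding hermitian_kernel_def
  proof (intro ballI)
    fix t s assume "\<forall>t\<in>space (N w). \<forall>s\<in>space (N w). kslice K w (t, s) = cnj (kslice K w (s, t))"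
      and ts: "t \<in> space (N w)" "s \<in> space (N w)"
    then have "cnj (kslice K w (s, t)) = kslice K w (t, s)"
      by metis
    then show "kslice (deflate K l h) w (t, s) = cnj (kslice (deflate K l h) w (s, t))"
      by (simp add: kslice_deflate mult.commute)
  qed
qed

text \<open>The recursion runs on whole families, not on the operators at single parameters;
  otherwise the choices at different w would not fit together measurably.\<close>

theorem spectral_decomposition_family:
  assumes K: "HS_family K"
  shows "\<exists>(l :: nat \<Rightarrow> 'w \<Rightarrow> real) h. (\<forall>n. l n \<in> borel_measurable M) \<and> (\<forall>n. h n \<in> borel_measurable (S \<Otimes>\<^sub>M M)) \<and>
    (\<forall>w\<in>space M. eigensystem (N w) (kslice K w) (\<lambda>n. l n w) (\<lambda>n s. h n (s, w)))"
proof -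
  define top where "top X l h \<longleftrightarrow> l \<in> borel_measurable M \<and> h \<in> borel_measurable (S \<Otimes>\<^sub>M M) \<and>
    (\<forall>w\<in>space M. (\<lambda>s. h (s, w)) \<in> L2 (N w) \<and>
      (if l w = 0 then \<forall>s. h (s, w) = 0
       else sq (N w) (\<lambda>s. h (s, w)) = 1 \<and>
         (AE t in N w. kop (N w) (kslice X w) (\<lambda>s. h (s, w)) t = of_real (l w) * h (t, w))) \<and>
      (\<forall>f\<in>L2 (N w). sq (N w) (kop (N w) (kslice X w) f) \<le> (l w)\<^sup>2 * sq (N w) f))" for X l h
  \<comment> \<open>With the hypothesis under the quantifiers, choice yields total functions
    \<open>L\<close> and \<open>H\<close> on all kernels, over which \<open>rec_nat\<close> can
    iterate.\<close>
  have "\<forall>X. \<exists>l h. HS_family X \<longrightarrow> top X l h"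
    using top_eigenvector unfolding top_def by blast
  then obtain L H where LH: "\<And>X. HS_family X \<Longrightarrow> top X (L X) (H X)"
    by metis
  define Ks where "Ks = rec_nat K (\<lambda>_ X. deflate X (L X) (H X))"
  have Ks: "Ks 0 = K" "Ks (Suc n) = deflate (Ks n) (L (Ks n)) (H (Ks n))" for n
    by (auto simp: Ks_def)
  have HS: "HS_family (Ks n)" for n
  proof (induction n)
    case (Suc n)
    then show ?case
      using LH[OF Suc] unfolding Ks top_def by (intro HS_family_deflate) auto
  qed (simp add: Ks K)
  define l where "l n = L (Ks n)" for n
  define h where "h n = H (Ks n)" for n
  have top: "top (Ks n) (l n) (h n)" for n
    using LH[OF HS] by (simp add: l_def h_def)
  have main: "eigensystem (N w) (kslice K w) (\<lambda>n. l n w) (\<lambda>n s. h n (s, w))"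
    if w: "w \<in> space M" for w
  proof -
    interpret finite_measure_L2 "N w"
      by (rule N_L2[OF w])
    have 1: "hermitian_HS (N w) (kslice (Ks n) w)" for n
      by (rule HS_familyD[OF HS w])
    have 2: "(\<lambda>s. h n (s, w)) \<in> L2 (N w)" for n
      using top[of n] w by (simp add: top_def)
    have 3: "h n (s, w) = 0" if "l n w = 0" for n s
      using top[of n] w that by (simp add: top_def)
    have 4: "sq (N w) (\<lambda>s. h n (s, w)) = 1" if "l n w \<noteq> 0" for n
      using top[of n] w that by (simp add: top_def)
    have 5: "AE t in N w. kop (N w) (kslice (Ks n) w) (\<lambda>s. h n (s, w)) t = of_real (l n w) * h n (t, w)" if "l n w \<noteq> 0" for n
      using top[of n] w that by (simp add: top_def)
    have 6: "sq (N w) (kop (N w) (kslice (Ks n) w) f) \<le> (l n w)\<^sup>2 * sq (N w) f" if "f \<in> L2 (N w)" for n f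
      using top[of n] w that by (simp add: top_def)
    have 7: "kslice (Ks (Suc n)) w = (\<lambda>(t, s). kslice (Ks n) w (t, s) - of_real (l n w) * (h n (t, w) * cnj (h n (s, w))))" for n
      by (simp only: Ks kslice_deflate l_def h_def)
    note a = 1 2 3 4 5 6 7
    note d = deflation_orth[where K="\<lambda>n. kslice (Ks n) w" and l="\<lambda>n. l n w" and h="\<lambda>n s. h n (s, w)", OF a]
      deflation_decreasing[where K="\<lambda>n. kslice (Ks n) w" and l="\<lambda>n. l n w" and h="\<lambda>n s. h n (s, w)", OF a]
      deflation_le[where K="\<lambda>n. kslice (Ks n) w" and l="\<lambda>n. l n w" and h="\<lambda>n s. h n (s, w)", OF a]
      deflation_tendsto_0[where K="\<lambda>n. kslice (Ks n) w" and l="\<lambda>n. l n w" and h="\<lambda>n s. h n (s, w)", OF a]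
      deflation_bound[where K="\<lambda>n. kslice (Ks n) w" and l="\<lambda>n. l n w" and h="\<lambda>n s. h n (s, w)", OF a]
    show ?thesis
      unfolding eigensystem_def using 2 3 4 d by (simp add: Ks(1))
  qed
  moreover have "l n \<in> borel_measurable M" "h n \<in> borel_measurable (S \<Otimes>\<^sub>M M)" for n
    using top[of n] by (auto simp: top_def)
  ultimately show ?thesis
    by blast
qed

end

section \<open>The kernel of finite measures attached to \<open>k\<close>\<close>

lemma L2inf_inner_ip: "L2inf_inner S f g w = ip S (\<lambda>s. f (s, w)) (\<lambda>s. g (s, w))"
  by (simp add: L2inf_inner_def ip_def)

lemma L2inf_measurable: "f \<in> L2inf S M \<Longrightarrow> f \<in> borel_measurable (S \<Otimes>\<^sub>M M)"
  by (simp add: L2inf_def)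

lemma L2inf_slices:
  assumes f: "f \<in> L2inf S M"
  shows "\<exists>C\<ge>0. AE w in M. (\<lambda>s. f (s, w)) \<in> L2 S \<and> sq S (\<lambda>s. f (s, w)) \<le> C"
proof -
  note L2inf_measurable[OF f, measurable]
  obtain C :: real where "AE w in M. (\<integral>\<^sup>+s. ennreal ((cmod (f (s, w)))\<^sup>2) \<partial>S) \<le> ennreal C"
    using f by (auto simp: L2inf_def nn_Linf_def)
  then have "AE w in M. (\<lambda>s. f (s, w)) \<in> L2 S \<and> sq S (\<lambda>s. f (s, w)) \<le> max 0 C"
    using AE_space
  proof eventually_elim
    case (elim w)
    then have m: "(\<lambda>s. f (s, w)) \<in> borel_measurable S"
      by measurable
    have "(\<integral>\<^sup>+s. ennreal ((cmod (f (s, w)))\<^sup>2) \<partial>S) \<le> ennreal (max 0 C)"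
      using elim(1) by (simp add: ennreal_max_0)
    from L2I_nn[OF m this] show ?case
      by simp
  qed
  then show ?thesis
    by (intro exI[of _ "max 0 C"]) auto
qed

text \<open>Since \<open>S\<close> need not be \<sigma>-finite, measurability of the squared norm in
  w does not follow from that of f and has to be supplied.\<close>

lemma L2infI:
  assumes f: "f \<in> borel_measurable (S \<Otimes>\<^sub>M M)" and L2: "\<And>w. w \<in> space M \<Longrightarrow> (\<lambda>s. f (s, w)) \<in> L2 S"
    and m: "(\<lambda>w. sq S (\<lambda>s. f (s, w))) \<in> borel_measurable M"
    and C: "AE w in M. sq S (\<lambda>s. f (s, w)) \<le> C"
  shows "f \<in> L2inf S M"
proof -
  have eq: "(\<integral>\<^sup>+s. ennreal ((cmod (f (s, w)))\<^sup>2) \<partial>S) = ennreal (sq S (\<lambda>s. f (s, w)))" if "w \<in> space M" for w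
    by (rule nn_sq[OF L2[OF that]])
  have "(\<lambda>w. \<integral>\<^sup>+s. ennreal ((cmod (f (s, w)))\<^sup>2) \<partial>S) \<in> borel_measurable M"
    using m by (subst measurable_cong[OF eq]) auto
  moreover have "AE w in M. (\<integral>\<^sup>+s. ennreal ((cmod (f (s, w)))\<^sup>2) \<partial>S) \<le> ennreal C"
    using C AE_space by eventually_elim (simp add: eq ennreal_leI)
  ultimately show ?thesis
    using f by (auto simp: L2inf_def nn_Linf_def)
qed

lemma L2inf_scale_mem:
  assumes f: "f \<in> L2inf S M" and a: "a \<in> Linf M"
  shows "L2inf_scale a f \<in> L2inf S M"
proof -
  note L2inf_measurable[OF f, measurable]
  have am[measurable]: "a \<in> borel_measurable M"
    using a by (simp add: Linf_def)
  obtain A :: real where A: "AE w in M. cmod (a w) \<le> A"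
    using a by (auto simp: Linf_def)
  have Fm[measurable]: "(\<lambda>w. \<integral>\<^sup>+s. ennreal ((cmod (f (s, w)))\<^sup>2) \<partial>S) \<in> borel_measurable M"
    using f by (simp add: L2inf_def nn_Linf_def)
  obtain C :: real where C: "AE w in M. (\<integral>\<^sup>+s. ennreal ((cmod (f (s, w)))\<^sup>2) \<partial>S) \<le> ennreal C"
    using f by (auto simp: L2inf_def nn_Linf_def)
  have eq: "(\<integral>\<^sup>+s. ennreal ((cmod (L2inf_scale a f (s, w)))\<^sup>2) \<partial>S) =
      ennreal ((cmod (a w))\<^sup>2) * (\<integral>\<^sup>+s. ennreal ((cmod (f (s, w)))\<^sup>2) \<partial>S)" if w: "w \<in> space M" for w
  proof -
    have "(\<lambda>s. ennreal ((cmod (f (s, w)))\<^sup>2)) \<in> borel_measurable S"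
      using w by measurable
    then show ?thesis
      by (simp add: L2inf_scale_def norm_mult power_mult_distrib ennreal_mult nn_integral_cmult)
  qed
  have "(\<lambda>w. \<integral>\<^sup>+s. ennreal ((cmod (L2inf_scale a f (s, w)))\<^sup>2) \<partial>S) \<in> borel_measurable M"
    by (subst measurable_cong[OF eq]) auto
  moreover have "AE w in M. (\<integral>\<^sup>+s. ennreal ((cmod (L2inf_scale a f (s, w)))\<^sup>2) \<partial>S) \<le> ennreal (A\<^sup>2 * max 0 C)"
    using A C AE_space
  proof eventually_elim
    case (elim w)
    have "(\<integral>\<^sup>+s. ennreal ((cmod (L2inf_scale a f (s, w)))\<^sup>2) \<partial>S) \<le> ennreal (A\<^sup>2) * ennreal (max 0 C)"
      unfolding eq[OF elim(3)] using elim
      by (intro mult_mono ennreal_leI power_mono) (auto simp: ennreal_max_0)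
    then show ?case
      by (simp add: ennreal_mult)
  qed
  moreover have "L2inf_scale a f \<in> borel_measurable (S \<Otimes>\<^sub>M M)"
    unfolding L2inf_scale_def by measurable
  ultimately show ?thesis
    unfolding L2inf_def nn_Linf_def by blast
qed

lemma Linf_indicator: "A \<in> sets M \<Longrightarrow> (indicator A :: 'w \<Rightarrow> complex) \<in> Linf M"
  unfolding Linf_def by (intro CollectI conjI exI[of _ 1]) (auto simp: indicator_def)

lemma Linf_mult:
  fixes a b :: "'w \<Rightarrow> complex"
  assumes "a \<in> Linf M" "b \<in> Linf M"
  shows "(\<lambda>w. a w * b w) \<in> Linf M"
proof -
  obtain A B :: real where AB: "AE w in M. cmod (a w) \<le> A" "AE w in M. cmod (b w) \<le> B"
    using assms by (auto simp: Linf_def)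
  from AB have "AE w in M. cmod (a w * b w) \<le> A * B"
  proof eventually_elim
    case (elim w)
    have "0 \<le> A"
      using elim(1) norm_ge_zero[of "a w"] by linarith
    then show ?case
      using elim by (simp add: norm_mult mult_mono)
  qed
  then show ?thesis
    using assms unfolding Linf_def by auto
qed

locale kernel_setup =
  fixes M :: "'w measure" and S :: "'s measure" and k :: "'s \<times> 's \<times> 'w \<Rightarrow> complex"
  assumes k_measurable[measurable]: "k \<in> borel_measurable (S \<Otimes>\<^sub>M (S \<Otimes>\<^sub>M M))"
    and k_inner_integral: "(\<lambda>(s, w). \<integral>\<^sup>+t. ennreal ((cmod (k (t, s, w)))\<^sup>2) \<partial>S) \<in> borel_measurable (S \<Otimes>\<^sub>M M)"
    and k_square_integral: "nn_Linf M (\<lambda>w. \<integral>\<^sup>+s. \<integral>\<^sup>+t. ennreal ((cmod (k (t, s, w)))\<^sup>2) \<partial>S \<partial>S)"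
    and k_hermitian: "\<forall>t\<in>space S. \<forall>s\<in>space S. \<forall>w\<in>space M. k (t, s, w) = cnj (k (s, t, w))"
    and inner_Linf: "\<forall>f\<in>L2inf S M. \<forall>g\<in>L2inf S M. L2inf_inner S f g \<in> Linf M"
    and T_maps: "\<forall>f\<in>L2inf S M. kernel_op S k f \<in> L2inf S M"
begin

text \<open>The delicate point is measurability of the squared norm of the sum. Expanding it
  expresses it through three inner products, which are measurable by
  \<open>inner_Linf\<close>.\<close>

lemma L2inf_add:
  assumes f: "f \<in> L2inf S M" and g: "g \<in> L2inf S M"
    and fL2: "\<And>w. w \<in> space M \<Longrightarrow> (\<lambda>s. f (s, w)) \<in> L2 S" and gL2: "\<And>w. w \<in> space M \<Longrightarrow> (\<lambda>s. g (s, w)) \<in> L2 S"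
  shows "(\<lambda>z. f z + g z) \<in> L2inf S M"
proof -
  obtain C D where CD: "AE w in M. (\<lambda>s. f (s, w)) \<in> L2 S \<and> sq S (\<lambda>s. f (s, w)) \<le> C"
      "AE w in M. (\<lambda>s. g (s, w)) \<in> L2 S \<and> sq S (\<lambda>s. g (s, w)) \<le> D"
    using L2inf_slices f g by blast
  show ?thesis
  proof (rule L2infI)
  note [measurable] = L2inf_measurable[OF f] L2inf_measurable[OF g]
  show "(\<lambda>z. f z + g z) \<in> borel_measurable (S \<Otimes>\<^sub>M M)"
    by measurable
  show "(\<lambda>s. f (s, w) + g (s, w)) \<in> L2 S" if "w \<in> space M" for w
    by (intro L2_add fL2 gL2 that)
  have [measurable]: "L2inf_inner S f f \<in> borel_measurable M" "L2inf_inner S f g \<in> borel_measurable M" "L2inf_inner S g g \<in> borel_measurable M"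
    using inner_Linf f g by (auto simp: Linf_def)
  have "sq S (\<lambda>s. f (s, w) + g (s, w)) = Re (L2inf_inner S f f w + L2inf_inner S g g w) + 2 * Re (L2inf_inner S f g w)"
    if w: "w \<in> space M" for w
    by (simp add: sq_add L2inf_inner_ip ip_self fL2 gL2 w)
  then show "(\<lambda>w. sq S (\<lambda>s. f (s, w) + g (s, w))) \<in> borel_measurable M"
    by (subst measurable_cong) auto
  show "AE w in M. sq S (\<lambda>s. f (s, w) + g (s, w)) \<le> 2 * C + 2 * D"
    using CD
  proof eventually_elim
    case (elim w)
    then show ?case
      using sq_add_le[of "\<lambda>s. f (s, w)" S "\<lambda>s. g (s, w)"] by simp
  qed
qed
qed

section \<open>The weight q and the subprobabilities \<open>N w\<close>\<close>

definition \<kappa> :: "'s \<Rightarrow> 'w \<Rightarrow> ennreal" where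
  "\<kappa> s w = (\<integral>\<^sup>+t. ennreal ((cmod (k (t, s, w)))\<^sup>2) \<partial>S)"

text \<open>Dividing by this constant makes the weighted measures subprobabilities; the lower bound
  1 keeps the division harmless.\<close>

definition B :: real where
  "B = (SOME C. 1 \<le> C \<and> (AE w in M. (\<integral>\<^sup>+s. \<kappa> s w \<partial>S) \<le> ennreal C))"

lemma B: "1 \<le> B" "AE w in M. (\<integral>\<^sup>+s. \<kappa> s w \<partial>S) \<le> ennreal B"
proof -
  obtain C :: real where C: "AE w in M. (\<integral>\<^sup>+s. \<kappa> s w \<partial>S) \<le> ennreal C"
    using k_square_integral by (auto simp: nn_Linf_def \<kappa>_def)
  have "AE w in M. (\<integral>\<^sup>+s. \<kappa> s w \<partial>S) \<le> ennreal (max 1 C)"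
    using C by eventually_elim (meson order_trans ennreal_leI max.cobounded2)
  then have "\<exists>C. 1 \<le> C \<and> (AE w in M. (\<integral>\<^sup>+s. \<kappa> s w \<partial>S) \<le> ennreal C)"
    by (intro exI[of _ "max 1 C"]) auto
  from someI_ex[OF this] show "1 \<le> B" "AE w in M. (\<integral>\<^sup>+s. \<kappa> s w \<partial>S) \<le> ennreal B"
    unfolding B_def by auto
qed

lemma \<kappa>_measurable[measurable]: "(\<lambda>(s, w). \<kappa> s w) \<in> borel_measurable (S \<Otimes>\<^sub>M M)"
  using k_inner_integral by (simp add: \<kappa>_def)

lemma \<kappa>2_measurable[measurable]: "(\<lambda>w. \<integral>\<^sup>+s. \<kappa> s w \<partial>S) \<in> borel_measurable M"
  using k_square_integral by (simp add: nn_Linf_def \<kappa>_def)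

definition good :: "'w set" where
  "good = {w \<in> space M. (\<integral>\<^sup>+s. \<kappa> s w \<partial>S) \<le> ennreal B}"

lemma good_sets[measurable]: "good \<in> sets M"
  unfolding good_def by measurable

lemma good_AE: "AE w in M. w \<in> good"
  using B(2) AE_space by eventually_elim (simp add: good_def)

text \<open>Off the conull set \<open>good\<close> the weight is 0 and \<open>N w\<close> is the
  null measure, so later statements hold for every w in \<open>space M\<close>. Infinite values of
  \<open>\<kappa>\<close> are discarded too; for good w they form a null set.\<close>

definition q :: "'s \<Rightarrow> 'w \<Rightarrow> real" where
  "q s w = (if w \<in> good \<and> \<kappa> s w \<noteq> \<infinity> then sqrt (enn2real (\<kappa> s w) / B) else 0)"

lemma q_measurable[measurable]: "(\<lambda>(s, w). q s w) \<in> borel_measurable (S \<Otimes>\<^sub>M M)"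
  unfolding q_def by measurable

lemma q_nonneg: "0 \<le> q s w"
  using B(1) by (simp add: q_def)

lemma \<kappa>_finite_AE:
  assumes "w \<in> good"
  shows "AE s in S. \<kappa> s w \<noteq> \<infinity>"
proof (rule nn_integral_PInf_AE)
  have "w \<in> space M"
    using assms by (simp add: good_def)
  then show "(\<lambda>s. \<kappa> s w) \<in> borel_measurable S"
    by measurable
  show "(\<integral>\<^sup>+s. \<kappa> s w \<partial>S) \<noteq> \<infinity>"
    using assms by (auto simp: good_def top_unique)
qed

lemma q_eq_0: "w \<in> good \<Longrightarrow> q s w = 0 \<longleftrightarrow> \<kappa> s w = 0 \<or> \<kappa> s w = \<infinity>"
  using B(1) by (auto simp: q_def enn2real_eq_0_iff)

lemma nn_q:
  assumes w: "w \<in> space M"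
  shows "(\<integral>\<^sup>+s. ennreal ((q s w)\<^sup>2) \<partial>S) = (if w \<in> good then (\<integral>\<^sup>+s. \<kappa> s w \<partial>S) * ennreal (1 / B) else 0)"
proof (cases "w \<in> good")
  case True
  have "(\<integral>\<^sup>+s. ennreal ((q s w)\<^sup>2) \<partial>S) = (\<integral>\<^sup>+s. \<kappa> s w * ennreal (1 / B) \<partial>S)"
    using \<kappa>_finite_AE[OF True]
  proof (intro nn_integral_cong_AE, eventually_elim)
    case (elim s)
    then obtain x where "\<kappa> s w = ennreal x" "0 \<le> x"
      by (cases "\<kappa> s w" rule: ennreal_cases) auto
    then show ?case
      using True B(1) by (simp add: q_def flip: ennreal_mult)
  qed
  also have "\<dots> = (\<integral>\<^sup>+s. \<kappa> s w \<partial>S) * ennreal (1 / B)"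
    using w by (intro nn_integral_multc) measurable
  finally show ?thesis
    using True by simp
qed (simp add: q_def)

lemma nn_q_le_1: "w \<in> space M \<Longrightarrow> (\<integral>\<^sup>+s. ennreal ((q s w)\<^sup>2) \<partial>S) \<le> 1"
proof (cases "w \<in> good")
  case True
  assume w: "w \<in> space M"
  have "(\<integral>\<^sup>+s. \<kappa> s w \<partial>S) * ennreal (1 / B) \<le> ennreal B * ennreal (1 / B)"
    using True by (intro mult_right_mono) (auto simp: good_def)
  also have "\<dots> = 1"
    using B(1) by (simp flip: ennreal_mult)
  finally show ?thesis
    using True by (simp add: nn_q[OF w])
qed (simp add: nn_q)

text \<open>Multiplying \<open>q\<close> by functions with values in \<open>{-1, 1}\<close> stays in \<open>L\<^sup>2\<^sup>,\<^sup>\<infinity>\<close>; this is where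
  measurability of the measures \<open>q(\<cdot>, w)\<^sup>2 \<nu>\<close> in \<open>w\<close> comes from, although \<open>\<nu>\<close> is arbitrary.\<close>

lemma sign_q_L2inf:
  assumes [measurable]: "A \<in> sets S"
  shows "(\<lambda>(s, w). (2 * indicator A s - 1) * of_real (q s w)) \<in> L2inf S M"
proof -
  have eq: "(cmod ((2 * indicator A s - 1) * of_real (q s w)))\<^sup>2 = (q s w)\<^sup>2" for s w
    using q_nonneg by (auto simp: indicator_def norm_mult)
  have "(\<lambda>w. \<integral>\<^sup>+s. ennreal ((q s w)\<^sup>2) \<partial>S) \<in> borel_measurable M"
    by (subst measurable_cong[OF nn_q]) measurable
  moreover have "AE w in M. (\<integral>\<^sup>+s. ennreal ((q s w)\<^sup>2) \<partial>S) \<le> ennreal 1"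
    using AE_space by eventually_elim (simp add: nn_q_le_1)
  ultimately show ?thesis
    unfolding L2inf_def nn_Linf_def using eq by (auto intro!: exI[of _ 1])
qed

definition N :: "'w \<Rightarrow> 's measure" where
  "N w = density S (\<lambda>s. ennreal ((q s w)\<^sup>2))"

lemma q_slice_L2: "w \<in> space M \<Longrightarrow> (\<lambda>s. of_real (q s w)) \<in> L2 S"
  using nn_q_le_1[of w] by (intro L2I_nn(1)[where c=1]) auto

text \<open>Subprobability spaces are nonempty by definition, hence the assumption; empty
  \<open>S\<close> is treated apart in \<open>measurable_eigenexpansion\<close>.\<close>

lemma N_kernel:
  assumes "space S \<noteq> {}"
  shows "N \<in> M \<rightarrow>\<^sub>M subprob_algebra S"
proof (rule measurable_subprob_algebra)
  fix w assume w: "w \<in> space M"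
  have qm[measurable]: "(\<lambda>s. q s w) \<in> borel_measurable S"
    using w by measurable
  show "subprob_space (N w)"
    by (rule subprob_spaceI) (use assms nn_q_le_1[OF w] in \<open>auto simp: N_def emeasure_density cong: nn_integral_cong\<close>)
  show "sets (N w) = sets S"
    by (simp add: N_def)
next
  fix A assume A[measurable]: "A \<in> sets S"
  \<comment> \<open>Half the sum of \<langle>(2 1_A - 1) q, q\<rangle> and \<langle>q, q\<rangle> is
    the integral of q^2 over A. Using 1_A q directly would be circular: its membership in
    \<open>L2inf\<close> already contains the measurability to be proved. \<open>?u\<close> is q
    itself, written as a sign multiple so that one lemma covers both.\<close>
  let ?v = "\<lambda>(s, w). (2 * indicator A s - 1) * of_real (q s w) :: complex"
  let ?u = "\<lambda>(s, w). (2 * indicator (space S) s - 1) * of_real (q s w) :: complex"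
  have v: "?v \<in> L2inf S M" "?u \<in> L2inf S M"
    by (intro sign_q_L2inf A sets.top)+
  have [measurable]: "L2inf_inner S ?v ?u \<in> borel_measurable M" "L2inf_inner S ?u ?u \<in> borel_measurable M"
    using inner_Linf v by (auto simp: Linf_def)
  have "emeasure (N w) A = ennreal (Re (L2inf_inner S ?v ?u w + L2inf_inner S ?u ?u w) / 2)" if w: "w \<in> space M" for w
  proof -
    have qm[measurable]: "(\<lambda>s. q s w) \<in> borel_measurable S"
      using w by measurable
    have int: "integrable S (\<lambda>s. of_real ((q s w)\<^sup>2) :: complex)"
      using L2_ip_integrable[OF q_slice_L2[OF w] q_slice_L2[OF w]] by (simp add: power2_eq_square)
    have intA: "integrable S (\<lambda>s. of_real ((q s w)\<^sup>2) * indicator A s :: complex)"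
      by (rule integrable_times_indicator[OF A int])
    have "L2inf_inner S ?v ?u w = (\<integral>s. 2 * (of_real ((q s w)\<^sup>2) * indicator A s) - of_real ((q s w)\<^sup>2) \<partial>S)"
      unfolding L2inf_inner_def by (intro Bochner_Integration.integral_cong) (auto simp: algebra_simps power2_eq_square indicator_def)
    also have "\<dots> = 2 * (\<integral>s. of_real ((q s w)\<^sup>2) * indicator A s \<partial>S) - (\<integral>s. of_real ((q s w)\<^sup>2) \<partial>S)"
      using int intA by simp
    finally have 1: "L2inf_inner S ?v ?u w = \<dots>" .
    have 2: "L2inf_inner S ?u ?u w = (\<integral>s. of_real ((q s w)\<^sup>2) \<partial>S)"
      unfolding L2inf_inner_def by (intro Bochner_Integration.integral_cong) (auto simp: algebra_simps power2_eq_square indicator_def)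
    have 3: "(\<integral>s. of_real ((q s w)\<^sup>2) * indicator A s \<partial>S) = complex_of_real (\<integral>s. (q s w)\<^sup>2 * indicator A s \<partial>S)"
      by (subst integral_complex_of_real[symmetric]) (intro Bochner_Integration.integral_cong, auto simp: indicator_def)
    have intr: "integrable S (\<lambda>s. (q s w)\<^sup>2 * indicator A s)"
      using integrable_Re[OF intA] by (rule Bochner_Integration.integrable_cong[THEN iffD1, rotated -1]) (auto simp: indicator_def)
    have "emeasure (N w) A = (\<integral>\<^sup>+s. ennreal ((q s w)\<^sup>2 * indicator A s) \<partial>S)"
      unfolding N_def by (subst emeasure_density) (auto intro!: nn_integral_cong simp: indicator_def)
    also have "\<dots> = ennreal (\<integral>s. (q s w)\<^sup>2 * indicator A s \<partial>S)"
      using intr by (intro nn_integral_eq_integral) auto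
    also have "(\<integral>s. (q s w)\<^sup>2 * indicator A s \<partial>S) = Re (L2inf_inner S ?v ?u w + L2inf_inner S ?u ?u w) / 2"
      unfolding 1 2 3 by simp
    finally show ?thesis .
  qed
  then show "(\<lambda>w. emeasure (N w) A) \<in> borel_measurable M"
    by (subst measurable_cong) auto
qed

end

section \<open>Transfer to \<open>S\<close>\<close>

context kernel_setup
begin

lemma N_sets: "sets (N w) = sets S" "space (N w) = space S"
  by (simp_all add: N_def)

lemma measurable_N_iff: "u \<in> borel_measurable (N w) \<longleftrightarrow> u \<in> borel_measurable S"
  by (simp add: N_def)

text \<open>Multiplication by q maps \<open>L2 (N w)\<close> isometrically into \<open>L2 S\<close>;
  this is the dictionary between the two spaces.\<close>

lemma ip_N:
  fixes u v :: "'s \<Rightarrow> complex"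
  assumes w: "w \<in> space M" and [measurable]: "u \<in> borel_measurable S" "v \<in> borel_measurable S"
  shows "ip (N w) u v = ip S (\<lambda>s. of_real (q s w) * u s) (\<lambda>s. of_real (q s w) * v s)"
proof -
  have [measurable]: "(\<lambda>s. q s w) \<in> borel_measurable S"
    using w by measurable
  have "ip (N w) u v = (\<integral>s. (q s w)\<^sup>2 *\<^sub>R (u s * cnj (v s)) \<partial>S)"
    unfolding ip_def N_def by (intro integral_density) auto
  also have "\<dots> = ip S (\<lambda>s. of_real (q s w) * u s) (\<lambda>s. of_real (q s w) * v s)"
    unfolding ip_def by (intro Bochner_Integration.integral_cong) (auto simp: scaleR_conv_of_real power2_eq_square)
  finally show ?thesis .
qed

lemma sq_N:
  fixes u :: "'s \<Rightarrow> complex"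
  assumes w: "w \<in> space M" and [measurable]: "u \<in> borel_measurable S"
  shows "sq (N w) u = sq S (\<lambda>s. of_real (q s w) * u s)"
proof -
  have [measurable]: "(\<lambda>s. q s w) \<in> borel_measurable S"
    using w by measurable
  have "sq (N w) u = (\<integral>s. (q s w)\<^sup>2 *\<^sub>R (cmod (u s))\<^sup>2 \<partial>S)"
    unfolding sq_def N_def by (intro integral_density) auto
  also have "\<dots> = sq S (\<lambda>s. of_real (q s w) * u s)"
    unfolding sq_def by (intro Bochner_Integration.integral_cong) (auto simp: norm_mult power_mult_distrib)
  finally show ?thesis .
qed

lemma L2_N_iff:
  fixes u :: "'s \<Rightarrow> complex"
  assumes w: "w \<in> space M" and [measurable]: "u \<in> borel_measurable S"
  shows "u \<in> L2 (N w) \<longleftrightarrow> (\<lambda>s. of_real (q s w) * u s) \<in> L2 S"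
proof -
  have [measurable]: "(\<lambda>s. q s w) \<in> borel_measurable S"
    using w by measurable
  have "(\<integral>\<^sup>+s. ennreal ((cmod (u s))\<^sup>2) \<partial>N w) = (\<integral>\<^sup>+s. ennreal ((cmod (of_real (q s w) * u s))\<^sup>2) \<partial>S)"
    unfolding N_def by (subst nn_integral_density) (auto simp: norm_mult power_mult_distrib ennreal_mult)
  then show ?thesis
    by (simp add: L2_iff_nn measurable_N_iff)
qed

text \<open>Conjugating the operator by multiplication with q. Division by 0 gives 0, so the kernel
  vanishes wherever one of the weights does.\<close>

definition kq :: "'s \<times> 's \<times> 'w \<Rightarrow> complex" where
  "kq = (\<lambda>(t, s, w). k (t, s, w) / of_real (q t w * q s w))"

lemma kq_measurable[measurable]: "kq \<in> borel_measurable (S \<Otimes>\<^sub>M (S \<Otimes>\<^sub>M M))"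
  unfolding kq_def by measurable

lemma k_norm_sym:
  assumes "t \<in> space S" "s \<in> space S" "w \<in> space M"
  shows "cmod (k (t, s, w)) = cmod (k (s, t, w))"
  using k_hermitian assms by (metis complex_mod_cnj)

lemma k_slice_measurable:
  assumes "w \<in> space M"
  shows "(\<lambda>(t, s). k (t, s, w)) \<in> borel_measurable (S \<Otimes>\<^sub>M S)"
  using assms by measurable

text \<open>Against \<open>N w\<close> the weights cancel the denominators, leaving at most |k|^2.
  The inner integral then runs over the second variable; Hermitian symmetry identifies it with
  \<open>\<kappa>\<close>, whose integral is at most \<open>B\<close> on
  \<open>good\<close>.\<close>

lemma kq_HS:
  assumes ne: "space S \<noteq> {}" and w: "w \<in> space M"
  shows "kslice kq w \<in> L2 (N w \<Otimes>\<^sub>M N w)" "sq (N w \<Otimes>\<^sub>M N w) (kslice kq w) \<le> B"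
proof -
  interpret F: kernel_family M S N
    by unfold_locales (rule N_kernel[OF ne])
  interpret finite_measure_L2 "N w"
    by (rule F.N_L2[OF w])
  have [measurable]: "(\<lambda>s. q s w) \<in> borel_measurable S"
    using w by measurable
  note k_slice_measurable[OF w, measurable]
  have m[measurable]: "kslice kq w \<in> borel_measurable (N w \<Otimes>\<^sub>M N w)"
    by (rule F.kslice_measurable[OF kq_measurable w])
  have rowm: "(\<lambda>s. kslice kq w (t, s)) \<in> borel_measurable S" if "t \<in> space S" for t
    using that w unfolding kslice_def by measurable
  have row: "ennreal ((q t w)\<^sup>2) * (\<integral>\<^sup>+s. ennreal ((cmod (kslice kq w (t, s)))\<^sup>2) \<partial>N w) \<le> (if w \<in> good then \<kappa> t w else 0)"
    if t: "t \<in> space S" for t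
  proof (cases "w \<in> good")
    case True
    have "ennreal ((q t w)\<^sup>2) * (\<integral>\<^sup>+s. ennreal ((cmod (kslice kq w (t, s)))\<^sup>2) \<partial>N w) =
        ennreal ((q t w)\<^sup>2) * (\<integral>\<^sup>+s. ennreal ((q s w)\<^sup>2) * ennreal ((cmod (kslice kq w (t, s)))\<^sup>2) \<partial>S)"
      unfolding N_def using rowm[OF t] by (subst nn_integral_density) auto
    also have "\<dots> = (\<integral>\<^sup>+s. ennreal ((q t w)\<^sup>2) * (ennreal ((q s w)\<^sup>2) * ennreal ((cmod (kslice kq w (t, s)))\<^sup>2)) \<partial>S)"
      using rowm[OF t] by (intro nn_integral_cmult[symmetric]) auto
    also have "\<dots> \<le> \<kappa> t w"
      unfolding \<kappa>_def
    proof (rule nn_integral_mono)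
      fix s assume s: "s \<in> space S"
      have "(q t w)\<^sup>2 * ((q s w)\<^sup>2 * (cmod (kslice kq w (t, s)))\<^sup>2) \<le> (cmod (k (s, t, w)))\<^sup>2"
        unfolding k_norm_sym[OF s t w]
        by (auto simp: kslice_def kq_def norm_divide norm_mult power_divide power_mult_distrib)
      then show "ennreal ((q t w)\<^sup>2) * (ennreal ((q s w)\<^sup>2) * ennreal ((cmod (kslice kq w (t, s)))\<^sup>2)) \<le> ennreal ((cmod (k (s, t, w)))\<^sup>2)"
        by (simp add: ennreal_leI flip: ennreal_mult)
    qed
    finally show ?thesis
      using True by simp
  qed (simp add: q_def)
  have "(\<integral>\<^sup>+x. ennreal ((cmod (kslice kq w x))\<^sup>2) \<partial>(N w \<Otimes>\<^sub>M N w)) =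
      (\<integral>\<^sup>+t. (\<integral>\<^sup>+s. ennreal ((cmod (kslice kq w (t, s)))\<^sup>2) \<partial>N w) \<partial>N w)"
    by (subst nn_integral_fst[symmetric]) auto
  also have "\<dots> = (\<integral>\<^sup>+t. ennreal ((q t w)\<^sup>2) * (\<integral>\<^sup>+s. ennreal ((cmod (kslice kq w (t, s)))\<^sup>2) \<partial>N w) \<partial>S)"
  proof -
    have "(\<lambda>t. \<integral>\<^sup>+s. ennreal ((cmod (kslice kq w (t, s)))\<^sup>2) \<partial>N w) \<in> borel_measurable (N w)"
      by measurable
    then have Sm: "(\<lambda>t. \<integral>\<^sup>+s. ennreal ((cmod (kslice kq w (t, s)))\<^sup>2) \<partial>N w) \<in> borel_measurable S"
      by (simp add: N_def)
    show ?thesis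
      using nn_integral_density[OF _ Sm, of "\<lambda>t. ennreal ((q t w)\<^sup>2)"] by (simp flip: N_def)
  qed
  also have "\<dots> \<le> (\<integral>\<^sup>+t. (if w \<in> good then \<kappa> t w else 0) \<partial>S)"
    by (intro nn_integral_mono row)
  also have "\<dots> \<le> ennreal B"
    using B(1) by (cases "w \<in> good") (auto simp: good_def)
  finally have "(\<integral>\<^sup>+x. ennreal ((cmod (kslice kq w x))\<^sup>2) \<partial>(N w \<Otimes>\<^sub>M N w)) \<le> ennreal B" .
  from L2I_nn[OF m this] show "kslice kq w \<in> L2 (N w \<Otimes>\<^sub>M N w)" "sq (N w \<Otimes>\<^sub>M N w) (kslice kq w) \<le> B"
    using B(1) by auto
qed

lemma kq_family:
  assumes ne: "space S \<noteq> {}"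
  shows "kernel_family.HS_family M S N kq"
proof -
  interpret F: kernel_family M S N
    by unfold_locales (rule N_kernel[OF ne])
  have "hermitian_kernel (N w) (kslice kq w)" if "w \<in> space M" for w
    unfolding hermitian_kernel_def N_sets
  proof (intro ballI)
    fix t s assume "t \<in> space S" "s \<in> space S"
    then have "cnj (k (s, t, w)) = k (t, s, w)"
      using k_hermitian that by metis
    then show "kslice kq w (t, s) = cnj (kslice kq w (s, t))"
      by (simp add: kslice_def kq_def mult.commute)
  qed
  then show ?thesis
    unfolding F.HS_family_def using kq_HS[OF ne] by auto
qed

text \<open>The part of \<open>S\<close> where \<open>q\<close> vanishes does not contribute: Fubini's theorem applies to the finite
  measures \<open>N w\<close> and \<open>|f|\<^sup>2 \<nu>\<close>.\<close>

lemma kernel_op_eq_kop: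
  assumes w: "w \<in> good" and f: "f \<in> L2 S"
  shows "AE t in S. (\<integral>s. k (t, s, w) * f s \<partial>S) = of_real (q t w) * kop (N w) (kslice kq w) (\<lambda>s. f s / of_real (q s w)) t"
proof -
  have wM: "w \<in> space M"
    using w by (simp add: good_def)
  note k_slice_measurable[OF wM, measurable] L2_measurable[OF f, measurable]
  have qm[measurable]: "(\<lambda>s. q s w) \<in> borel_measurable S"
    using wM by measurable
  have \<kappa>m[measurable]: "(\<lambda>s. \<kappa> s w) \<in> borel_measurable S"
    using wM by measurable
  \<comment> \<open>\<open>N w\<close> ignores the points where q vanishes and \<open>Nf\<close>
    those where f does. Both are finite, so null sets in one variable can be exchanged with null
    sets in the other, which \<nu> itself does not permit.\<close>
  define Nf where "Nf = density S (\<lambda>s. ennreal ((cmod (f s))\<^sup>2))"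
  have Nf_sets[measurable_cong]: "sets Nf = sets S"
    by (simp add: Nf_def)
  note N_sets(1)[measurable_cong]
  interpret Nf: finite_measure Nf
  proof
    show "emeasure Nf (space Nf) \<noteq> \<infinity>"
      using nn_sq[OF f] by (simp add: Nf_def emeasure_density cong: nn_integral_cong)
  qed
  interpret Nw: finite_measure "N w"
  proof
    show "emeasure (N w) (space (N w)) \<noteq> \<infinity>"
      using nn_q_le_1[OF wM] by (auto simp: N_def emeasure_density top_unique cong: nn_integral_cong)
  qed
  interpret P: pair_sigma_finite "N w" Nf ..
  have zero_col: "AE t in S. k (t, s, w) = 0" if "s \<in> space S" "\<kappa> s w = 0" for s
  proof -
    have "(\<lambda>t. ennreal ((cmod (k (t, s, w)))\<^sup>2)) \<in> borel_measurable S"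
      using that(1) by measurable
    then have "AE t in S. ennreal ((cmod (k (t, s, w)))\<^sup>2) = 0"
      using that(2) unfolding \<kappa>_def by (subst (asm) nn_integral_0_iff_AE) auto
    then show ?thesis
      by eventually_elim simp
  qed
  have zero_row: "AE s in S. k (t, s, w) = 0" if t: "t \<in> space S" "\<kappa> t w = 0" for t
    using zero_col[OF t] AE_space
  proof eventually_elim
    case (elim s)
    then show ?case
      using k_norm_sym[OF t(1) elim(2) wM] by simp
  qed
  \<comment> \<open>Where q(s) = 0 and \<open>\<kappa>\<close> is finite, \<open>\<kappa>\<close> is
    0, so the column of k at s vanishes almost everywhere. What is needed is the same statement for
    rows.\<close>
  have "AE s in S. AE t in N w. q s w \<noteq> 0 \<or> k (t, s, w) = 0"
    using \<kappa>_finite_AE[OF w] AE_space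
  proof eventually_elim
    case (elim s)
    show ?case
    proof (cases "q s w = 0")
      case True
      then have "\<kappa> s w = 0"
        using q_eq_0[OF w] elim(1) by auto
      from zero_col[OF elim(2) this] show ?thesis
        unfolding N_def by (subst AE_density) (auto elim: eventually_mono)
    qed simp
  qed
  then have "AE s in Nf. AE t in N w. q s w \<noteq> 0 \<or> k (t, s, w) = 0"
    unfolding Nf_def by (subst AE_density) (auto elim: eventually_mono)
  then have "AE t in N w. AE s in Nf. q s w \<noteq> 0 \<or> k (t, s, w) = 0"
    by (subst P.AE_commute) measurable
  then have *: "AE t in S. q t w \<noteq> 0 \<longrightarrow> (AE s in S. f s \<noteq> 0 \<longrightarrow> q s w \<noteq> 0 \<or> k (t, s, w) = 0)"
    unfolding N_def Nf_def by (simp add: AE_density)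
  show ?thesis
    using * \<kappa>_finite_AE[OF w] AE_space
  proof eventually_elim
    case (elim t)
    note elim(3)[measurable]
    show ?case
    proof (cases "q t w = 0")
      case True
      then have "\<kappa> t w = 0"
        using q_eq_0[OF w] elim(2) by auto
      from zero_row[OF elim(3) this] have "(\<integral>s. k (t, s, w) * f s \<partial>S) = 0"
        by (intro integral_eq_zero_AE) (auto elim: eventually_mono)
      then show ?thesis
        using True by simp
    next
      case False
      have "of_real (q t w) * kop (N w) (kslice kq w) (\<lambda>s. f s / of_real (q s w)) t =
          (\<integral>s. of_real (q t w) * (k (t, s, w) / of_real (q t w * q s w) * (f s / of_real (q s w))) \<partial>N w)"
        unfolding kop_def kslice_def kq_def prod.case by (rule integral_mult_right_zero[symmetric])
      also have "\<dots> = (\<integral>s. (q s w)\<^sup>2 *\<^sub>R (of_real (q t w) * (k (t, s, w) / of_real (q t w * q s w) * (f s / of_real (q s w)))) \<partial>S)"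
        unfolding N_def by (intro integral_density) auto
      also have "\<dots> = (\<integral>s. k (t, s, w) * f s \<partial>S)"
      \<comment> \<open>For q(s) \<noteq> 0 the weights cancel; for q(s) = 0 the left side is 0, and
        the exchanged null set statement gives k = 0 or f = 0 on the right.\<close>
      proof (rule integral_cong_AE)
        show "AE s in S. (q s w)\<^sup>2 *\<^sub>R (of_real (q t w) * (k (t, s, w) / of_real (q t w * q s w) * (f s / of_real (q s w)))) = k (t, s, w) * f s"
          using elim(1)[rule_format, OF False]
          by eventually_elim (use False in \<open>auto simp: scaleR_conv_of_real power2_eq_square\<close>)
      qed auto
      finally show ?thesis
        by simp
    qed
  qed
qed

text \<open>Here and below eigenvalues are numbered from \<open>0\<close>; the eigenvectors are set to \<open>0\<close> where the
  eigenvalue vanishes.\<close>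

theorem measurable_eigenexpansion:
  obtains l :: "nat \<Rightarrow> 'w \<Rightarrow> real" and g :: "nat \<Rightarrow> 's \<times> 'w \<Rightarrow> complex" where
    "\<And>n. l n \<in> borel_measurable M"
    "\<And>n. g n \<in> borel_measurable (S \<Otimes>\<^sub>M M)"
    "\<And>w n. w \<in> space M \<Longrightarrow> (\<lambda>s. g n (s, w)) \<in> L2 S"
    "\<And>w n. w \<in> space M \<Longrightarrow> sq S (\<lambda>s. g n (s, w)) = (if l n w = 0 then 0 else 1)"
    "\<And>w i j. w \<in> space M \<Longrightarrow> i \<noteq> j \<Longrightarrow> ip S (\<lambda>s. g i (s, w)) (\<lambda>s. g j (s, w)) = 0"
    "\<And>w n. w \<in> space M \<Longrightarrow> \<bar>l (Suc n) w\<bar> \<le> \<bar>l n w\<bar>"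
    "\<And>w n. w \<in> space M \<Longrightarrow> \<bar>l n w\<bar> \<le> sqrt B"
    "\<And>w. w \<in> space M \<Longrightarrow> (\<lambda>n. l n w) \<longlonglongrightarrow> 0"
    "\<And>f. f \<in> L2inf S M \<Longrightarrow> AE w in M. \<forall>n. sq S (\<lambda>t. kernel_op S k f (t, w) -
        (\<Sum>i<n. of_real (l i w) * ip S (\<lambda>s. f (s, w)) (\<lambda>s. g i (s, w)) * g i (t, w))) \<le> (l n w)\<^sup>2 * sq S (\<lambda>s. f (s, w))"
proof (cases "space S = {}")
  case True
  \<comment> \<open>On empty \<open>S\<close> every norm is 0, so zero eigenvalues and eigenvectors
    do.\<close>
  have "integral\<^sup>L S f = 0" for f :: "'s \<Rightarrow> real"
    using True by (intro integral_eq_zero_AE AE_I2) auto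
  then show thesis
    using B(1) by (intro that[of "\<lambda>_ _. 0" "\<lambda>_ _. 0"]) (auto simp: L2_zero sq_def ip_def)
next
  case ne: False
  interpret F: kernel_family M S N
    by unfold_locales (rule N_kernel[OF ne])
  obtain l :: "nat \<Rightarrow> 'w \<Rightarrow> real" and h where
    l[measurable]: "\<And>n. l n \<in> borel_measurable M" and h[measurable]: "\<And>n. h n \<in> borel_measurable (S \<Otimes>\<^sub>M M)" and
    es: "\<And>w. w \<in> space M \<Longrightarrow> eigensystem (N w) (kslice kq w) (\<lambda>n. l n w) (\<lambda>n s. h n (s, w))"
    using F.spectral_decomposition_family[OF kq_family[OF ne]] by blast
  note es' = es[unfolded eigensystem_def]
  have hL2: "\<And>w n. w \<in> space M \<Longrightarrow> (\<lambda>s. h n (s, w)) \<in> L2 (N w)"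
    and h0: "\<And>w n s. w \<in> space M \<Longrightarrow> l n w = 0 \<Longrightarrow> h n (s, w) = 0"
    and h1: "\<And>w n. w \<in> space M \<Longrightarrow> l n w \<noteq> 0 \<Longrightarrow> sq (N w) (\<lambda>s. h n (s, w)) = 1"
    and horth: "\<And>w i j. w \<in> space M \<Longrightarrow> i \<noteq> j \<Longrightarrow> ip (N w) (\<lambda>s. h i (s, w)) (\<lambda>s. h j (s, w)) = 0"
    and ldec: "\<And>w n. w \<in> space M \<Longrightarrow> \<bar>l (Suc n) w\<bar> \<le> \<bar>l n w\<bar>"
    and lle: "\<And>w n. w \<in> space M \<Longrightarrow> (l n w)\<^sup>2 \<le> sq (N w \<Otimes>\<^sub>M N w) (kslice kq w)"
    and llim: "\<And>w. w \<in> space M \<Longrightarrow> (\<lambda>n. l n w) \<longlonglongrightarrow> 0"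
    and hexp: "\<And>w f n. w \<in> space M \<Longrightarrow> f \<in> L2 (N w) \<Longrightarrow> sq (N w) (\<lambda>t. kop (N w) (kslice kq w) f t -
          (\<Sum>i<n. of_real (l i w) * ip (N w) f (\<lambda>s. h i (s, w)) * h i (t, w))) \<le> (l n w)\<^sup>2 * sq (N w) f"
    using es' by simp_all
  \<comment> \<open>The isometric images in \<open>L2 S\<close> of the eigenvectors found over
    \<open>N w\<close>.\<close>
  define g where "g n = (\<lambda>(s, w). of_real (q s w) * h n (s, w))" for n
  have g[measurable]: "g n \<in> borel_measurable (S \<Otimes>\<^sub>M M)" for n
    unfolding g_def by measurable
  have hm[measurable]: "(\<lambda>s. h n (s, w)) \<in> borel_measurable S" if "w \<in> space M" for n w
    using that by measurable
  have gL2: "(\<lambda>s. g n (s, w)) \<in> L2 S" if w: "w \<in> space M" for n w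
    using hL2[OF w, of n] L2_N_iff[OF w hm[OF w], of n] by (simp add: g_def)
  have gsq: "sq S (\<lambda>s. g n (s, w)) = (if l n w = 0 then 0 else 1)" if w: "w \<in> space M" for n w
    using h0[OF w, of n] h1[OF w, of n] sq_N[OF w hm[OF w], of n] by (auto simp: g_def sq_zero)
  have gorth: "ip S (\<lambda>s. g i (s, w)) (\<lambda>s. g j (s, w)) = 0" if w: "w \<in> space M" and "i \<noteq> j" for i j w
    using horth[OF that] ip_N[OF w hm[OF w] hm[OF w], of i j] by (simp add: g_def)
  have lB: "\<bar>l n w\<bar> \<le> sqrt B" if w: "w \<in> space M" for n w
    using order_trans[OF lle[OF w] kq_HS(2)[OF ne w]] real_sqrt_le_mono[of "(l n w)\<^sup>2" B] by simp
  have exp: "AE w in M. \<forall>n. sq S (\<lambda>t. kernel_op S k f (t, w) -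
        (\<Sum>i<n. of_real (l i w) * ip S (\<lambda>s. f (s, w)) (\<lambda>s. g i (s, w)) * g i (t, w))) \<le> (l n w)\<^sup>2 * sq S (\<lambda>s. f (s, w))"
    if f: "f \<in> L2inf S M" for f
  proof -
    have Tf: "kernel_op S k f \<in> L2inf S M"
      using T_maps f by blast
    note [measurable] = L2inf_measurable[OF f] L2inf_measurable[OF Tf]
    obtain C where "AE w in M. (\<lambda>s. f (s, w)) \<in> L2 S \<and> sq S (\<lambda>s. f (s, w)) \<le> C"
      using L2inf_slices[OF f] by blast
    then show ?thesis
      using good_AE
    proof eventually_elim
      case (elim w)
      then have w: "w \<in> space M" and fw: "(\<lambda>s. f (s, w)) \<in> L2 S"
        by (auto simp: good_def)
      have [measurable]: "(\<lambda>s. q s w) \<in> borel_measurable S" "(\<lambda>s. f (s, w)) \<in> borel_measurable S"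
          "(\<lambda>s. kernel_op S k f (s, w)) \<in> borel_measurable S" "\<And>i. (\<lambda>s. g i (s, w)) \<in> borel_measurable S"
        using w by measurable
      note hm[OF w, measurable]
      \<comment> \<open>The preimage of f under multiplication by q. The part of f living where q =
        0 is lost, so the norm of f' is only bounded by that of f; inner products with g are
        unchanged because g vanishes there too.\<close>
      define f' where "f' s = f (s, w) / of_real (q s w)" for s
      have f'm[measurable]: "f' \<in> borel_measurable S"
        unfolding f'_def by measurable
      have qf': "of_real (q s w) * f' s = (if q s w = 0 then 0 else f (s, w))" for s
        by (simp add: f'_def)
      have f'L2: "f' \<in> L2 (N w)"
        unfolding L2_N_iff[OF w f'm] qf' by (rule L2_cong_cmod[OF fw]) auto
      have sqf': "sq (N w) f' \<le> sq S (\<lambda>s. f (s, w))"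
        unfolding sq_N[OF w f'm] qf' unfolding sq_def
        by (intro integral_mono_AE) (use L2_cong_cmod[OF fw, of "\<lambda>s. if q s w = 0 then 0 else f (s, w)"] fw in \<open>auto simp: L2_def\<close>)
      have ipf': "ip (N w) f' (\<lambda>s. h i (s, w)) = ip S (\<lambda>s. f (s, w)) (\<lambda>s. g i (s, w))" for i
        unfolding ip_N[OF w f'm hm[OF w]] qf' unfolding ip_def
        by (intro Bochner_Integration.integral_cong) (auto simp: g_def)
      let ?D = "\<lambda>n t. kop (N w) (kslice kq w) f' t - (\<Sum>i<n. of_real (l i w) * ip (N w) f' (\<lambda>s. h i (s, w)) * h i (t, w))"
      have km: "kop (N w) (kslice kq w) f' \<in> borel_measurable S"
        using finite_measure_L2.kop_L2(1)[OF F.N_L2[OF w] kq_HS(1)[OF ne w] f'L2]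
        by (auto dest!: L2_measurable simp: measurable_N_iff)
      note km[measurable]
      show ?case
      proof
        fix n
        have "sq S (\<lambda>t. kernel_op S k f (t, w) - (\<Sum>i<n. of_real (l i w) * ip S (\<lambda>s. f (s, w)) (\<lambda>s. g i (s, w)) * g i (t, w))) =
            sq S (\<lambda>t. of_real (q t w) * ?D n t)"
        proof (rule sq_cong_AE)
          show "AE t in S. kernel_op S k f (t, w) - (\<Sum>i<n. of_real (l i w) * ip S (\<lambda>s. f (s, w)) (\<lambda>s. g i (s, w)) * g i (t, w)) =
              of_real (q t w) * ?D n t"
            using kernel_op_eq_kop[OF elim(2) fw]
            by eventually_elim (simp add: kernel_op_def f'_def[symmetric] right_diff_distrib sum_distrib_left ipf' g_def mult_ac)
        qed measurable
        also have "\<dots> = sq (N w) (?D n)"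
          by (rule sq_N[OF w, symmetric]) measurable
        also have "\<dots> \<le> (l n w)\<^sup>2 * sq (N w) f'"
          by (rule hexp[OF w f'L2])
        also have "\<dots> \<le> (l n w)\<^sup>2 * sq S (\<lambda>s. f (s, w))"
          by (intro mult_left_mono sqf') simp
        finally show "sq S (\<lambda>t. kernel_op S k f (t, w) - (\<Sum>i<n. of_real (l i w) * ip S (\<lambda>s. f (s, w)) (\<lambda>s. g i (s, w)) * g i (t, w))) \<le>
            (l n w)\<^sup>2 * sq S (\<lambda>s. f (s, w))" .
      qed
    qed
  qed
  show thesis
    by (rule that[OF l g gL2 gsq gorth ldec lB llim exp])
qed

end

section \<open>The expansion theorem\<close>

context kernel_setup
begin

lemma L2inf_sum:
  fixes u :: "nat \<Rightarrow> 's \<times> 'w \<Rightarrow> complex"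
  assumes "\<And>i. i < n \<Longrightarrow> u i \<in> L2inf S M" "\<And>i w. i < n \<Longrightarrow> w \<in> space M \<Longrightarrow> (\<lambda>s. u i (s, w)) \<in> L2 S"
  shows "(\<lambda>z. \<Sum>i<n. u i z) \<in> L2inf S M"
  using assms
proof (induction n)
  case 0
  show ?case
    by (rule L2infI[where C=0]) (simp_all add: L2_zero sq_zero)
next
  case (Suc n)
  have "(\<lambda>z. (\<Sum>i<n. u i z) + u n z) \<in> L2inf S M"
  proof (rule L2inf_add)
    show "(\<lambda>z. \<Sum>i<n. u i z) \<in> L2inf S M"
      by (rule Suc.IH) (use Suc.prems in simp_all)
    show "(\<lambda>s. \<Sum>i<n. u i (s, w)) \<in> L2 S" if "w \<in> space M" for w
      by (rule L2_sum) (use Suc.prems that in simp)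
  qed (use Suc.prems in simp_all)
  then show ?case
    by simp
qed

end

text \<open>Valid for every f: if the squared modulus is not integrable, the complex and the real
  integral both default to 0.\<close>

lemma L2inf_norm_sq: "L2inf_norm S f w = sqrt (sq S (\<lambda>s. f (s, w)))"
proof -
  have "ip S f f = of_real (sq S f)" for f :: "'a \<Rightarrow> complex"
    unfolding ip_def sq_def integral_complex_of_real[symmetric] complex_norm_square[symmetric] by simp
  then show ?thesis
    by (simp add: L2inf_norm_def L2inf_inner_ip)
qed

lemma sum_shift_1: "(\<Sum>n=1..N. f (n - 1)) = (\<Sum>i<N. f i :: 'a :: comm_monoid_add)" for N :: nat
  by (rule sum.reindex_bij_witness[of _ Suc "\<lambda>n. n - 1"]) auto

theorem theorem3p1:
  fixes M :: "'w measure" and S :: "'s measure" and k :: "'s \<times> 's \<times> 'w \<Rightarrow> complex"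
  assumes dsp: "direct_sum_property M"
    and k_measurable: "k \<in> borel_measurable (S \<Otimes>\<^sub>M (S \<Otimes>\<^sub>M M))"
    and k_inner_integral: "(\<lambda>(s, w). \<integral>\<^sup>+t. ennreal ((cmod (k (t, s, w)))\<^sup>2) \<partial>S) \<in> borel_measurable (S \<Otimes>\<^sub>M M)"
    and k_square_integral: "nn_Linf M (\<lambda>w. \<integral>\<^sup>+s. \<integral>\<^sup>+t. ennreal ((cmod (k (t, s, w)))\<^sup>2) \<partial>S \<partial>S)"
    and k_hermitian: "\<forall>t\<in>space S. \<forall>s\<in>space S. \<forall>w\<in>space M. k (t, s, w) = cnj (k (s, t, w))"
    and inner_Linf: "\<forall>f\<in>L2inf S M. \<forall>g\<in>L2inf S M. L2inf_inner S f g \<in> Linf M"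
    and T_maps: "\<forall>f\<in>L2inf S M. kernel_op S k f \<in> L2inf S M"
  shows "\<exists>(W :: enat \<Rightarrow> 'w set) (g :: enat \<Rightarrow> nat \<Rightarrow> 's \<times> 'w \<Rightarrow> complex) (l :: enat \<Rightarrow> nat \<Rightarrow> 'w \<Rightarrow> complex).
      (\<forall>j. W j \<in> sets M) \<and> disjoint_family W \<and> (\<Union>j. W j) = space M \<and>
      (\<forall>j. 1 \<le> j \<longrightarrow>
         L2inf_orthonormal S M (W j) {n. 1 \<le> n \<and> enat n \<le> j} (g j) \<and>
         (\<forall>n. 1 \<le> n \<and> enat n \<le> j \<longrightarrow> l j n \<in> (\<lambda>a w. indicator (W j) w * a w) ` Linf M)) \<and>
      (\<forall>f\<in>L2inf S M. L2inf_eq S M (L2inf_scale (indicator (W 0)) (kernel_op S k f)) (\<lambda>_. 0)) \<and>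
      Linf_decreases_to_0 M (\<lambda>n w. indicator (W \<infinity>) w * cmod (l \<infinity> n w)) \<and>
      (\<forall>f\<in>L2inf S M. \<exists>G H.
         L2inf_sums S M
           (\<lambda>n. L2inf_scale (\<lambda>w. l \<infinity> n w * L2inf_inner S f (g \<infinity> n) w) (g \<infinity> n)) G \<and>
         L2inf_sums S M
           (\<lambda>j. L2inf_scale (indicator (W (enat j)))
              (\<lambda>z. \<Sum>n=1..j. L2inf_scale (\<lambda>w. l (enat j) n w * L2inf_inner S f (g (enat j) n) w) (g (enat j) n) z)) H \<and>
         L2inf_eq S M (kernel_op S k f) (\<lambda>z. L2inf_scale (indicator (W \<infinity>)) G z + H z))"
proof -
  interpret kernel_setup M S k
    using k_measurable k_inner_integral k_square_integral k_hermitian inner_Linf T_maps by unfold_locales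
  obtain e :: "nat \<Rightarrow> 'w \<Rightarrow> real" and v :: "nat \<Rightarrow> 's \<times> 'w \<Rightarrow> complex" where
    e[measurable]: "\<And>n. e n \<in> borel_measurable M" and v[measurable]: "\<And>n. v n \<in> borel_measurable (S \<Otimes>\<^sub>M M)" and
    vL2: "\<And>w n. w \<in> space M \<Longrightarrow> (\<lambda>s. v n (s, w)) \<in> L2 S" and
    vsq: "\<And>w n. w \<in> space M \<Longrightarrow> sq S (\<lambda>s. v n (s, w)) = (if e n w = 0 then 0 else 1)" and
    vorth: "\<And>w i j. w \<in> space M \<Longrightarrow> i \<noteq> j \<Longrightarrow> ip S (\<lambda>s. v i (s, w)) (\<lambda>s. v j (s, w)) = 0" and
    edec: "\<And>w n. w \<in> space M \<Longrightarrow> \<bar>e (Suc n) w\<bar> \<le> \<bar>e n w\<bar>" and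
    eB: "\<And>w n. w \<in> space M \<Longrightarrow> \<bar>e n w\<bar> \<le> sqrt B" and
    elim: "\<And>w. w \<in> space M \<Longrightarrow> (\<lambda>n. e n w) \<longlonglongrightarrow> 0" and
    expand: "\<And>f. f \<in> L2inf S M \<Longrightarrow> AE w in M. \<forall>n. sq S (\<lambda>t. kernel_op S k f (t, w) -
        (\<Sum>i<n. of_real (e i w) * ip S (\<lambda>s. f (s, w)) (\<lambda>s. v i (s, w)) * v i (t, w))) \<le> (e n w)\<^sup>2 * sq S (\<lambda>s. f (s, w))"
    by (rule measurable_eigenexpansion) (rule that)
  \<comment> \<open>Once an eigenvalue is 0 all later ones are, by the decrease of the moduli; so
    the first zero, counted from 0, equals the number of nonzero eigenvalues. For j = \<infinity>
    the second condition is vacuous.\<close>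
  define W where "W j = {w \<in> space M. (\<forall>i. enat i < j \<longrightarrow> e i w \<noteq> 0) \<and> (\<forall>n. j = enat n \<longrightarrow> e n w = 0)}" for j
  define g where "g j n = (\<lambda>(s, w). indicator (W j) w * v (n - 1) (s, w))" for j n
  define l where "l j n = (\<lambda>w. indicator (W j) w * complex_of_real (e (n - 1) w))" for j n
  have W[measurable]: "W j \<in> sets M" for j
    unfolding W_def by measurable
  have WM: "w \<in> W j \<Longrightarrow> w \<in> space M" for w j
    by (simp add: W_def)
  have disj: "i = j" if "w \<in> W i" "w \<in> W j" for i j w
  proof -
    have not_less: "\<not> i < j" if i: "w \<in> W i" and j: "w \<in> W j" for i j
    proof
      assume "i < j"
      then obtain n where n: "i = enat n"
        by (cases i) simp_all
      have "e n w = 0"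
        using i n unfolding W_def by blast
      moreover have "e n w \<noteq> 0"
        using j n \<open>i < j\<close> unfolding W_def by blast
      ultimately show False
        by simp
    qed
    show ?thesis
      using not_less[OF that] not_less[OF that(2,1)] by (meson linorder_neqE)
  qed
  have W_ex: "\<exists>j. w \<in> W j" if w: "w \<in> space M" for w
  proof (cases "\<exists>n. e n w = 0")
    case True
    define n where "n = (LEAST n. e n w = 0)"
    have "e n w = 0"
      unfolding n_def by (rule LeastI_ex[OF True])
    moreover have "e i w \<noteq> 0" if "i < n" for i
      using that unfolding n_def by (rule not_less_Least)
    ultimately have "w \<in> W (enat n)"
      using w by (simp add: W_def)
    then show ?thesis ..
  next
    case False
    then have "w \<in> W \<infinity>"
      using w by (simp add: W_def)
    then show ?thesis ..
  qed
  have vLinf: "v n \<in> L2inf S M" for n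
  proof (rule L2infI[OF v vL2])
    show "(\<lambda>w. sq S (\<lambda>s. v n (s, w))) \<in> borel_measurable M"
      by (subst measurable_cong[OF vsq]) auto
    show "AE w in M. sq S (\<lambda>s. v n (s, w)) \<le> 1"
      using AE_space by eventually_elim (simp add: vsq)
  qed
  have eLinf: "(\<lambda>w. complex_of_real (e n w)) \<in> Linf M" for n
    unfolding Linf_def using AE_I2[of M "\<lambda>w. cmod (complex_of_real (e n w)) \<le> sqrt B"] eB by auto
  have g_scale: "g j n = L2inf_scale (indicator (W j)) (v (n - 1))" for j n
    by (auto simp: g_def L2inf_scale_def)
  have orthonormal: "L2inf_orthonormal S M (W j) {n. 1 \<le> n \<and> enat n \<le> j} (g j)" for j
    unfolding L2inf_orthonormal_def
  proof (intro conjI ballI impI)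
    fix n assume "n \<in> {n. 1 \<le> n \<and> enat n \<le> j}"
    then have n: "1 \<le> n" "enat n \<le> j"
      by auto
    show "g j n \<in> L2inf_scale (indicator (W j)) ` L2inf S M"
      unfolding g_scale using vLinf by blast
    have "L2inf_inner S (g j n) (g j n) w = indicator (W j) w" if w: "w \<in> space M" for w
    proof (cases "w \<in> W j")
      case True
      have "enat (n - 1) < j"
        using n by (cases j) auto
      then have "e (n - 1) w \<noteq> 0"
        using True by (simp add: W_def)
      then show ?thesis
        using True vsq[OF w, of "n - 1"] by (simp add: L2inf_inner_ip g_def ip_self[OF vL2[OF w]])
    qed (simp add: L2inf_inner_ip g_def ip_def)
    then show "AE w in M. L2inf_inner S (g j n) (g j n) w = indicator (W j) w"
      by (intro AE_I2)
  next
    fix n m assume "n \<in> {n. 1 \<le> n \<and> enat n \<le> j}" "m \<in> {n. 1 \<le> n \<and> enat n \<le> j}" "n \<noteq> m"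
    then have nm: "n - 1 \<noteq> m - 1"
      by auto
    have "L2inf_inner S (g j n) (g j m) w = 0" if "w \<in> space M" for w
      using vorth[OF that nm] by (cases "w \<in> W j") (auto simp: L2inf_inner_ip g_def ip_def)
    then show "AE w in M. L2inf_inner S (g j n) (g j m) w = 0"
      by (intro AE_I2)
  qed
  have decreases: "Linf_decreases_to_0 M (\<lambda>n w. indicator (W \<infinity>) w * cmod (l \<infinity> n w))"
  proof -
    have eq: "(\<lambda>n w. indicator (W \<infinity>) w * cmod (l \<infinity> n w)) = (\<lambda>n w. indicator (W \<infinity>) w * \<bar>e (n - 1) w\<bar> :: real)"
      by (intro ext) (auto simp: l_def indicator_def)
    show ?thesis
      unfolding Linf_decreases_to_0_def eq
    proof (intro conjI allI impI ballI)
      fix n :: nat assume n: "1 \<le> n"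
      have "AE w in M. norm (indicator (W \<infinity>) w * \<bar>e (n - 1) w\<bar>) \<le> sqrt B"
        using B(1) eB by (intro AE_I2) (auto simp: indicator_def)
      then show "(\<lambda>w. indicator (W \<infinity>) w * \<bar>e (n - 1) w\<bar>) \<in> Linf M"
        unfolding Linf_def by auto
      show "AE w in M. indicator (W \<infinity>) w * \<bar>e (Suc n - 1) w\<bar> \<le> indicator (W \<infinity>) w * \<bar>e (n - 1) w\<bar>"
        using n edec[of _ "n - 1"] by (intro AE_I2 mult_left_mono) auto
      show "AE w in M. 0 \<le> indicator (W \<infinity>) w * \<bar>e (n - 1) w\<bar>"
        by simp
    next
      fix u assume "\<forall>n\<ge>1. AE w in M. u w \<le> indicator (W \<infinity>) w * \<bar>e (n - 1) w\<bar>"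
      from this[rule_format, of "Suc _"] have "AE w in M. u w \<le> indicator (W \<infinity>) w * \<bar>e n w\<bar>" for n
        by simp
      then have "AE w in M. \<forall>n. u w \<le> indicator (W \<infinity>) w * \<bar>e n w\<bar>"
        by (simp add: AE_all_countable)
      then show "AE w in M. u w \<le> 0"
        using AE_space
      proof eventually_elim
        case (elim w)
        \<comment> \<open>A lower bound for all members of the sequence lies, almost everywhere,
          below their pointwise limit, which is 0.\<close>
        have "(\<lambda>n. indicator (W \<infinity>) w * \<bar>e n w\<bar>) \<longlonglongrightarrow> indicator (W \<infinity>) w * \<bar>0\<bar>"
          by (intro tendsto_intros \<open>\<And>w. w \<in> space M \<Longrightarrow> (\<lambda>n. e n w) \<longlonglongrightarrow> 0\<close> elim(2))
        then have "(\<lambda>n. indicator (W \<infinity>) w * \<bar>e n w\<bar>) \<longlonglongrightarrow> 0"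
          by simp
        then show ?case
          by (rule LIMSEQ_le_const) (use elim(1) in auto)
      qed
    qed
  qed
  have zero: "L2inf_eq S M (L2inf_scale (indicator (W 0)) (kernel_op S k f)) (\<lambda>_. 0)"
    and series: "\<exists>G H.
         L2inf_sums S M
           (\<lambda>n. L2inf_scale (\<lambda>w. l \<infinity> n w * L2inf_inner S f (g \<infinity> n) w) (g \<infinity> n)) G \<and>
         L2inf_sums S M
           (\<lambda>j. L2inf_scale (indicator (W (enat j)))
              (\<lambda>z. \<Sum>n=1..j. L2inf_scale (\<lambda>w. l (enat j) n w * L2inf_inner S f (g (enat j) n) w) (g (enat j) n) z)) H \<and>
         L2inf_eq S M (kernel_op S k f) (\<lambda>z. L2inf_scale (indicator (W \<infinity>)) G z + H z)"
    if f: "f \<in> L2inf S M" for f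
  proof -
    have Tf: "kernel_op S k f \<in> L2inf S M"
      using T_maps f by blast
    define a where "a i w = complex_of_real (e i w) * L2inf_inner S f (v i) w" for i w
    have aLinf: "(\<lambda>w. a i w) \<in> Linf M" for i
      unfolding a_def using inner_Linf f vLinf by (intro Linf_mult eLinf) auto
    \<comment> \<open>The remainder after n terms. Its bound by \<open>(e n w)\<^sup>2\<close>
      yields both kinds of expansion: it tends to 0 on \<open>W \<infinity>\<close> and is exactly 0
      after n terms on \<open>W (enat n)\<close>.\<close>
    define R where "R n w = (\<lambda>t. kernel_op S k f (t, w) - (\<Sum>i<n. a i w * v i (t, w)))" for n w
    obtain C where C: "AE w in M. (\<lambda>s. f (s, w)) \<in> L2 S \<and> sq S (\<lambda>s. f (s, w)) \<le> C"
      using L2inf_slices[OF f] by blast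
    obtain C' where C': "AE w in M. (\<lambda>t. kernel_op S k f (t, w)) \<in> L2 S \<and> sq S (\<lambda>t. kernel_op S k f (t, w)) \<le> C'"
      using L2inf_slices[OF Tf] by blast
    have R: "AE w in M. w \<in> space M \<and> (\<forall>n. R n w \<in> L2 S \<and> sq S (R n w) \<le> (e n w)\<^sup>2 * sq S (\<lambda>s. f (s, w)))"
      using expand[OF f] C' AE_space
    proof eventually_elim
      case (elim w)
      then show ?case
        unfolding R_def a_def L2inf_inner_ip
        by (auto simp: mult.assoc intro!: L2_diff L2_sum L2_scale vL2)
    qed
    have R0: "AE w in M. \<forall>n. w \<in> W (enat n) \<longrightarrow> (AE t in S. R n w t = 0) \<and> sq S (R n w) = 0"
      using R
    proof eventually_elim
      case (elim w)
      show ?case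
      proof (intro allI impI)
        fix n assume "w \<in> W (enat n)"
        then have "e n w = 0"
          by (simp add: W_def)
        moreover have "sq S (R n w) \<le> (e n w)\<^sup>2 * sq S (\<lambda>s. f (s, w))"
          using elim by blast
        ultimately have "sq S (R n w) = 0"
          using sq_nonneg[of S "R n w"] by simp
        then show "(AE t in S. R n w t = 0) \<and> sq S (R n w) = 0"
          using elim sq_eq_0_iff[of "R n w" S] by simp
      qed
    qed
    have term_eq: "L2inf_scale (\<lambda>w. l j n w * L2inf_inner S f (g j n) w) (g j n) (t, w) =
        indicator (W j) w * (a (n - 1) w * v (n - 1) (t, w))" for j n t w
      by (auto simp: L2inf_scale_def l_def g_def a_def L2inf_inner_ip ip_def indicator_def)
    \<comment> \<open>The sums of the two series are known in advance: they are T f cut down to the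
      union of the \<open>W j\<close> with 1 \<le> j < \<infinity>, and to
      \<open>W \<infinity>\<close>. Membership in \<open>L2inf\<close> is then immediate, and only
      convergence remains.\<close>
    define H where "H = L2inf_scale (indicator (\<Union>j\<in>{1..}. W (enat j))) (kernel_op S k f)"
    define G where "G = L2inf_scale (indicator (W \<infinity>)) (kernel_op S k f)"
    have inH: "w \<in> (\<Union>j\<in>{1..}. W (enat j)) \<longleftrightarrow> 1 \<le> m" if "w \<in> W (enat m)" for w m
      using that disj by fastforce
    have notH: "w \<notin> (\<Union>j\<in>{1..}. W (enat j))" if "w \<in> W \<infinity>" for w
      using that disj[of w \<infinity>] by auto
    have GL: "G \<in> L2inf S M" and HL: "H \<in> L2inf S M"
      unfolding G_def H_def by (intro L2inf_scale_mem Linf_indicator Tf; measurable)+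
    have sums_G: "L2inf_sums S M
        (\<lambda>n. L2inf_scale (\<lambda>w. l \<infinity> n w * L2inf_inner S f (g \<infinity> n) w) (g \<infinity> n)) G"
      unfolding L2inf_sums_def
    proof (intro conjI allI impI GL)
      fix n :: nat
      have "L2inf_scale (\<lambda>w. l \<infinity> n w * L2inf_inner S f (g \<infinity> n) w) (g \<infinity> n) =
          L2inf_scale (\<lambda>w. indicator (W \<infinity>) w * a (n - 1) w) (v (n - 1))"
      proof (intro ext, clarify)
        show "L2inf_scale (\<lambda>w. l \<infinity> n w * L2inf_inner S f (g \<infinity> n) w) (g \<infinity> n) (t, w) =
            L2inf_scale (\<lambda>w. indicator (W \<infinity>) w * a (n - 1) w) (v (n - 1)) (t, w)" for t w
          unfolding term_eq by (simp add: L2inf_scale_def mult.assoc)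
      qed
      also have "\<dots> \<in> L2inf S M"
        by (intro L2inf_scale_mem Linf_mult Linf_indicator vLinf aLinf W)
      finally show "L2inf_scale (\<lambda>w. l \<infinity> n w * L2inf_inner S f (g \<infinity> n) w) (g \<infinity> n) \<in> L2inf S M" .
    next
      let ?d = "\<lambda>N w. L2inf_norm S (\<lambda>z. G z - (\<Sum>n=1..N. L2inf_scale (\<lambda>w. l \<infinity> n w * L2inf_inner S f (g \<infinity> n) w) (g \<infinity> n) z)) w"
      have d: "?d N w = indicator (W \<infinity>) w * sqrt (sq S (R N w))" for N w
      proof -
        have "(\<lambda>s. G (s, w) - (\<Sum>n=1..N. L2inf_scale (\<lambda>w. l \<infinity> n w * L2inf_inner S f (g \<infinity> n) w) (g \<infinity> n) (s, w))) =
            (\<lambda>s. indicator (W \<infinity>) w * R N w s)"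
          unfolding term_eq sum_distrib_left[symmetric] sum_shift_1[of "\<lambda>n. a n w * v n (_, w)"]
          by (auto simp: G_def L2inf_scale_def R_def right_diff_distrib)
        then show ?thesis
          by (simp add: L2inf_norm_sq sq_scale indicator_def)
      qed
      show "AE w in M. (\<lambda>N. ?d N w) \<longlonglongrightarrow> 0"
        unfolding d using R
      proof eventually_elim
        case (elim w)
        have "(\<lambda>N. sqrt (sq S (R N w))) \<longlonglongrightarrow> 0"
        proof (rule tendsto_sandwich[OF _ _ tendsto_const])
          show "\<forall>\<^sub>F n in sequentially. 0 \<le> sqrt (sq S (R n w))"
            by (simp add: sq_nonneg)
          show "\<forall>\<^sub>F n in sequentially. sqrt (sq S (R n w)) \<le> sqrt ((e n w)\<^sup>2 * sq S (\<lambda>s. f (s, w)))"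
            using elim by simp
          have "(\<lambda>n. sqrt ((e n w)\<^sup>2 * sq S (\<lambda>s. f (s, w)))) \<longlonglongrightarrow> sqrt (0\<^sup>2 * sq S (\<lambda>s. f (s, w)))"
            by (intro tendsto_intros \<open>\<And>w. w \<in> space M \<Longrightarrow> (\<lambda>n. e n w) \<longlonglongrightarrow> 0\<close>) (use elim in simp)
          then show "(\<lambda>n. sqrt ((e n w)\<^sup>2 * sq S (\<lambda>s. f (s, w)))) \<longlonglongrightarrow> 0"
            by simp
        qed
        then show ?case
          by (rule tendsto_mult_right_zero)
      qed
    qed
    have sums_H: "L2inf_sums S M
        (\<lambda>j. L2inf_scale (indicator (W (enat j)))
          (\<lambda>z. \<Sum>n=1..j. L2inf_scale (\<lambda>w. l (enat j) n w * L2inf_inner S f (g (enat j) n) w) (g (enat j) n) z)) H"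
      (is "L2inf_sums S M ?u H")
    proof -
      have u: "?u j (t, w) = indicator (W (enat j)) w * (\<Sum>i<j. a i w * v i (t, w))" for j t w
        unfolding L2inf_scale_def[of "indicator _"] prod.case term_eq sum_distrib_left[symmetric]
          sum_shift_1[of "\<lambda>n. a n w * v n (_, w)"]
        by (simp add: indicator_def)
      show ?thesis
        unfolding L2inf_sums_def
      proof (intro conjI allI impI HL)
        fix j :: nat
        have "?u j = L2inf_scale (indicator (W (enat j))) (\<lambda>z. \<Sum>i<j. L2inf_scale (a i) (v i) z)"
        proof (intro ext, clarify)
          show "?u j (t, w) = L2inf_scale (indicator (W (enat j))) (\<lambda>z. \<Sum>i<j. L2inf_scale (a i) (v i) z) (t, w)" for t w
            unfolding u by (simp add: L2inf_scale_def)
        qed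
        also have "\<dots> \<in> L2inf S M"
        proof (intro L2inf_scale_mem Linf_indicator W L2inf_sum)
          show "(\<lambda>s. L2inf_scale (a i) (v i) (s, w)) \<in> L2 S" if "w \<in> space M" for i w
            using L2_scale[OF vL2[OF that]] by (simp add: L2inf_scale_def)
        qed (use aLinf vLinf in auto)
        finally show "?u j \<in> L2inf S M" .
      next
        show "AE w in M. (\<lambda>N. L2inf_norm S (\<lambda>z. H z - (\<Sum>j=1..N. ?u j z)) w) \<longlonglongrightarrow> 0"
          using R R0
        proof eventually_elim
          case (elim w)
          \<comment> \<open>Each w lies in exactly one set of the partition, so at most one term of
            the outer series is nonzero at w.\<close>
          then obtain j where j: "w \<in> W j"
            using W_ex by blast
          have ind: "indicator (W i) w = (if i = j then 1 else 0 :: complex)" for i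
            using j disj by (auto simp: indicator_def)
          show ?case
          proof (cases j)
            case infinity
            have "(\<lambda>s. H (s, w) - (\<Sum>j=1..N. ?u j (s, w))) = (\<lambda>_. 0)" for N
              using notH[of w] j unfolding u ind infinity by (simp add: H_def L2inf_scale_def)
            then show ?thesis
              by (simp add: L2inf_norm_sq sq_zero)
          next
            case (enat m)
            \<comment> \<open>From N = m on the partial sum contains this term, and the difference
              is the remainder \<open>R m w\<close>, a null function. For m = 0 the difference is
              identically 0.\<close>
            have "L2inf_norm S (\<lambda>z. H z - (\<Sum>j=1..N. ?u j z)) w = 0" if N: "m \<le> N" for N
            proof -
              have sum: "(\<Sum>j=1..N. ?u j (s, w)) = (if 1 \<le> m then \<Sum>i<m. a i w * v i (s, w) else 0)" for s
              proof -
                have "(\<Sum>j=1..N. ?u j (s, w)) = (\<Sum>j=1..N. if j = m then \<Sum>i<m. a i w * v i (s, w) else 0)"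
                  unfolding u ind enat by (intro sum.cong) auto
                then show ?thesis
                  using N by simp
              qed
              have "(\<lambda>s. H (s, w) - (\<Sum>j=1..N. ?u j (s, w))) = (\<lambda>s. (if 1 \<le> m then 1 else 0) * R m w s)"
                unfolding sum using inH[of w m] j enat by (auto simp: H_def L2inf_scale_def R_def indicator_def)
              then have "sq S (\<lambda>s. H (s, w) - (\<Sum>j=1..N. ?u j (s, w))) = 0"
                using elim(2) j enat by (simp add: sq_scale)
              then show ?thesis
                by (simp add: L2inf_norm_sq)
            qed
            then show ?thesis
              by (intro tendsto_eventually) (auto simp: eventually_sequentially)
          qed
        qed
      qed
    qed
    have "L2inf_eq S M (kernel_op S k f) (\<lambda>z. L2inf_scale (indicator (W \<infinity>)) G z + H z)"
      unfolding L2inf_eq_def using R R0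
    proof eventually_elim
      case (elim w)
      then obtain j where j: "w \<in> W j"
        using W_ex by blast
      show ?case
      proof (cases j)
        case infinity
        then show ?thesis
          using j notH[of w] by (simp add: G_def H_def L2inf_scale_def)
      next
        case (enat m)
        have "w \<notin> W \<infinity>"
          using j disj[of w j \<infinity>] enat by auto
        \<comment> \<open>On \<open>W 0\<close> both G and H contribute nothing; there the remainder
          before any term is T f itself, which is null.\<close>
        moreover have "AE t in S. kernel_op S k f (t, w) = 0" if "m = 0"
          using elim(2) j enat that by (auto simp: R_def)
        ultimately show ?thesis
          using inH[of w m] j enat by (cases "m = 0") (auto simp: H_def L2inf_scale_def elim: eventually_mono)
      qed
    qed
    with sums_G sums_H show "\<exists>G H.
         L2inf_sums S M
           (\<lambda>n. L2inf_scale (\<lambda>w. l \<infinity> n w * L2inf_inner S f (g \<infinity> n) w) (g \<infinity> n)) G \<and>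
         L2inf_sums S M
           (\<lambda>j. L2inf_scale (indicator (W (enat j)))
              (\<lambda>z. \<Sum>n=1..j. L2inf_scale (\<lambda>w. l (enat j) n w * L2inf_inner S f (g (enat j) n) w) (g (enat j) n) z)) H \<and>
         L2inf_eq S M (kernel_op S k f) (\<lambda>z. L2inf_scale (indicator (W \<infinity>)) G z + H z)"
      by blast
    show "L2inf_eq S M (L2inf_scale (indicator (W 0)) (kernel_op S k f)) (\<lambda>_. 0)"
      unfolding L2inf_eq_def using R0
    proof eventually_elim
      case (elim w)
      show ?case
      proof (cases "w \<in> W 0")
        case True
        then have "AE t in S. R 0 w t = 0"
          using elim by (simp add: zero_enat_def)
        then show ?thesis
          by eventually_elim (simp add: R_def L2inf_scale_def)
      qed (simp add: L2inf_scale_def)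
    qed
  qed
  have "disjoint_family W"
    using disj by (auto simp: disjoint_family_on_def)
  moreover have "(\<Union>j. W j) = space M"
    using W_ex WM by blast
  moreover have "l j n \<in> (\<lambda>a w. indicator (W j) w * a w) ` Linf M" for j n
    unfolding l_def by (rule image_eqI[OF refl eLinf])
  ultimately show ?thesis
    using W orthonormal decreases zero series
    by (intro exI[of _ W] exI[of _ g] exI[of _ l] conjI allI impI ballI)
qed

end
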